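(* Let $\epsilon>0$ be fixed and let $p=p(n)$ be a sequence of probabilities with $n^{-1/6}\ll p\leq 1-\epsilon$. Let $\Delta\sim\Delta(n,p)$ be a random flag complex. \begin{enumerate} \item With high probability as $n\to\infty$, the Betti table of the Stanley--Reisner ideal of $\Delta$ depends on the characteristic. \item More specifically, for any fixed integer $m\geq 2$, with high probability as $n\to\infty$, the Betti table of the Stanley--Reisner ideal of $\Delta$ has $\ell$-torsion for every prime $\ell$ dividing $m$. \end{enumerate}
   Context: Random flag complexes: $G(n,p)$ is the Erdős--Rényi random graph on $n$ vertices, in which each of the $\binom n2$ possible edges is included independently with probability $p$. The flag complex (clique complex) of a graph is the simplicial complex obtained by adjoining a $k$-simplex on every $(k+1)$-clique. $\Delta\sim\Delta(n,p)$ means that $\Delta$ is the clique complex of $G(n,p)$. Asymptotics: $f\ll g$ means $\lim_{n\to\infty} f(n)/g(n)=0$. An event (depending on $n$) occurs with high probability as $n\to\infty$ if its probability tends to $1$ as $n\to\infty$. Betti tables: for a simplicial complex $\Delta$ on vertices $1,\dots,n$, its Stanley--Reisner ideal is the squarefree monomial ideal generated by the monomials $\prod_{i\in\sigma}x_i$ for subsets $\sigma\subseteq\{1,\dots,n\}$ that are not faces of $\Delta$; let $J\subset T=\mathbb{Z}[x_1,\dots,x_n]$ be the ideal generated by these monomials. For a field $k$, the Betti numbers are $$\beta_{i,j}((T/J)\otimes_{\mathbb Z}k)=\dim_k \operatorname{Tor}_i^{T\otimes_{\mathbb Z}k}((T/J)\otimes_{\mathbb Z}k,\,k)_j ,$$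 and the Betti table is the collection of all of these; it depends on $k$ only through the characteristic of $k$. For a prime $\ell$ one has $\beta_{i,j}((T/J)\otimes\mathbb Q)\leq\beta_{i,j}((T/J)\otimes\mathbb F_\ell)$ for all $i,j$. The Betti table of the Stanley--Reisner ideal has $\ell$-torsion if this inequality is strict for some $i,j$. It depends on the characteristic if it has $\ell$-torsion for some prime $\ell$. *)

theory Defs
  imports
    "HOL-Probability.Probability"
    "HOL-Library.Landau_Symbols"
    "HOL-Number_Theory.Residues"
    "HOL-Algebra.Algebraic_Closure_Type"
    "HOL-Algebra.Indexed_Polynomials"
    "HOL-Algebra.QuotRing"
    "Jordan_Normal_Form.Missing_VectorSpace"
begin

section \<open>Random flag complexes\<close>

definition potential_edges :: "nat \<Rightarrow> nat set set" where
  "potential_edges n = {e. e \<subseteq> {1..n} \<and> card e = 2}"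

definition random_graph :: "nat \<Rightarrow> real \<Rightarrow> nat set set pmf" where
  "random_graph n p =
     map_pmf (\<lambda>h. {e \<in> potential_edges n. h e})
       (Pi_pmf (potential_edges n) False (\<lambda>_. bernoulli_pmf p))"

text \<open>A simplicial complex is given by its set of faces, the empty face included. Every vertex of
  \<open>{1..n}\<close> is a face of the clique complex, also when it is isolated.\<close>

definition clique_complex :: "nat \<Rightarrow> nat set set \<Rightarrow> nat set set" where
  "clique_complex n E =
     {\<sigma>. \<sigma> \<subseteq> {1..n} \<and> (\<forall>u\<in>\<sigma>. \<forall>v\<in>\<sigma>. u \<noteq> v \<longrightarrow> {u, v} \<in> E)}"

definition random_flag_complex :: "nat \<Rightarrow> real \<Rightarrow> nat set set pmf" where
  "random_flag_complex n p = map_pmf (clique_complex n) (random_graph n p)"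


section \<open>The graded polynomial ring and Stanley--Reisner ideals\<close>

text \<open>The coefficient ring is a record rather than a type class, because the field \<open>F\<^sub>l\<close> has to
  range over all primes \<open>l\<close> inside a formula. As in \<^theory>\<open>HOL-Algebra.Indexed_Polynomials\<close>,
  a monomial is a multiset of indices (so its degree is its size) and a polynomial is its
  coefficient function; only the multiplication is missing there.\<close>

type_synonym 'a mpoly = "nat multiset \<Rightarrow> 'a"

definition mpoly_ring :: "('a, 'c) ring_scheme \<Rightarrow> nat \<Rightarrow> 'a mpoly ring" where
  "mpoly_ring K n =
     \<lparr>carrier = ring.indexed_pset K {1..n} (carrier K),
      monoid.mult = (\<lambda>f g m. \<Oplus>\<^bsub>K\<^esub>s\<in>{s. s \<subseteq># m}. f s \<otimes>\<^bsub>K\<^esub> g (m - s)),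
      one = ring.indexed_const K \<one>\<^bsub>K\<^esub>,
      zero = ring.indexed_const K \<zero>\<^bsub>K\<^esub>,
      add = ring.indexed_padd K\<rparr>"

definition monomial :: "('a, 'c) ring_scheme \<Rightarrow> nat multiset \<Rightarrow> 'a mpoly" where
  "monomial K m = (\<lambda>m'. if m' = m then \<one>\<^bsub>K\<^esub> else \<zero>\<^bsub>K\<^esub>)"

definition homogeneous :: "('a, 'c) ring_scheme \<Rightarrow> nat \<Rightarrow> int \<Rightarrow> 'a mpoly set" where
  "homogeneous K n d =
     {f \<in> carrier (mpoly_ring K n). \<forall>m. f m \<noteq> \<zero>\<^bsub>K\<^esub> \<longrightarrow> int (size m) = d}"

text \<open>The ring \<open>mpoly_ring k n Quot sr_ideal k n \<Delta>\<close> is \<open>(T/J) \<otimes> k\<close>: the generators of \<open>J\<close> are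
  monomials, and \<open>- \<otimes> k\<close> is right exact, so \<open>(T/J) \<otimes> k\<close> is the quotient of
  \<open>k[x\<^sub>1, \<dots>, x\<^sub>n]\<close> by the ideal that the same monomials generate.\<close>

definition sr_ideal :: "('a, 'c) ring_scheme \<Rightarrow> nat \<Rightarrow> nat set set \<Rightarrow> 'a mpoly set" where
  "sr_ideal K n \<Delta> =
     genideal (mpoly_ring K n) {monomial K (mset_set \<sigma>) | \<sigma>. \<sigma> \<subseteq> {1..n} \<and> \<sigma> \<notin> \<Delta>}"

definition irrelevant_ideal :: "('a, 'c) ring_scheme \<Rightarrow> nat \<Rightarrow> 'a mpoly set" where
  "irrelevant_ideal K n = genideal (mpoly_ring K n) {monomial K {#i#} | i. i \<in> {1..n}}"


section \<open>Graded free resolutions and Tor\<close>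

text \<open>A graded complex \<open>F\<close> of finitely generated free modules is stored as matrices:
  \<open>F\<^sub>i\<close> is the direct sum of the twists \<open>S(- fdeg F i b)\<close> for \<open>b < frank F i\<close>, and
  \<open>fdiff F i\<close> is the matrix of the differential from \<open>F\<^sub>i\<^sub>+\<^sub>1\<close> to \<open>F\<^sub>i\<close>.\<close>

record 'r graded_free_complex =
  frank :: "nat \<Rightarrow> nat"
  fdeg :: "nat \<Rightarrow> nat \<Rightarrow> int"
  fdiff :: "nat \<Rightarrow> nat \<Rightarrow> nat \<Rightarrow> 'r"

definition mat_vec ::
  "('r, 'c) ring_scheme \<Rightarrow> nat \<Rightarrow> nat \<Rightarrow> (nat \<Rightarrow> nat \<Rightarrow> 'r) \<Rightarrow> (nat \<Rightarrow> 'r) \<Rightarrow> nat \<Rightarrow> 'r" where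
  "mat_vec R r s A v = (\<lambda>a\<in>{..<r}. \<Oplus>\<^bsub>R\<^esub>b\<in>{..<s}. A a b \<otimes>\<^bsub>R\<^esub> v b)"

definition zero_vec :: "('r, 'c) ring_scheme \<Rightarrow> nat \<Rightarrow> nat \<Rightarrow> 'r" where
  "zero_vec R r = (\<lambda>a\<in>{..<r}. \<zero>\<^bsub>R\<^esub>)"

definition free_part ::
  "('r, 'c) ring_scheme \<Rightarrow> 'r graded_free_complex \<Rightarrow> nat \<Rightarrow> (nat \<Rightarrow> 'r) set" where
  "free_part R F i = {..<frank F i} \<rightarrow>\<^sub>E carrier R"

definition free_map ::
  "('r, 'c) ring_scheme \<Rightarrow> 'r graded_free_complex \<Rightarrow> nat \<Rightarrow> (nat \<Rightarrow> 'r) \<Rightarrow> nat \<Rightarrow> 'r" where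
  "free_map R F i = mat_vec R (frank F i) (frank F (Suc i)) (fdiff F i)"

text \<open>\<open>F\<close> is a graded free resolution of \<open>S/I\<close>, for \<open>S = K[x\<^sub>1, \<dots>, x\<^sub>n]\<close> and a homogeneous
  ideal \<open>I\<close>, with \<open>F\<^sub>0 = S\<close> and the projection from \<open>S\<close> to \<open>S/I\<close> as augmentation. Exactness at
  \<open>F\<^sub>0\<close> says that the image of \<open>F\<^sub>1\<close> in \<open>S\<close> is \<open>I\<close>.\<close>

definition graded_free_resolution ::
  "('a, 'c) ring_scheme \<Rightarrow> nat \<Rightarrow> 'a mpoly set \<Rightarrow> 'a mpoly graded_free_complex \<Rightarrow> bool" where
  "graded_free_resolution K n I F \<longleftrightarrow>
     (let S = mpoly_ring K n in
       frank F 0 = 1 \<and> fdeg F 0 0 = 0 \<and>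
       (\<forall>i. \<forall>a<frank F i. \<forall>b<frank F (Suc i).
          fdiff F i a b \<in> homogeneous K n (fdeg F (Suc i) b - fdeg F i a)) \<and>
       (\<lambda>v. v 0) ` free_map S F 0 ` free_part S F 1 = I \<and>
       (\<forall>i. {v \<in> free_part S F (Suc i). free_map S F i v = zero_vec S (frank F i)}
              = free_map S F (Suc i) ` free_part S F (Suc (Suc i))))"

text \<open>The \<open>K\<close>-space \<open>(S/J \<otimes> F\<^sub>i)\<^sub>j\<close>: since \<open>S/J \<otimes> F\<^sub>i\<close> is the direct sum of the
  \<open>(S/J)(- fdeg F i b)\<close>, an element is a vector over \<open>S/J\<close> whose \<open>b\<close>-th entry is homogeneous of
  degree \<open>j - fdeg F i b\<close>. The fields \<open>mult\<close> and \<open>one\<close> of a module record play no role.\<close>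

definition tensor_part ::
  "('a, 'c) ring_scheme \<Rightarrow> nat \<Rightarrow> 'a mpoly set \<Rightarrow> 'a mpoly graded_free_complex \<Rightarrow>
     nat \<Rightarrow> int \<Rightarrow> ('a, nat \<Rightarrow> 'a mpoly set) module" where
  "tensor_part K n J F i j =
     (let S = mpoly_ring K n; Q = S Quot J; r = frank F i in
       \<lparr>carrier = (\<Pi>\<^sub>E b\<in>{..<r}. a_r_coset S J ` homogeneous K n (j - fdeg F i b)),
        monoid.mult = undefined,
        one = undefined,
        zero = zero_vec Q r,
        add = (\<lambda>v w. \<lambda>b\<in>{..<r}. v b \<oplus>\<^bsub>Q\<^esub> w b),
        smult = (\<lambda>c v. \<lambda>b\<in>{..<r}. (J +>\<^bsub>S\<^esub> ring.indexed_const K c) \<otimes>\<^bsub>Q\<^esub> v b)\<rparr>)"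

definition tensor_map ::
  "('a, 'c) ring_scheme \<Rightarrow> nat \<Rightarrow> 'a mpoly set \<Rightarrow> 'a mpoly graded_free_complex \<Rightarrow>
     nat \<Rightarrow> (nat \<Rightarrow> 'a mpoly set) \<Rightarrow> nat \<Rightarrow> 'a mpoly set" where
  "tensor_map K n J F i =
     (let S = mpoly_ring K n in
       mat_vec (S Quot J) (frank F i) (frank F (Suc i)) (\<lambda>a b. J +>\<^bsub>S\<^esub> fdiff F i a b))"

definition tor_cycles ::
  "('a, 'c) ring_scheme \<Rightarrow> nat \<Rightarrow> 'a mpoly set \<Rightarrow> 'a mpoly graded_free_complex \<Rightarrow>
     nat \<Rightarrow> int \<Rightarrow> (nat \<Rightarrow> 'a mpoly set) set" where
  "tor_cycles K n J F i j =
     {v \<in> carrier (tensor_part K n J F i j).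
        case i of 0 \<Rightarrow> True
        | Suc h \<Rightarrow> tensor_map K n J F h v = zero_vec (mpoly_ring K n Quot J) (frank F h)}"

definition tor_boundaries ::
  "('a, 'c) ring_scheme \<Rightarrow> nat \<Rightarrow> 'a mpoly set \<Rightarrow> 'a mpoly graded_free_complex \<Rightarrow>
     nat \<Rightarrow> int \<Rightarrow> (nat \<Rightarrow> 'a mpoly set) set" where
  "tor_boundaries K n J F i j =
     tensor_map K n J F i ` carrier (tensor_part K n J F (Suc i) j)"

definition quotient_module :: "('a, 'v, 'c) module_scheme \<Rightarrow> 'v set \<Rightarrow> ('a, 'v set) module" where
  "quotient_module V W =
     \<lparr>carrier = a_rcosets\<^bsub>V\<^esub> W,
      monoid.mult = undefined,
      one = undefined,
      zero = W,
      add = set_add V,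
      smult = (\<lambda>c A. \<Union>v\<in>A. W +>\<^bsub>V\<^esub> (c \<odot>\<^bsub>V\<^esub> v))\<rparr>"

definition homology_part ::
  "('a, 'c) ring_scheme \<Rightarrow> nat \<Rightarrow> 'a mpoly set \<Rightarrow> 'a mpoly graded_free_complex \<Rightarrow>
     nat \<Rightarrow> int \<Rightarrow> ('a, (nat \<Rightarrow> 'a mpoly set) set) module" where
  "homology_part K n J F i j =
     quotient_module (tensor_part K n J F i j\<lparr>carrier := tor_cycles K n J F i j\<rparr>)
       (tor_boundaries K n J F i j)"

text \<open>\<open>Tor\<^sub>i(S/J, S/I)\<^sub>j\<close>, with \<open>Tor\<^sub>i(S/J, -)\<close> as the left derived functor of \<open>S/J \<otimes> -\<close>. As usual
  one resolution is chosen; up to isomorphism Tor does not depend on the choice. One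
  exists for every homogeneous \<open>I\<close> when \<open>K\<close> is a field (\<open>S\<close> is Noetherian).\<close>

definition graded_tor ::
  "('a, 'c) ring_scheme \<Rightarrow> nat \<Rightarrow> 'a mpoly set \<Rightarrow> 'a mpoly set \<Rightarrow>
     nat \<Rightarrow> int \<Rightarrow> ('a, (nat \<Rightarrow> 'a mpoly set) set) module" where
  "graded_tor K n J I i j = homology_part K n J (SOME F. graded_free_resolution K n I F) i j"


section \<open>Betti tables and their torsion\<close>

definition betti :: "('a, 'c) ring_scheme \<Rightarrow> nat \<Rightarrow> nat set set \<Rightarrow> nat \<Rightarrow> int \<Rightarrow> nat" where
  "betti K n \<Delta> i j =
     vectorspace.dim K (graded_tor K n (sr_ideal K n \<Delta>) (irrelevant_ideal K n) i j)"

definition has_torsion :: "nat \<Rightarrow> nat \<Rightarrow> nat set set \<Rightarrow> bool" where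
  "has_torsion l n \<Delta> \<longleftrightarrow>
     (\<exists>i j. betti (ring_of_type_algebra :: rat ring) n \<Delta> i j
              < betti (residue_ring (int l)) n \<Delta> i j)"

definition depends_on_characteristic :: "nat \<Rightarrow> nat set set \<Rightarrow> bool" where
  "depends_on_characteristic n \<Delta> \<longleftrightarrow> (\<exists>l::nat. Factorial_Ring.prime l \<and> has_torsion l n \<Delta>)"

end

theory Submission
  imports Defs
begin

text \<open>Resolve \<open>k\<close> by the Koszul complex instead of the chosen resolution. Then
  \<open>Tor\<^sub>i(S/J, k)\<^sub>j\<close> is the homology of a complex of vector spaces whose differentials are integer
  matrices independent of \<open>k\<close>, so a Betti number is a number of basis elements minus two ranks.
  Ranks can only drop modulo \<open>l\<close>, and one of them drops strictly if some \<open>l * y\<close> is an integral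
  boundary but \<open>y\<close> is not. The part of squarefree multidegree \<open>W\<close> is the cochain complex
  of \<open>\<Delta>\<close> restricted to \<open>W\<close> (Hochster), so \<open>l\<close>-torsion in the second cohomology of one induced subcomplex
  suffices.

  For every prime \<open>l\<close> there is a graph on \<open>v = 4 * l + 5\<close> vertices whose clique complex is a Moore space
  with such torsion, and whose vertices can be ordered so that each has at most 5 earlier
  neighbours. Split \<open>{1..n}\<close> into \<open>v\<close> blocks of size \<open>N = n div v\<close> and embed the vertices greedily, the
  \<open>k\<close>-th one into the \<open>k\<close>-th block. Each of the \<open>N\<close> candidates is suitable with probability at
  least \<open>p ^ 5 * \<epsilon> ^ v\<close>, and independently of the others, so the embedding fails with probability at most
  \<open>v * (1 - p ^ 5 * \<epsilon> ^ v) ^ N\<close>, which tends to 0 because \<open>n * p ^ 6\<close> tends to infinity.\<close>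

section \<open>The multivariate polynomial ring\<close>

text \<open>Two obstacles shape the proof. The definition of Tor picks a resolution by
  \<open>SOME\<close>, and nothing is known about it except that it is a resolution. So the
  comparison theorem is proved with homogeneous chain maps and homotopies, and it is used twice, as
  an inequality of dimensions in either direction. The second obstacle is that one density p has to
  serve every prime l. The number of edges from a new vertex back to the embedded ones must be
  bounded independently of l, while the size of the complex may only enter through the constant
  \<epsilon> ^ v. That constant pays for the non-edges: the copy has to be induced, since an
  additional edge could create faces that destroy the torsion. Placing the vertices in successive
  blocks ensures that the edges tested for a new vertex have not been inspected before. Torsion is
  detected by integers alone. A cochain whose coboundary is l * y sums to 1 around a 4-cycle. If y
  were an integral coboundary, subtracting l times a primitive of y would leave a cocycle, whose sum
  around that cycle must be 0, and l would divide 1.\<close>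

lemma finite_submultisets: "finite {s. s \<subseteq># (m :: 'b multiset)}"
proof (induction m)
  case (add x m)
  have "{s. s \<subseteq># add_mset x m} \<subseteq> {s. s \<subseteq># m} \<union> add_mset x ` {s. s \<subseteq># m}"
  proof
    fix s assume s: "s \<in> {s. s \<subseteq># add_mset x m}"
    show "s \<in> {s. s \<subseteq># m} \<union> add_mset x ` {s. s \<subseteq># m}"
    proof (cases "x \<in># s")
      case True
      then obtain t where "s = add_mset x t" by (metis insert_DiffM)
      with s show ?thesis by auto
    next
      case False
      then have "count s a \<le> count m a" for a
        using s mset_subset_eq_count[of s "add_mset x m" a] by (cases "a = x") (auto simp: not_in_iff)
      then show ?thesis by (simp add: subseteq_mset_def)
    qed
  qed
  with add show ?case by (meson finite_UnI finite_imageI finite_subset)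
qed simp

lemma diff_diff_submultiset: "s \<subseteq># m \<Longrightarrow> m - (m - s) = s"
  by (auto simp: subset_mset.le_iff_add)

lemma (in abelian_monoid) finsum_Sigma:
  assumes "finite A" "\<And>a. a \<in> A \<Longrightarrow> finite (B a)"
    and "\<And>a b. a \<in> A \<Longrightarrow> b \<in> B a \<Longrightarrow> f a b \<in> carrier G"
  shows "(\<Oplus>a\<in>A. \<Oplus>b\<in>B a. f a b) = (\<Oplus>x\<in>Sigma A B. f (fst x) (snd x))"
  using assms
proof (induction A rule: finite_induct)
  case (insert a A)
  have Sig: "Sigma (insert a A) B = Pair a ` B a \<union> Sigma A B" by auto
  have "(\<Oplus>x\<in>Sigma (insert a A) B. f (fst x) (snd x)) =
      (\<Oplus>x\<in>Pair a ` B a. f (fst x) (snd x)) \<oplus> (\<Oplus>x\<in>Sigma A B. f (fst x) (snd x))"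
    unfolding Sig using insert by (intro finsum_Un_disjoint) auto
  also have "(\<Oplus>x\<in>Pair a ` B a. f (fst x) (snd x)) = (\<Oplus>b\<in>B a. f a b)"
    using insert by (subst finsum_reindex) (auto simp: inj_on_def)
  finally show ?case using insert by (auto simp: Pi_iff)
qed simp

lemma (in abelian_monoid) finsum_single:
  assumes "i \<in> A" "finite A" "f i \<in> carrier G" "\<And>j. j \<in> A \<Longrightarrow> j \<noteq> i \<Longrightarrow> f j = \<zero>"
  shows "finsum G f A = f i"
proof -
  have c: "f \<in> A \<rightarrow> carrier G" using assms by (metis Pi_I zero_closed)
  have "finsum G f A = finsum G (\<lambda>j. if i = j then f j else \<zero>) A"
    using c assms by (intro finsum_cong') auto
  also have "\<dots> = f i"
    using c assms by (intro add.finprod_singleton) auto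
  finally show ?thesis .
qed

locale poly_over = field K for K :: "('a, 'c) ring_scheme" (structure) +
  fixes n :: nat
begin

abbreviation S where "S \<equiv> mpoly_ring K n"

definition mterm :: "'a \<Rightarrow> nat multiset \<Rightarrow> 'a mpoly" where
  "mterm c s = (\<lambda>m. if m = s then c else \<zero>)"

definition vars_ok :: "nat multiset \<Rightarrow> bool" where
  "vars_ok m \<longleftrightarrow> set_mset m \<subseteq> {1..n}"

lemma vars_ok_simps [simp]: "vars_ok {#}" "vars_ok (s + t) \<longleftrightarrow> vars_ok s \<and> vars_ok t"
  "vars_ok (add_mset i t) \<longleftrightarrow> i \<in> {1..n} \<and> vars_ok t"
  by (auto simp: vars_ok_def)

lemma vars_ok_diff: "vars_ok m \<Longrightarrow> vars_ok (m - s)"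
  by (auto simp: vars_ok_def dest: in_diffD)

lemma indexed_const_mterm: "indexed_const c = mterm c {#}"
  by (auto simp: indexed_const_def mterm_def)

lemma monomial_mterm: "monomial K m = mterm \<one> m"
  by (auto simp: monomial_def mterm_def)

lemma mterm_pset:
  assumes "c \<in> carrier K" "vars_ok m"
  shows "mterm c m \<in> indexed_pset {1..n} (carrier K)"
  using assms(2)
proof (induction m)
  case empty
  show ?case using assms(1) by (simp add: indexed_const_mterm [symmetric] indexed_pset.indexed_const)
next
  case (add i m)
  have "mterm c (add_mset i m) = indexed_pmult (mterm c m) i"
    by (rule ext) (auto simp: mterm_def indexed_pmult_def dest: insert_DiffM)
  with add show ?case by (auto intro: indexed_pset.indexed_pmult)
qed

text \<open>The carrier is generated inductively by constants, sums and multiplication by variables.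
  A finitely supported function is built up inside it by induction on a finite set containing the
  support, splitting off one term at a time.\<close>

lemma finsupp_pset:
  assumes "\<And>m. f m \<in> carrier K" "finite {m. f m \<noteq> \<zero>}" "\<And>m. f m \<noteq> \<zero> \<Longrightarrow> vars_ok m"
  shows "f \<in> indexed_pset {1..n} (carrier K)"
proof -
  have "finite A \<Longrightarrow> {m. f m \<noteq> \<zero>} \<subseteq> A \<Longrightarrow> (\<And>m. f m \<in> carrier K) \<Longrightarrow> (\<And>m. f m \<noteq> \<zero> \<Longrightarrow> vars_ok m) \<Longrightarrow>
      f \<in> indexed_pset {1..n} (carrier K)" for A f
  proof (induction A arbitrary: f rule: finite_induct)
    case empty
    then have "f = indexed_const \<zero>" by (auto simp: indexed_const_def)
    then show ?case by (simp add: indexed_pset.indexed_const)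
  next
    case (insert s A)
    let ?g = "f(s := \<zero>)"
    have g: "?g \<in> indexed_pset {1..n} (carrier K)"
      using insert.prems by (intro insert.IH) (auto split: if_splits)
    have h: "mterm (f s) s \<in> indexed_pset {1..n} (carrier K)"
    proof (cases "f s = \<zero>")
      case True
      then have "mterm (f s) s = mterm \<zero> {#}" by (auto simp: mterm_def)
      then show ?thesis by (metis mterm_pset vars_ok_simps(1) zero_closed)
    qed (use insert.prems mterm_pset in blast)
    have "f = indexed_padd ?g (mterm (f s) s)"
      using insert.prems(2) by (auto simp: indexed_padd_def mterm_def)
    with g h show ?case by (metis indexed_pset.indexed_padd)
  qed
  from this[OF assms(2) order_refl assms(1,3)] show ?thesis .
qed

text \<open>Membership in an inductively generated set is awkward to test. From here on a polynomial
  is a finitely supported coefficient function in the admissible variables.\<close>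

lemma carrier_S:
  "carrier S = {f. (\<forall>m. f m \<in> carrier K) \<and> finite {m. f m \<noteq> \<zero>} \<and> (\<forall>m. f m \<noteq> \<zero> \<longrightarrow> vars_ok m)}"
proof -
  have "P \<in> indexed_pset {1..n} (carrier K) \<Longrightarrow>
      (\<forall>m. P m \<in> carrier K) \<and> finite {m. P m \<noteq> \<zero>} \<and> (\<forall>m. P m \<noteq> \<zero> \<longrightarrow> vars_ok m)" for P
  proof (induction rule: indexed_pset.induct)
    case (indexed_const k)
    have "{m. indexed_const k m \<noteq> \<zero>} \<subseteq> {{#}}" by (auto simp: indexed_const_def)
    then have "finite {m. indexed_const k m \<noteq> \<zero>}" using finite_subset by blast
    with indexed_const show ?case by (auto simp: indexed_const_def)
  next
    case (indexed_padd P Q)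
    have "{m. indexed_padd P Q m \<noteq> \<zero>} \<subseteq> {m. P m \<noteq> \<zero>} \<union> {m. Q m \<noteq> \<zero>}"
      by (auto simp: indexed_padd_def)
    moreover have "finite ({m. P m \<noteq> \<zero>} \<union> {m. Q m \<noteq> \<zero>})" using indexed_padd.IH by blast
    ultimately have "finite {m. indexed_padd P Q m \<noteq> \<zero>}" by (rule finite_subset)
    moreover have "vars_ok m" if "P m \<oplus> Q m \<noteq> \<zero>" for m
      using that indexed_padd.IH by (metis add.r_one zero_closed)
    ultimately show ?case using indexed_padd.IH by (auto simp: indexed_padd_def)
  next
    case (indexed_pmult P i)
    have "{m. indexed_pmult P i m \<noteq> \<zero>} \<subseteq> add_mset i ` {m. P m \<noteq> \<zero>}"
    proof
      fix m assume "m \<in> {m. indexed_pmult P i m \<noteq> \<zero>}"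
      then have "i \<in># m" "P (m - {#i#}) \<noteq> \<zero>" by (auto simp: indexed_pmult_def split: if_splits)
      then show "m \<in> add_mset i ` {m. P m \<noteq> \<zero>}"
        by (metis (mono_tags, lifting) imageI insert_DiffM mem_Collect_eq)
    qed
    then have "finite {m. indexed_pmult P i m \<noteq> \<zero>}" using indexed_pmult.IH finite_subset by blast
    moreover have "vars_ok m" if "i \<in># m" "P (m - {#i#}) \<noteq> \<zero>" for m
    proof -
      have "vars_ok (m - {#i#})" using that indexed_pmult.IH by blast
      then have "vars_ok (add_mset i (m - {#i#}))" using indexed_pmult.hyps by simp
      then show ?thesis using that(1) by simp
    qed
    ultimately show ?case using indexed_pmult.IH by (auto simp: indexed_pmult_def)
  qed
  then show ?thesis using finsupp_pset by (auto simp: mpoly_ring_def)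
qed

lemma S_coeff: "f \<in> carrier S \<Longrightarrow> f m \<in> carrier K"
  by (simp add: carrier_S)

lemma mterm_closed [simp, intro]: "c \<in> carrier K \<Longrightarrow> vars_ok m \<Longrightarrow> mterm c m \<in> carrier S"
  using mterm_pset[of c m] by (simp add: mpoly_ring_def)

lemma S_add: "f \<oplus>\<^bsub>S\<^esub> g = (\<lambda>m. f m \<oplus> g m)"
  by (simp add: mpoly_ring_def indexed_padd_def)

lemma S_zero: "\<zero>\<^bsub>S\<^esub> = (\<lambda>m. \<zero>)"
  by (simp add: mpoly_ring_def indexed_zero_def)

lemma S_one: "\<one>\<^bsub>S\<^esub> = mterm \<one> {#}"
  by (simp add: mpoly_ring_def indexed_const_mterm)

lemma S_mult: "f \<otimes>\<^bsub>S\<^esub> g = (\<lambda>m. \<Oplus>s\<in>{s. s \<subseteq># m}. f s \<otimes> g (m - s))"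
  by (simp add: mpoly_ring_def)

text \<open>Both sides sum f t * g u * h w over all decompositions m = t + u + w. A chain t
  \<subseteq> s \<subseteq> m on the left corresponds to the pair of t and u = s - t on the
  right.\<close>

lemma S_mult_assoc:
  assumes "\<And>m. f m \<in> carrier K" "\<And>m. g m \<in> carrier K" "\<And>m. h m \<in> carrier K"
  shows "(f \<otimes>\<^bsub>S\<^esub> g) \<otimes>\<^bsub>S\<^esub> h = f \<otimes>\<^bsub>S\<^esub> (g \<otimes>\<^bsub>S\<^esub> h)"
proof
  fix m :: "nat multiset"
  let ?sub = "\<lambda>m. {s. s \<subseteq># m}"
  let ?F = "\<lambda>s t. f t \<otimes> g (s - t) \<otimes> h (m - s)"
  have "((f \<otimes>\<^bsub>S\<^esub> g) \<otimes>\<^bsub>S\<^esub> h) m = (\<Oplus>s\<in>?sub m. \<Oplus>t\<in>?sub s. ?F s t)"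
    unfolding S_mult using assms finite_submultisets
    by (intro finsum_cong' refl) (auto simp: Pi_iff intro!: finsum_ldistr)
  also have "\<dots> = (\<Oplus>x\<in>Sigma (?sub m) ?sub. ?F (fst x) (snd x))"
    using assms finite_submultisets by (intro finsum_Sigma) auto
  also have "Sigma (?sub m) ?sub = (\<lambda>(t, u). (t + u, t)) ` Sigma (?sub m) (\<lambda>t. ?sub (m - t))"
  proof (intro equalityI subsetI)
    fix x assume "x \<in> Sigma (?sub m) ?sub"
    then obtain s t where x: "x = (s, t)" "s \<subseteq># m" "t \<subseteq># s" by auto
    then have "x = (\<lambda>(t, u). (t + u, t)) (t, s - t)" "s - t \<subseteq># m - t" "t \<subseteq># m"
      by (auto simp: subset_mset.diff_add) (metis subset_mset.le_diff_conv2 subset_mset.order_trans subset_mset.diff_add)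
    then show "x \<in> (\<lambda>(t, u). (t + u, t)) ` Sigma (?sub m) (\<lambda>t. ?sub (m - t))"
      by (metis (mono_tags, lifting) SigmaI image_eqI mem_Collect_eq)
  next
    fix x assume "x \<in> (\<lambda>(t, u). (t + u, t)) ` Sigma (?sub m) (\<lambda>t. ?sub (m - t))"
    then show "x \<in> Sigma (?sub m) ?sub"
      by (auto simp: subset_mset.le_diff_conv2 add.commute)
  qed
  also have "(\<Oplus>x\<in>\<dots>. ?F (fst x) (snd x)) =
      (\<Oplus>x\<in>Sigma (?sub m) (\<lambda>t. ?sub (m - t)). f (fst x) \<otimes> (g (snd x) \<otimes> h (m - fst x - snd x)))"
    using assms by (subst finsum_reindex) (auto simp: inj_on_def case_prod_beta m_assoc intro!: finsum_cong')
  also have "\<dots> = (\<Oplus>t\<in>?sub m. \<Oplus>u\<in>?sub (m - t). f t \<otimes> (g u \<otimes> h (m - t - u)))"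
    using assms finite_submultisets
    by (intro finsum_Sigma [symmetric, where f = "\<lambda>t u. f t \<otimes> (g u \<otimes> h (m - t - u))"]) auto
  also have "\<dots> = (f \<otimes>\<^bsub>S\<^esub> (g \<otimes>\<^bsub>S\<^esub> h)) m"
    unfolding S_mult using assms finite_submultisets
    by (intro finsum_cong' refl) (auto simp: Pi_iff intro!: finsum_rdistr [symmetric])
  finally show "((f \<otimes>\<^bsub>S\<^esub> g) \<otimes>\<^bsub>S\<^esub> h) m = (f \<otimes>\<^bsub>S\<^esub> (g \<otimes>\<^bsub>S\<^esub> h)) m" .
qed

text \<open>Passing to the complement s -> m - s permutes the submultisets of m.\<close>

lemma S_mult_comm:
  assumes "\<And>m. f m \<in> carrier K" "\<And>m. g m \<in> carrier K"
  shows "f \<otimes>\<^bsub>S\<^esub> g = g \<otimes>\<^bsub>S\<^esub> f"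
proof
  fix m :: "nat multiset"
  have im: "{s. s \<subseteq># m} = (\<lambda>s. m - s) ` {s. s \<subseteq># m}"
  proof (intro equalityI subsetI)
    fix s assume "s \<in> {s. s \<subseteq># m}"
    then have "s = m - (m - s)" "m - s \<in> {s. s \<subseteq># m}"
      by (auto simp: subset_mset.le_iff_add)
    then show "s \<in> (\<lambda>s. m - s) ` {s. s \<subseteq># m}" by (rule image_eqI)
  qed auto
  have inj: "inj_on (\<lambda>s. m - s) {s. s \<subseteq># m}"
    by (rule inj_onI) (metis mem_Collect_eq subset_mset.diff_add add_left_cancel)
  have "(f \<otimes>\<^bsub>S\<^esub> g) m = (\<Oplus>s\<in>(\<lambda>s. m - s) ` {s. s \<subseteq># m}. f s \<otimes> g (m - s))"
    unfolding S_mult using im by simp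
  also have "\<dots> = (\<Oplus>s\<in>{s. s \<subseteq># m}. f (m - s) \<otimes> g (m - (m - s)))"
    using inj assms by (intro finsum_reindex) auto
  also have "\<dots> = (g \<otimes>\<^bsub>S\<^esub> f) m"
    unfolding S_mult using assms
    by (intro finsum_cong') (auto simp: m_comm Pi_iff diff_diff_submultiset)
  finally show "(f \<otimes>\<^bsub>S\<^esub> g) m = (g \<otimes>\<^bsub>S\<^esub> f) m" .
qed

lemma mterm_mult:
  assumes "c \<in> carrier K" "\<And>m. f m \<in> carrier K"
  shows "mterm c s \<otimes>\<^bsub>S\<^esub> f = (\<lambda>m. if s \<subseteq># m then c \<otimes> f (m - s) else \<zero>)"
proof
  fix m :: "nat multiset"
  show "(mterm c s \<otimes>\<^bsub>S\<^esub> f) m = (if s \<subseteq># m then c \<otimes> f (m - s) else \<zero>)"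
  proof (cases "s \<subseteq># m")
    case True
    then show ?thesis unfolding S_mult mterm_def using assms
      by (subst finsum_single[of s]) (auto simp: finite_submultisets)
  next
    case False
    then show ?thesis unfolding S_mult mterm_def using assms
      by (intro trans[OF add.finprod_one_eqI]) auto
  qed
qed

lemma mterm_mult_mterm:
  assumes "c \<in> carrier K" "d \<in> carrier K"
  shows "mterm c s \<otimes>\<^bsub>S\<^esub> mterm d t = mterm (c \<otimes> d) (s + t)"
  using assms by (subst mterm_mult) (auto simp: mterm_def fun_eq_iff subset_mset.add_diff_inverse)

text \<open>The support of a product lies in the set of sums of one exponent from each factor, which
  is finite and stays within the admissible variables.\<close>

lemma S_mult_closed:
  assumes "f \<in> carrier S" "g \<in> carrier S"
  shows "f \<otimes>\<^bsub>S\<^esub> g \<in> carrier S"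
proof -
  let ?A = "{m. f m \<noteq> \<zero>}" and ?B = "{m. g m \<noteq> \<zero>}"
  have nz: "\<exists>s t. m = s + t \<and> f s \<noteq> \<zero> \<and> g t \<noteq> \<zero>" if "(f \<otimes>\<^bsub>S\<^esub> g) m \<noteq> \<zero>" for m
  proof (rule ccontr)
    assume *: "\<not> ?thesis"
    have "f s \<otimes> g (m - s) = \<zero>" if "s \<subseteq># m" for s
    proof -
      have "m = s + (m - s)" using that by simp
      with * have "f s = \<zero> \<or> g (m - s) = \<zero>" by blast
      then show ?thesis using assms(1)[THEN S_coeff] assms(2)[THEN S_coeff] by auto
    qed
    then have "(f \<otimes>\<^bsub>S\<^esub> g) m = \<zero>" unfolding S_mult by (intro add.finprod_one_eqI) auto
    with that show False by simp
  qed
  have "{m. (f \<otimes>\<^bsub>S\<^esub> g) m \<noteq> \<zero>} \<subseteq> (\<lambda>(s, t). s + t) ` (?A \<times> ?B)"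
  proof
    fix m :: "nat multiset" assume "m \<in> {m. (f \<otimes>\<^bsub>S\<^esub> g) m \<noteq> \<zero>}"
    then obtain s t where "m = s + t" "f s \<noteq> \<zero>" "g t \<noteq> \<zero>" using nz by blast
    then show "m \<in> (\<lambda>(s, t). s + t) ` (?A \<times> ?B)" by (intro image_eqI[of _ _ "(s, t)"]) auto
  qed
  moreover have "finite ((\<lambda>(s, t). s + t) ` (?A \<times> ?B))"
    using assms unfolding carrier_S by blast
  ultimately have "finite {m. (f \<otimes>\<^bsub>S\<^esub> g) m \<noteq> \<zero>}" by (rule finite_subset)
  moreover have "vars_ok m" if m: "(f \<otimes>\<^bsub>S\<^esub> g) m \<noteq> \<zero>" for m
  proof -
    obtain s t where "m = s + t" "f s \<noteq> \<zero>" "g t \<noteq> \<zero>" using nz[OF m] by blast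
    with assms show ?thesis unfolding carrier_S by auto
  qed
  moreover have "(f \<otimes>\<^bsub>S\<^esub> g) m \<in> carrier K" for m
    unfolding S_mult using assms(1)[THEN S_coeff] assms(2)[THEN S_coeff] by (intro finsum_closed) auto
  ultimately show ?thesis unfolding carrier_S by blast
qed

lemma uminus_closed_S:
  assumes f: "f \<in> carrier S"
  shows "(\<lambda>m. \<ominus> f m) \<in> carrier S"
proof -
  have "\<ominus> f m = \<zero> \<longleftrightarrow> f m = \<zero>" for m using S_coeff[OF f, of m] by auto
  then show ?thesis using f unfolding carrier_S by simp
qed

lemma S_add_closed:
  assumes "f \<in> carrier S" "g \<in> carrier S"
  shows "f \<oplus>\<^bsub>S\<^esub> g \<in> carrier S"
proof -
  have c: "carrier S = indexed_pset {1..n} (carrier K)" by (simp add: mpoly_ring_def)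
  have a: "f \<oplus>\<^bsub>S\<^esub> g = indexed_padd f g" by (simp add: mpoly_ring_def)
  show ?thesis using assms unfolding c a by (rule indexed_pset.indexed_padd)
qed

lemma S_cring: "cring S"
proof (rule cringI)
  show "abelian_group S"
  proof (rule abelian_groupI)
    fix x y assume "x \<in> carrier S" "y \<in> carrier S"
    then show "x \<oplus>\<^bsub>S\<^esub> y \<in> carrier S"
      by (rule S_add_closed)
  next
    show "\<zero>\<^bsub>S\<^esub> \<in> carrier S" by (simp add: carrier_S S_zero)
  next
    fix x assume x: "x \<in> carrier S"
    from x have "(\<lambda>m. \<ominus> x m) \<in> carrier S" by (rule uminus_closed_S)
    moreover have "(\<lambda>m. \<ominus> x m) \<oplus>\<^bsub>S\<^esub> x = \<zero>\<^bsub>S\<^esub>" using x[THEN S_coeff] by (auto simp: S_add S_zero l_neg)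
    ultimately show "\<exists>y\<in>carrier S. y \<oplus>\<^bsub>S\<^esub> x = \<zero>\<^bsub>S\<^esub>" by blast
  qed (auto simp: S_add S_zero S_coeff intro!: ext a_assoc a_comm)
  show "comm_monoid S"
  proof (rule comm_monoidI)
    fix x y z assume "x \<in> carrier S" "y \<in> carrier S" "z \<in> carrier S"
    then show "(x \<otimes>\<^bsub>S\<^esub> y) \<otimes>\<^bsub>S\<^esub> z = x \<otimes>\<^bsub>S\<^esub> (y \<otimes>\<^bsub>S\<^esub> z)" by (intro S_mult_assoc S_coeff)
  next
    fix x y assume "x \<in> carrier S" "y \<in> carrier S"
    then show "x \<otimes>\<^bsub>S\<^esub> y = y \<otimes>\<^bsub>S\<^esub> x" by (intro S_mult_comm S_coeff)
  next
    fix x assume "x \<in> carrier S"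
    then show "\<one>\<^bsub>S\<^esub> \<otimes>\<^bsub>S\<^esub> x = x" by (simp add: S_one mterm_mult S_coeff)
  qed (auto simp: S_mult_closed S_one)
  fix x y z assume "x \<in> carrier S" "y \<in> carrier S" "z \<in> carrier S"
  then have xyz: "\<And>m. x m \<in> carrier K" "\<And>m. y m \<in> carrier K" "\<And>m. z m \<in> carrier K"
    using S_coeff by blast+
  show "(x \<oplus>\<^bsub>S\<^esub> y) \<otimes>\<^bsub>S\<^esub> z = x \<otimes>\<^bsub>S\<^esub> z \<oplus>\<^bsub>S\<^esub> y \<otimes>\<^bsub>S\<^esub> z"
  proof
    fix m
    have "((x \<oplus>\<^bsub>S\<^esub> y) \<otimes>\<^bsub>S\<^esub> z) m = (\<Oplus>s\<in>{s. s \<subseteq># m}. x s \<otimes> z (m - s) \<oplus> y s \<otimes> z (m - s))"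
      unfolding S_mult S_add using xyz by (intro finsum_cong') (auto simp: l_distr)
    also have "\<dots> = (x \<otimes>\<^bsub>S\<^esub> z \<oplus>\<^bsub>S\<^esub> y \<otimes>\<^bsub>S\<^esub> z) m"
      unfolding S_mult S_add using xyz by (intro finsum_addf) auto
    finally show "((x \<oplus>\<^bsub>S\<^esub> y) \<otimes>\<^bsub>S\<^esub> z) m = (x \<otimes>\<^bsub>S\<^esub> z \<oplus>\<^bsub>S\<^esub> y \<otimes>\<^bsub>S\<^esub> z) m" .
  qed
qed

end

sublocale poly_over \<subseteq> S: cring "mpoly_ring K n"
  by (rule S_cring)

context poly_over
begin

lemma S_minus: "f \<in> carrier S \<Longrightarrow> \<ominus>\<^bsub>S\<^esub> f = (\<lambda>m. \<ominus> f m)"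
proof -
  assume f: "f \<in> carrier S"
  from f have "(\<lambda>m. \<ominus> f m) \<in> carrier S" by (rule uminus_closed_S)
  moreover have "(\<lambda>m. \<ominus> f m) \<oplus>\<^bsub>S\<^esub> f = \<zero>\<^bsub>S\<^esub>" using f[THEN S_coeff] by (auto simp: S_add S_zero l_neg)
  ultimately show ?thesis using f S.minus_equality by blast
qed

lemma S_finsum_coeff:
  assumes "finite A" "\<And>a. a \<in> A \<Longrightarrow> f a \<in> carrier S"
  shows "(\<Oplus>\<^bsub>S\<^esub>a\<in>A. f a) m = (\<Oplus>a\<in>A. f a m)"
  using assms
  by (induction A rule: finite_induct) (auto simp: S_zero S_add S_coeff Pi_iff)

end

section \<open>Graded free modules and chain maps\<close>

definition vset :: "('r, 'c) ring_scheme \<Rightarrow> nat \<Rightarrow> (nat \<Rightarrow> 'r) set" where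
  "vset R r = {..<r} \<rightarrow>\<^sub>E carrier R"

definition vadd :: "('r, 'c) ring_scheme \<Rightarrow> nat \<Rightarrow> (nat \<Rightarrow> 'r) \<Rightarrow> (nat \<Rightarrow> 'r) \<Rightarrow> nat \<Rightarrow> 'r" where
  "vadd R r v w = (\<lambda>a\<in>{..<r}. v a \<oplus>\<^bsub>R\<^esub> w a)"

definition vsub :: "('r, 'c) ring_scheme \<Rightarrow> nat \<Rightarrow> (nat \<Rightarrow> 'r) \<Rightarrow> (nat \<Rightarrow> 'r) \<Rightarrow> nat \<Rightarrow> 'r" where
  "vsub R r v w = (\<lambda>a\<in>{..<r}. v a \<ominus>\<^bsub>R\<^esub> w a)"

definition vscale :: "('r, 'c) ring_scheme \<Rightarrow> nat \<Rightarrow> 'r \<Rightarrow> (nat \<Rightarrow> 'r) \<Rightarrow> nat \<Rightarrow> 'r" where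
  "vscale R r c v = (\<lambda>a\<in>{..<r}. c \<otimes>\<^bsub>R\<^esub> v a)"

definition uvec :: "('r, 'c) ring_scheme \<Rightarrow> nat \<Rightarrow> nat \<Rightarrow> nat \<Rightarrow> 'r" where
  "uvec R r b = (\<lambda>a\<in>{..<r}. if a = b then \<one>\<^bsub>R\<^esub> else \<zero>\<^bsub>R\<^esub>)"

text \<open>Maps between free modules are functions on vectors rather than matrices, so that
  compositions and differences of matrix actions stay in the class without matrix
  arithmetic.\<close>

definition linop ::
  "('r, 'c) ring_scheme \<Rightarrow> nat \<Rightarrow> nat \<Rightarrow> ((nat \<Rightarrow> 'r) \<Rightarrow> nat \<Rightarrow> 'r) \<Rightarrow> bool" where
  "linop R r s L \<longleftrightarrow> (\<forall>v\<in>vset R r. L v \<in> vset R s) \<and>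
     (\<forall>v\<in>vset R r. \<forall>w\<in>vset R r. L (vadd R r v w) = vadd R s (L v) (L w)) \<and>
     (\<forall>c\<in>carrier R. \<forall>v\<in>vset R r. L (vscale R r c v) = vscale R s c (L v))"

lemma vset_nth: "v \<in> vset R r \<Longrightarrow> a < r \<Longrightarrow> v a \<in> carrier R"
  by (auto simp: vset_def)

lemma vset_eqI: "v \<in> vset R r \<Longrightarrow> w \<in> vset R r \<Longrightarrow> (\<And>a. a < r \<Longrightarrow> v a = w a) \<Longrightarrow> v = w"
  unfolding vset_def by (rule PiE_ext) auto

lemma free_part_vset: "free_part R F i = vset R (frank F i)"
  by (simp add: free_part_def vset_def)

lemma linop_closed: "linop R r s L \<Longrightarrow> v \<in> vset R r \<Longrightarrow> L v \<in> vset R s"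
  by (auto simp: linop_def)

lemma linop_add: "linop R r s L \<Longrightarrow> v \<in> vset R r \<Longrightarrow> w \<in> vset R r \<Longrightarrow>
    L (vadd R r v w) = vadd R s (L v) (L w)"
  by (auto simp: linop_def)

lemma linop_scale: "linop R r s L \<Longrightarrow> c \<in> carrier R \<Longrightarrow> v \<in> vset R r \<Longrightarrow>
    L (vscale R r c v) = vscale R s c (L v)"
  by (auto simp: linop_def)

lemma linop_comp: "linop R r s L \<Longrightarrow> linop R s t L' \<Longrightarrow> linop R r t (\<lambda>v. L' (L v))"
  by (auto simp: linop_def)

context cring
begin

lemma vadd_closed: "v \<in> vset R r \<Longrightarrow> w \<in> vset R r \<Longrightarrow> vadd R r v w \<in> vset R r"
  by (auto simp: vset_def vadd_def)

lemma vsub_closed: "v \<in> vset R r \<Longrightarrow> w \<in> vset R r \<Longrightarrow> vsub R r v w \<in> vset R r"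
  by (auto simp: vset_def vsub_def)

lemma vscale_closed: "c \<in> carrier R \<Longrightarrow> v \<in> vset R r \<Longrightarrow> vscale R r c v \<in> vset R r"
  by (auto simp: vset_def vscale_def)

lemma uvec_closed: "uvec R r b \<in> vset R r"
  by (auto simp: vset_def uvec_def)

lemma zero_vec_closed: "zero_vec R r \<in> vset R r"
  by (auto simp: vset_def zero_vec_def)

text \<open>Reduces compatibility of linear maps with differences to the two closure properties in
  \<open>linop\<close>.\<close>

lemma vsub_eq: "v \<in> vset R r \<Longrightarrow> w \<in> vset R r \<Longrightarrow> vsub R r v w = vadd R r v (vscale R r (\<ominus> \<one>) w)"
  by (rule ext) (auto simp: vsub_def vadd_def vscale_def a_minus_def l_minus vset_nth)

lemma vsub_self: "v \<in> vset R r \<Longrightarrow> vsub R r v v = zero_vec R r"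
  by (rule ext) (auto simp: vsub_def zero_vec_def vset_nth r_neg a_minus_def)

lemma vsub_zero: "v \<in> vset R r \<Longrightarrow> vsub R r v (zero_vec R r) = v"
  by (rule vset_eqI[of _ R r]) (auto simp: vsub_closed zero_vec_closed, auto simp: vsub_def zero_vec_def vset_nth a_minus_def)

lemma linop_zero: "linop R r s L \<Longrightarrow> L (zero_vec R r) = zero_vec R s"
proof -
  assume L: "linop R r s L"
  have "zero_vec R r = vscale R r \<zero> (zero_vec R r)" by (auto simp: zero_vec_def vscale_def)
  then have "L (zero_vec R r) = vscale R s \<zero> (L (zero_vec R r))"
    using linop_scale[OF L zero_closed zero_vec_closed] by simp
  also have "\<dots> = zero_vec R s"
    using linop_closed[OF L zero_vec_closed] by (auto simp: vscale_def zero_vec_def vset_nth)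
  finally show ?thesis .
qed

lemma linop_sub: "linop R r s L \<Longrightarrow> v \<in> vset R r \<Longrightarrow> w \<in> vset R r \<Longrightarrow>
    L (vsub R r v w) = vsub R s (L v) (L w)"
  by (simp add: vsub_eq linop_add linop_scale vscale_closed linop_closed)

lemma linop_diff:
  assumes "linop R r s L" "linop R r s L'"
  shows "linop R r s (\<lambda>v. vsub R s (L v) (L' v))"
  unfolding linop_def
proof (intro conjI ballI)
  fix v w assume vw: "v \<in> vset R r" "w \<in> vset R r"
  show "vsub R s (L v) (L' v) \<in> vset R s" using assms vw by (simp add: vsub_closed linop_closed)
  have c: "\<And>a. a < s \<Longrightarrow> L v a \<in> carrier R" "\<And>a. a < s \<Longrightarrow> L w a \<in> carrier R"
     "\<And>a. a < s \<Longrightarrow> L' v a \<in> carrier R" "\<And>a. a < s \<Longrightarrow> L' w a \<in> carrier R"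
    using assms vw by (auto intro: vset_nth linop_closed)
  show "vsub R s (L (vadd R r v w)) (L' (vadd R r v w)) =
      vadd R s (vsub R s (L v) (L' v)) (vsub R s (L w) (L' w))"
    using c unfolding linop_add[OF assms(1) vw] linop_add[OF assms(2) vw]
    by (intro ext) (auto simp: vsub_def vadd_def a_minus_def minus_add a_ac)
  fix k assume k: "k \<in> carrier R"
  show "vsub R s (L (vscale R r k v)) (L' (vscale R r k v)) = vscale R s k (vsub R s (L v) (L' v))"
    using c k unfolding linop_scale[OF assms(1) k vw(1)] linop_scale[OF assms(2) k vw(1)]
    by (intro ext) (auto simp: vsub_def vscale_def a_minus_def r_distr r_minus)
qed

lemma linop_id: "linop R r r (\<lambda>v. v)"
  by (auto simp: linop_def)

lemma linop_mat_vec: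
  assumes A: "\<And>a b. a < r \<Longrightarrow> b < s \<Longrightarrow> A a b \<in> carrier R"
  shows "linop R s r (mat_vec R r s A)"
  unfolding linop_def
proof (intro conjI ballI)
  fix v w assume vw: "v \<in> vset R s" "w \<in> vset R s"
  show "mat_vec R r s A v \<in> vset R r"
    using A vw unfolding vset_def mat_vec_def by (auto intro!: finsum_closed simp: PiE_mem)
  show "mat_vec R r s A (vadd R s v w) = vadd R r (mat_vec R r s A v) (mat_vec R r s A w)"
  proof (rule ext)
    fix a
    show "mat_vec R r s A (vadd R s v w) a = vadd R r (mat_vec R r s A v) (mat_vec R r s A w) a"
    proof (cases "a < r")
      case True
      have "(\<Oplus>b\<in>{..<s}. A a b \<otimes> vadd R s v w b) = (\<Oplus>b\<in>{..<s}. A a b \<otimes> v b \<oplus> A a b \<otimes> w b)"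
        using A vw True by (intro finsum_cong') (auto simp: vadd_def r_distr vset_nth)
      also have "\<dots> = (\<Oplus>b\<in>{..<s}. A a b \<otimes> v b) \<oplus> (\<Oplus>b\<in>{..<s}. A a b \<otimes> w b)"
        using A vw True by (intro finsum_addf) (auto simp: vset_nth)
      finally show ?thesis using True by (simp add: mat_vec_def vadd_def)
    qed (simp add: mat_vec_def vadd_def)
  qed
  fix c assume c: "c \<in> carrier R"
  show "mat_vec R r s A (vscale R s c v) = vscale R r c (mat_vec R r s A v)"
  proof (rule ext)
    fix a
    show "mat_vec R r s A (vscale R s c v) a = vscale R r c (mat_vec R r s A v) a"
    proof (cases "a < r")
      case True
      have "(\<Oplus>b\<in>{..<s}. A a b \<otimes> vscale R s c v b) = (\<Oplus>b\<in>{..<s}. c \<otimes> (A a b \<otimes> v b))"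
        using A vw c True by (intro finsum_cong') (auto simp: vscale_def vset_nth m_lcomm)
      also have "\<dots> = c \<otimes> (\<Oplus>b\<in>{..<s}. A a b \<otimes> v b)"
        using A vw c True by (intro finsum_rdistr [symmetric]) (auto simp: vset_nth)
      finally show ?thesis using True by (simp add: mat_vec_def vscale_def)
    qed (simp add: mat_vec_def vscale_def)
  qed
qed

lemma mat_vec_uvec:
  assumes "\<And>a. a < r \<Longrightarrow> A a b \<in> carrier R" "\<And>a c. a < r \<Longrightarrow> c < s \<Longrightarrow> A a c \<in> carrier R" "b < s"
  shows "mat_vec R r s A (uvec R s b) = (\<lambda>a\<in>{..<r}. A a b)"
proof (rule ext)
  fix a
  show "mat_vec R r s A (uvec R s b) a = (\<lambda>a\<in>{..<r}. A a b) a"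
  proof (cases "a < r")
    case True
    have "(\<Oplus>c\<in>{..<s}. A a c \<otimes> uvec R s b c) = A a b \<otimes> uvec R s b b"
      using assms True by (intro finsum_single) (auto simp: uvec_def)
    with True assms show ?thesis by (simp add: mat_vec_def uvec_def)
  qed (simp add: mat_vec_def)
qed

text \<open>Induction on the number k of leading entries that may be nonzero: the last of them is
  split off as a multiple of a unit vector.\<close>

lemma linop_ext:
  assumes L: "linop R r s L" and L': "linop R r s L'"
    and eq: "\<And>b. b < r \<Longrightarrow> L (uvec R r b) = L' (uvec R r b)" and v: "v \<in> vset R r"
  shows "L v = L' v"
proof -
  have "k \<le> r \<Longrightarrow> (\<forall>v\<in>vset R r. (\<forall>a<r. k \<le> a \<longrightarrow> v a = \<zero>) \<longrightarrow> L v = L' v)" for k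
  proof (induction k)
    case 0
    show ?case
    proof (intro ballI impI)
      fix v assume v: "v \<in> vset R r" and z: "\<forall>a<r. 0 \<le> a \<longrightarrow> v a = \<zero>"
      have "v = zero_vec R r"
        by (rule vset_eqI[OF v zero_vec_closed]) (use z in \<open>simp add: zero_vec_def\<close>)
      then show "L v = L' v" using linop_zero L L' by simp
    qed
  next
    case (Suc k)
    show ?case
    proof (intro ballI impI)
      fix v assume v: "v \<in> vset R r" and z: "\<forall>a<r. Suc k \<le> a \<longrightarrow> v a = \<zero>"
      define w where "w = v(k := \<zero>)"
      have k: "k < r" using Suc.prems by simp
      have w: "w \<in> vset R r" using v k by (auto simp: w_def vset_def PiE_def extensional_def)
      have c: "v k \<in> carrier R" using v k by (rule vset_nth)
      have "v = vadd R r w (vscale R r (v k) (uvec R r k))"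
        by (rule vset_eqI[OF v]) (use v k w c in \<open>auto simp: vadd_closed vscale_closed uvec_closed\<close>,
            use v k c in \<open>auto simp: w_def vadd_def vscale_def uvec_def vset_nth\<close>)
      moreover have "L w = L' w" using Suc w z by (simp add: w_def)
      ultimately show "L v = L' v"
        using linop_add[OF L w vscale_closed[OF c uvec_closed]] linop_add[OF L' w vscale_closed[OF c uvec_closed]]
          linop_scale[OF L c uvec_closed] linop_scale[OF L' c uvec_closed] eq[OF k] by metis
    qed
  qed
  from this[of r] v show ?thesis by auto
qed

end

text \<open>Stated abstractly because it is instantiated twice, by the polynomial ring and by its
  quotient modulo a homogeneous ideal. \<open>H d\<close> is the set of homogeneous elements of
  degree d, zero included.\<close>

locale graded_cring = cring R for R (structure) +
  fixes H :: "int \<Rightarrow> 'a set"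
  assumes H_carrier: "x \<in> H d \<Longrightarrow> x \<in> carrier R"
    and H_zero: "\<zero> \<in> H d"
    and H_one: "\<one> \<in> H 0"
    and H_add: "x \<in> H d \<Longrightarrow> y \<in> H d \<Longrightarrow> x \<oplus> y \<in> H d"
    and H_uminus: "x \<in> H d \<Longrightarrow> \<ominus> x \<in> H d"
    and H_mult: "x \<in> H d \<Longrightarrow> y \<in> H e \<Longrightarrow> x \<otimes> y \<in> H (d + e)"
begin

text \<open>The degree-d part of the direct sum of the twists R(- dg a).\<close>

definition gvec :: "nat \<Rightarrow> (nat \<Rightarrow> int) \<Rightarrow> int \<Rightarrow> (nat \<Rightarrow> 'a) set" where
  "gvec r dg d = (\<Pi>\<^sub>E a\<in>{..<r}. H (d - dg a))"

text \<open>The matrices of degree-preserving maps between direct sums of twists: the b-th unit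
  vector has degree \<open>ds b\<close>, so its image must lie in the same degree.\<close>

definition gmat :: "nat \<Rightarrow> nat \<Rightarrow> (nat \<Rightarrow> int) \<Rightarrow> (nat \<Rightarrow> int) \<Rightarrow> (nat \<Rightarrow> nat \<Rightarrow> 'a) \<Rightarrow> bool" where
  "gmat r s dr ds A \<longleftrightarrow> (\<forall>a<r. \<forall>b<s. A a b \<in> H (ds b - dr a))"

lemma gvec_vset: "v \<in> gvec r dg d \<Longrightarrow> v \<in> vset R r"
  unfolding gvec_def vset_def using H_carrier by (auto simp: PiE_iff)

lemma gmat_linop: "gmat r s dr ds A \<Longrightarrow> linop R s r (mat_vec R r s A)"
  unfolding gmat_def by (intro linop_mat_vec) (metis H_carrier)

lemma H_finsum: "finite A \<Longrightarrow> (\<And>a. a \<in> A \<Longrightarrow> f a \<in> H d) \<Longrightarrow> finsum R f A \<in> H d"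
proof (induction A rule: finite_induct)
  case (insert a A)
  then have "f \<in> A \<rightarrow> carrier R" "f a \<in> carrier R" using H_carrier by blast+
  with insert show ?case by (simp add: H_add)
qed (simp add: H_zero)

lemma gmat_gvec:
  assumes "gmat r s dr ds A" "v \<in> gvec s ds d"
  shows "mat_vec R r s A v \<in> gvec r dr d"
  unfolding gvec_def mat_vec_def
proof (rule restrict_PiE_iff [THEN iffD2], rule ballI)
  fix a assume a: "a \<in> {..<r}"
  show "(\<Oplus>b\<in>{..<s}. A a b \<otimes> v b) \<in> H (d - dr a)"
  proof (rule H_finsum)
    fix b assume b: "b \<in> {..<s}"
    have "A a b \<in> H (ds b - dr a)" "v b \<in> H (d - ds b)"
      using assms a b by (auto simp: gmat_def gvec_def)
    from H_mult[OF this] show "A a b \<otimes> v b \<in> H (d - dr a)" by simp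
  qed simp
qed

lemma gvec_vsub: "v \<in> gvec r dg d \<Longrightarrow> w \<in> gvec r dg d \<Longrightarrow> vsub R r v w \<in> gvec r dg d"
  unfolding gvec_def vsub_def
  by (rule restrict_PiE_iff [THEN iffD2]) (auto simp: a_minus_def intro!: H_add H_uminus)

lemma uvec_gvec: "b < r \<Longrightarrow> uvec R r b \<in> gvec r dg (dg b)"
  unfolding gvec_def uvec_def
  by (rule restrict_PiE_iff [THEN iffD2]) (auto simp: H_one H_zero)

end

text \<open>\<open>comp d\<close> is the projection onto the component of degree d. It serves to
  turn arbitrary preimages into homogeneous ones.\<close>

locale graded_cring_comp = graded_cring R H for R (structure) and H +
  fixes comp :: "int \<Rightarrow> 'a \<Rightarrow> 'a"
  assumes comp_H: "x \<in> carrier R \<Longrightarrow> comp d x \<in> H d"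
    and comp_id: "x \<in> H d \<Longrightarrow> comp d x = x"
    and comp_zero: "comp d \<zero> = \<zero>"
    and comp_add: "x \<in> carrier R \<Longrightarrow> y \<in> carrier R \<Longrightarrow> comp d (x \<oplus> y) = comp d x \<oplus> comp d y"
    and comp_mult: "a \<in> H e \<Longrightarrow> x \<in> carrier R \<Longrightarrow> comp d (a \<otimes> x) = a \<otimes> comp (d - e) x"
begin

lemma comp_finsum:
  "finite A \<Longrightarrow> (\<And>a. a \<in> A \<Longrightarrow> f a \<in> carrier R) \<Longrightarrow>
    comp d (finsum R f A) = finsum R (\<lambda>a. comp d (f a)) A"
proof (induction A rule: finite_induct)
  case (insert a A)
  have "(\<lambda>a. comp d (f a)) \<in> A \<rightarrow> carrier R" "comp d (f a) \<in> carrier R"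
    using insert.prems comp_H H_carrier by blast+
  with insert show ?case by (simp add: comp_add Pi_iff finsum_closed)
qed (simp add: comp_zero)

text \<open>Exactness of a resolution is a statement about all vectors, so the preimages
  \<open>g b\<close> that it yields need not be homogeneous. As D is graded and the target is
  homogeneous, replacing each entry of \<open>g b\<close> by its component in the right degree keeps
  it a preimage; these components are the columns of M.\<close>

lemma graded_lift:
  assumes D: "gmat t s dt ds D" and L: "linop R r t L"
    and deg: "\<And>b. b < r \<Longrightarrow> L (uvec R r b) \<in> gvec t dt (dr b)"
    and ex: "\<And>b. b < r \<Longrightarrow> \<exists>g\<in>vset R s. mat_vec R t s D g = L (uvec R r b)"
  shows "\<exists>M. gmat s r ds dr M \<and> (\<forall>v\<in>vset R r. mat_vec R t s D (mat_vec R s r M v) = L v)"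
proof -
  obtain g where g: "\<And>b. b < r \<Longrightarrow> g b \<in> vset R s"
    "\<And>b. b < r \<Longrightarrow> mat_vec R t s D (g b) = L (uvec R r b)"
    using ex by metis
  define M where "M a b = comp (dr b - ds a) (g b a)" for a b
  have M: "gmat s r ds dr M"
    unfolding gmat_def M_def using g by (auto intro!: comp_H vset_nth)
  have Mc: "M a b \<in> carrier R" if "a < s" "b < r" for a b
    using M that H_carrier by (auto simp: gmat_def)
  have linM: "linop R r t (\<lambda>v. mat_vec R t s D (mat_vec R s r M v))"
    using gmat_linop[OF M] gmat_linop[OF D] by (rule linop_comp)
  have "mat_vec R t s D (mat_vec R s r M v) = L v" if "v \<in> vset R r" for v
  proof (rule linop_ext[OF linM L _ that])
    fix b assume b: "b < r"
    have "mat_vec R s r M (uvec R r b) = (\<lambda>a\<in>{..<s}. M a b)"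
      using Mc b by (intro mat_vec_uvec) auto
    moreover have "mat_vec R t s D (\<lambda>a\<in>{..<s}. M a b) = L (uvec R r b)"
    proof (rule vset_eqI[of _ R t])
      have "(\<lambda>a\<in>{..<s}. M a b) \<in> vset R s" using Mc b by (auto simp: vset_def)
      then show "mat_vec R t s D (\<lambda>a\<in>{..<s}. M a b) \<in> vset R t"
        by (rule linop_closed[OF gmat_linop[OF D]])
      show "L (uvec R r b) \<in> vset R t" by (rule linop_closed[OF L uvec_closed])
      fix c assume c: "c < t"
      have Dg: "D c a \<otimes> M a b = comp (dr b - dt c) (D c a \<otimes> g b a)" if "a < s" for a
        using comp_mult[of "D c a" "ds a - dt c" "g b a" "dr b - dt c"] D c that g(1)[OF b]
        by (simp add: gmat_def M_def vset_nth)
      have Dc: "D c a \<otimes> g b a \<in> carrier R" if "a < s" for a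
        using D c that H_carrier vset_nth[OF g(1)[OF b] that] unfolding gmat_def by blast
      have "mat_vec R t s D (\<lambda>a\<in>{..<s}. M a b) c = (\<Oplus>a\<in>{..<s}. comp (dr b - dt c) (D c a \<otimes> g b a))"
        using c Dg Dc by (auto simp: mat_vec_def intro!: finsum_cong' H_carrier[OF comp_H])
      also have "\<dots> = comp (dr b - dt c) (\<Oplus>a\<in>{..<s}. D c a \<otimes> g b a)"
        using Dc by (intro comp_finsum [symmetric]) auto
      also have "(\<Oplus>a\<in>{..<s}. D c a \<otimes> g b a) = L (uvec R r b) c"
        using fun_cong[OF g(2)[OF b], of c] c by (simp add: mat_vec_def)
      also have "comp (dr b - dt c) (L (uvec R r b) c) = L (uvec R r b) c"
        using deg[OF b] c by (intro comp_id) (auto simp: gvec_def)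
      finally show "mat_vec R t s D (\<lambda>a\<in>{..<s}. M a b) c = L (uvec R r b) c" .
    qed
    ultimately show "mat_vec R t s D (mat_vec R s r M (uvec R r b)) = L (uvec R r b)" by simp
  qed
  with M show ?thesis by blast
qed

section \<open>Graded resolutions, chain maps and homotopies\<close>

definition gres :: "'a set \<Rightarrow> 'a graded_free_complex \<Rightarrow> bool" where
  "gres I F \<longleftrightarrow> frank F 0 = 1 \<and> fdeg F 0 0 = 0 \<and>
     (\<forall>i. gmat (frank F i) (frank F (Suc i)) (fdeg F i) (fdeg F (Suc i)) (fdiff F i)) \<and>
     (\<lambda>v. v 0) ` free_map R F 0 ` free_part R F 1 = I \<and>
     (\<forall>i. {v \<in> free_part R F (Suc i). free_map R F i v = zero_vec R (frank F i)}
            = free_map R F (Suc i) ` free_part R F (Suc (Suc i)))"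

lemma gres_gmat: "gres I F \<Longrightarrow> gmat (frank F i) (frank F (Suc i)) (fdeg F i) (fdeg F (Suc i)) (fdiff F i)"
  by (simp add: gres_def)

lemma gres_linop: "gres I F \<Longrightarrow> linop R (frank F (Suc i)) (frank F i) (free_map R F i)"
  unfolding free_map_def using gres_gmat gmat_linop by blast

lemma gres_dd:
  assumes "gres I F" "v \<in> vset R (frank F (Suc (Suc i)))"
  shows "free_map R F i (free_map R F (Suc i) v) = zero_vec R (frank F i)"
proof -
  have "{v \<in> free_part R F (Suc i). free_map R F i v = zero_vec R (frank F i)}
            = free_map R F (Suc i) ` free_part R F (Suc (Suc i))"
    using assms(1) by (simp add: gres_def)
  then show ?thesis using assms(2) by (auto simp: free_part_vset)
qed

lemma gres_exact:
  assumes "gres I F" "v \<in> vset R (frank F (Suc i))" "free_map R F i v = zero_vec R (frank F i)"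
  shows "\<exists>g\<in>vset R (frank F (Suc (Suc i))). free_map R F (Suc i) g = v"
proof -
  have "{v \<in> free_part R F (Suc i). free_map R F i v = zero_vec R (frank F i)}
            = free_map R F (Suc i) ` free_part R F (Suc (Suc i))"
    using assms(1) by (simp add: gres_def)
  moreover have "v \<in> {v \<in> free_part R F (Suc i). free_map R F i v = zero_vec R (frank F i)}"
    using assms(2,3) by (simp add: free_part_vset)
  ultimately have "v \<in> free_map R F (Suc i) ` free_part R F (Suc (Suc i))" by simp
  then show ?thesis by (auto simp: free_part_vset)
qed

text \<open>M acts from \<open>F\<^sub>j\<close> to \<open>G\<^sub>i\<close>; as with rows and
  columns of a matrix, the target is named first.\<close>

definition act :: "'a graded_free_complex \<Rightarrow> 'a graded_free_complex \<Rightarrow> nat \<Rightarrow> nat \<Rightarrow>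
    (nat \<Rightarrow> nat \<Rightarrow> 'a) \<Rightarrow> (nat \<Rightarrow> 'a) \<Rightarrow> nat \<Rightarrow> 'a" where
  "act G F i j M = mat_vec R (frank G i) (frank F j) M"

abbreviation gmap where
  "gmap G F i j M \<equiv> gmat (frank G i) (frank F j) (fdeg G i) (fdeg F j) M"

lemma act_linop: "gmap G F i j M \<Longrightarrow> linop R (frank F j) (frank G i) (act G F i j M)"
  unfolding act_def by (rule gmat_linop)

lemma free_map_gvec:
  "gres I F \<Longrightarrow> v \<in> gvec (frank F (Suc i)) (fdeg F (Suc i)) d \<Longrightarrow> free_map R F i v \<in> gvec (frank F i) (fdeg F i) d"
  unfolding free_map_def by (rule gmat_gvec[OF gres_gmat])

text \<open>The comparison theorem: the identity of S lifts degree by degree. The invariant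
  \<open>P k\<close> records what the next step consumes, namely that the image of every d e_b has a
  preimage in the next module of G. For k = 0 this holds because both complexes have the same image
  I in S, afterwards because G is exact.\<close>

lemma chain_map_exists:
  assumes F: "gres I F" and G: "gres I G"
  shows "\<exists>\<phi>. (\<forall>k. gmap G F k k (\<phi> k)) \<and> (\<forall>v\<in>vset R 1. act G F 0 0 (\<phi> 0) v = v) \<and>
    (\<forall>k. \<forall>v\<in>vset R (frank F (Suc k)).
       free_map R G k (act G F (Suc k) (Suc k) (\<phi> (Suc k)) v) = act G F k k (\<phi> k) (free_map R F k v))"
proof -
  have rk: "frank F 0 = 1" "frank G 0 = 1" "fdeg F 0 0 = 0" "fdeg G 0 0 = 0"
    using F G by (auto simp: gres_def)
  define P where "P k M \<longleftrightarrow> gmap G F k k M \<and> (k = 0 \<longrightarrow> M = (\<lambda>_ _. \<one>)) \<and>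
     (\<forall>b<frank F (Suc k). \<exists>g\<in>vset R (frank G (Suc k)).
         free_map R G k g = act G F k k M (free_map R F k (uvec R (frank F (Suc k)) b)))" for k M
  define Q where "Q k M M' \<longleftrightarrow> (\<forall>v\<in>vset R (frank F (Suc k)).
       free_map R G k (act G F (Suc k) (Suc k) M' v) = act G F k k M (free_map R F k v))" for k M M'
  \<comment> \<open>Both complexes have rank one in degree 0, so the function that is constantly one
    is the 1 x 1 identity matrix.\<close>
  have one: "act G F 0 0 (\<lambda>_ _. \<one>) v = v" if "v \<in> vset R 1" for v
    using that by (intro ext) (auto simp: act_def rk mat_vec_def vset_def lessThan_Suc PiE_iff extensional_def)
  have "\<exists>\<phi>. \<forall>k. P k (\<phi> k) \<and> Q k (\<phi> k) (\<phi> (Suc k))"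
  proof (rule dependent_nat_choice)
    have "\<exists>g\<in>vset R (frank G 1). free_map R G 0 g = act G F 0 0 (\<lambda>_ _. \<one>) (free_map R F 0 (uvec R (frank F 1) b))"
      if "b < frank F 1" for b
    proof -
      let ?w = "free_map R F 0 (uvec R (frank F 1) b)"
      have w: "?w \<in> vset R 1" using linop_closed[OF gres_linop[OF F] uvec_closed, of 0 b] by (simp add: rk)
      have "?w 0 \<in> I" using F uvec_closed[of "frank F 1"] unfolding gres_def free_part_vset by blast
      also have "I = (\<lambda>v. v 0) ` free_map R G 0 ` free_part R G 1" using G by (simp add: gres_def)
      finally obtain g where g: "g \<in> vset R (frank G 1)" "?w 0 = free_map R G 0 g 0"
        by (auto simp: free_part_vset)
      have "free_map R G 0 g \<in> vset R 1" using linop_closed[OF gres_linop[OF G], of g 0] g by (simp add: rk)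
      then have "free_map R G 0 g = ?w" by (rule vset_eqI[OF _ w]) (use g in simp)
      then show ?thesis using one[OF w] g by auto
    qed
    then show "\<exists>x. P 0 x" unfolding P_def
      by (intro exI[of _ "\<lambda>_ _. \<one>"]) (auto simp: gmat_def rk H_one)
  next
    fix M k assume P: "P k M"
    let ?L = "\<lambda>v. act G F k k M (free_map R F k v)"
    have M: "gmap G F k k M" using P by (simp add: P_def)
    have L: "linop R (frank F (Suc k)) (frank G k) ?L"
      by (rule linop_comp[OF gres_linop[OF F] act_linop[OF M]])
    have "\<exists>M'. gmap G F (Suc k) (Suc k) M' \<and> (\<forall>v\<in>vset R (frank F (Suc k)).
        mat_vec R (frank G k) (frank G (Suc k)) (fdiff G k) (mat_vec R (frank G (Suc k)) (frank F (Suc k)) M' v) = ?L v)"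
    proof (rule graded_lift[OF gres_gmat[OF G] L])
      fix b assume b: "b < frank F (Suc k)"
      show "?L (uvec R (frank F (Suc k)) b) \<in> gvec (frank G k) (fdeg G k) (fdeg F (Suc k) b)"
        unfolding act_def by (intro gmat_gvec[OF M] free_map_gvec[OF F] uvec_gvec b)
      show "\<exists>g\<in>vset R (frank G (Suc k)). mat_vec R (frank G k) (frank G (Suc k)) (fdiff G k) g = ?L (uvec R (frank F (Suc k)) b)"
        using P b by (simp add: P_def free_map_def)
    qed
    then obtain M' where M': "gmap G F (Suc k) (Suc k) M'" "Q k M M'"
      by (auto simp: Q_def act_def free_map_def)
    have "P (Suc k) M'" unfolding P_def
    proof (intro conjI allI impI M')
      fix b assume b: "b < frank F (Suc (Suc k))"
      let ?u = "free_map R F (Suc k) (uvec R (frank F (Suc (Suc k))) b)"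
      have u: "?u \<in> vset R (frank F (Suc k))" by (rule linop_closed[OF gres_linop[OF F] uvec_closed])
      have "free_map R G k (act G F (Suc k) (Suc k) M' ?u) = ?L ?u" using M'(2) u by (simp add: Q_def)
      also have "\<dots> = zero_vec R (frank G k)"
        using gres_dd[OF F uvec_closed] linop_zero[OF act_linop[OF M]] by simp
      finally show "\<exists>g\<in>vset R (frank G (Suc (Suc k))). free_map R G (Suc k) g = act G F (Suc k) (Suc k) M' ?u"
        by (intro gres_exact[OF G linop_closed[OF act_linop[OF M'(1)] u]])
    qed simp
    with M' show "\<exists>y. P (Suc k) y \<and> Q k M y" by blast
  qed
  then obtain \<phi> where \<phi>: "\<And>k. P k (\<phi> k)" "\<And>k. Q k (\<phi> k) (\<phi> (Suc k))" by blast
  have "\<phi> 0 = (\<lambda>_ _. \<one>)" using \<phi>(1)[of 0] by (simp add: P_def)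
  with \<phi> one show ?thesis by (intro exI[of _ \<phi>]) (auto simp: P_def Q_def)
qed

text \<open>A graded endomorphism \<theta> that commutes with d and vanishes on
  \<open>F\<^sub>0\<close> has the form d s + s d. It will be applied to the difference of a
  composite of two chain maps and the identity. Each new s is a lift of \<theta> - s d through d,
  and such a lift exists because this difference maps into cycles.\<close>

lemma null_homotopy_exists:
  assumes F: "gres I F"
    and lin: "\<And>k. linop R (frank F k) (frank F k) (\<theta> k)"
    and deg: "\<And>k v d. v \<in> gvec (frank F k) (fdeg F k) d \<Longrightarrow> \<theta> k v \<in> gvec (frank F k) (fdeg F k) d"
    and comm: "\<And>k v. v \<in> vset R (frank F (Suc k)) \<Longrightarrow> free_map R F k (\<theta> (Suc k) v) = \<theta> k (free_map R F k v)"
    and zero: "\<And>v. v \<in> vset R (frank F 0) \<Longrightarrow> \<theta> 0 v = zero_vec R (frank F 0)"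
  shows "\<exists>s. (\<forall>k. gmap F F (Suc k) k (s k)) \<and> (\<forall>k. \<forall>v\<in>vset R (frank F (Suc k)).
       free_map R F (Suc k) (act F F (Suc (Suc k)) (Suc k) (s (Suc k)) v) =
         vsub R (frank F (Suc k)) (\<theta> (Suc k) v) (act F F (Suc k) k (s k) (free_map R F k v)))"
proof -
  \<comment> \<open>On boundaries d s agrees with \<theta>. This gives d (\<theta> v - s d v) =
    \<theta> (d v) - d s d v = 0, and d d = 0 passes the property on to the next s. It starts with s
    = 0.\<close>
  define P where "P k M \<longleftrightarrow> gmap F F (Suc k) k M \<and> (\<forall>v\<in>vset R (frank F (Suc k)).
     free_map R F k (act F F (Suc k) k M (free_map R F k v)) = \<theta> k (free_map R F k v))" for k M
  define Q where "Q k M M' \<longleftrightarrow> (\<forall>v\<in>vset R (frank F (Suc k)).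
       free_map R F (Suc k) (act F F (Suc (Suc k)) (Suc k) M' v) =
         vsub R (frank F (Suc k)) (\<theta> (Suc k) v) (act F F (Suc k) k M (free_map R F k v)))" for k M M'
  note d = gres_linop[OF F]
  have "\<exists>s. \<forall>k. P k (s k) \<and> Q k (s k) (s (Suc k))"
  proof (rule dependent_nat_choice)
    have z: "act F F (Suc 0) 0 (\<lambda>_ _. \<zero>) v = zero_vec R (frank F (Suc 0))" if "v \<in> vset R (frank F 0)" for v
      using that by (intro ext) (auto simp: act_def mat_vec_def zero_vec_def vset_nth intro!: add.finprod_one_eqI)
    have "P 0 (\<lambda>_ _. \<zero>)" unfolding P_def
      using z zero linop_closed[OF d] linop_zero[OF d] by (auto simp: gmat_def H_zero)
    then show "\<exists>x. P 0 x" by blast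
  next
    fix M k assume P: "P k M"
    let ?L = "\<lambda>v. vsub R (frank F (Suc k)) (\<theta> (Suc k) v) (act F F (Suc k) k M (free_map R F k v))"
    have M: "gmap F F (Suc k) k M" using P by (simp add: P_def)
    note aM = act_linop[OF M]
    have L: "linop R (frank F (Suc k)) (frank F (Suc k)) ?L"
      by (intro linop_diff lin linop_comp[OF d aM])
    have dL: "free_map R F k (?L v) = zero_vec R (frank F k)" if v: "v \<in> vset R (frank F (Suc k))" for v
    proof -
      have "free_map R F k (?L v) = vsub R (frank F k) (free_map R F k (\<theta> (Suc k) v))
          (free_map R F k (act F F (Suc k) k M (free_map R F k v)))"
        using v by (intro linop_sub[OF d]) (auto intro!: linop_closed[OF lin] linop_closed[OF aM] linop_closed[OF d])
      also have "\<dots> = vsub R (frank F k) (\<theta> k (free_map R F k v)) (\<theta> k (free_map R F k v))"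
        using comm[OF v] P v by (simp add: P_def)
      also have "\<dots> = zero_vec R (frank F k)"
        using v by (intro vsub_self) (auto intro!: linop_closed[OF lin] linop_closed[OF d])
      finally show ?thesis .
    qed
    have "\<exists>M'. gmap F F (Suc (Suc k)) (Suc k) M' \<and> (\<forall>v\<in>vset R (frank F (Suc k)).
        mat_vec R (frank F (Suc k)) (frank F (Suc (Suc k))) (fdiff F (Suc k))
          (mat_vec R (frank F (Suc (Suc k))) (frank F (Suc k)) M' v) = ?L v)"
    proof (rule graded_lift[OF gres_gmat[OF F] L])
      fix b assume b: "b < frank F (Suc k)"
      show "?L (uvec R (frank F (Suc k)) b) \<in> gvec (frank F (Suc k)) (fdeg F (Suc k)) (fdeg F (Suc k) b)"
        unfolding act_def by (intro gvec_vsub deg gmat_gvec[OF M] free_map_gvec[OF F] uvec_gvec b)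
      show "\<exists>g\<in>vset R (frank F (Suc (Suc k))). mat_vec R (frank F (Suc k)) (frank F (Suc (Suc k))) (fdiff F (Suc k)) g
          = ?L (uvec R (frank F (Suc k)) b)"
        using gres_exact[OF F linop_closed[OF L uvec_closed] dL[OF uvec_closed]]
        by (simp add: free_map_def)
    qed
    then obtain M' where M': "gmap F F (Suc (Suc k)) (Suc k) M'" "Q k M M'"
      by (auto simp: Q_def act_def free_map_def)
    have "P (Suc k) M'" unfolding P_def
    proof (intro conjI ballI M')
      fix v assume v: "v \<in> vset R (frank F (Suc (Suc k)))"
      have u: "free_map R F (Suc k) v \<in> vset R (frank F (Suc k))" using d v by (rule linop_closed)
      have "free_map R F (Suc k) (act F F (Suc (Suc k)) (Suc k) M' (free_map R F (Suc k) v)) =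
          vsub R (frank F (Suc k)) (\<theta> (Suc k) (free_map R F (Suc k) v)) (act F F (Suc k) k M (zero_vec R (frank F k)))"
        using M'(2) u gres_dd[OF F v] by (simp add: Q_def)
      also have "\<dots> = \<theta> (Suc k) (free_map R F (Suc k) v)"
        using u by (simp add: linop_zero[OF aM] vsub_zero linop_closed[OF lin])
      finally show "free_map R F (Suc k) (act F F (Suc (Suc k)) (Suc k) M' (free_map R F (Suc k) v)) = \<theta> (Suc k) (free_map R F (Suc k) v)" .
    qed
    with M' show "\<exists>y. P (Suc k) y \<and> Q k M y" by blast
  qed
  then obtain s where "\<And>k. P k (s k)" "\<And>k. Q k (s k) (s (Suc k))" by blast
  then show ?thesis by (intro exI[of _ s]) (auto simp: P_def Q_def)
qed

end

section \<open>Dimensions of quotients and of graded pieces\<close>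

context vectorspace
begin

text \<open>Independence in W is independence in V, so a maximal independent subset of W exists, has
  at most dim V elements, and is a basis of W.\<close>

lemma subspace_dim_le:
  assumes fd: fin_dim and W: "subspace K W V"
  shows "vectorspace.fin_dim K (vs W)" "vectorspace.dim K (vs W) \<le> dim"
proof -
  interpret W: vectorspace K "vs W" by (rule subspace_is_vs[OF W])
  have sm: "submodule K W V" using W by simp
  have WV: "W \<subseteq> carrier V" using sm by (simp add: submodule_def)
  have li: "finite A \<and> card A \<le> dim" if "A \<subseteq> W \<and> W.lin_indpt A" for A
  proof -
    have "lin_indpt A" using that span_li_not_depend(2)[OF _ sm, of A] by simp
    then show ?thesis using li_le_dim[OF fd _, of A] that WV by blast
  qed
  have "{} \<subseteq> W \<and> W.lin_indpt {}" by (simp add: W.lin_dep_def)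
  from maximal_exists[of "\<lambda>A. A \<subseteq> W \<and> W.lin_indpt A" dim "{}", OF li this]
  obtain A where A: "finite A" "maximal A (\<lambda>A. A \<subseteq> W \<and> W.lin_indpt A)" by blast
  have bas: "W.basis A" by (rule W.max_li_is_basis) (use A in simp)
  then show "W.fin_dim" using A unfolding W.fin_dim_def W.basis_def by auto
  show "W.dim \<le> dim" using W.dim_basis[OF A(1) bas] li A(2) unfolding maximal_def by simp
qed

lemma abelian_subgroup_subspace:
  assumes "subspace K B V"
  shows "abelian_subgroup B V"
proof (rule abelian_subgroupI3)
  have sm: "submodule K B V" using assms by simp
  interpret B: module K "V\<lparr>carrier := B\<rparr>" by (rule submodule_is_module[OF sm])
  show "abelian_group V" by unfold_locales
  show "additive_subgroup B V"
  proof (rule additive_subgroupI, rule add.subgroupI)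
    show "B \<subseteq> carrier V" using sm by (simp add: submodule_def)
    show "B \<noteq> {}" using sm by (auto simp: submodule_def)
    fix a b assume ab: "a \<in> B" "b \<in> B"
    show "a \<oplus>\<^bsub>V\<^esub> b \<in> B" using sm ab by (simp add: submodule_def)
    have "\<ominus>\<^bsub>K\<^esub> \<one>\<^bsub>K\<^esub> \<odot>\<^bsub>V\<^esub> a \<in> B" using sm ab by (simp add: submodule_def)
    moreover have "a \<in> carrier V" using ab sm by (auto simp: submodule_def)
    ultimately show "\<ominus>\<^bsub>V\<^esub> a \<in> B" using smult_minus_1[of a] by metis
  qed
qed

lemma
  assumes B: "subspace K B V"
  shows quotient_module_vectorspace: "vectorspace K (quotient_module V B)"
    and quotient_module_linear_map: "linear_map K V (quotient_module V B) (\<lambda>v. B +>\<^bsub>V\<^esub> v)"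
proof -
  interpret B: abelian_subgroup B V by (rule abelian_subgroup_subspace[OF B])
  have sm: "submodule K B V" using B by simp
  let ?Q = "quotient_module V B" and ?q = "\<lambda>v. B +>\<^bsub>V\<^esub> v"
  have car: "carrier ?Q = ?q ` carrier V"
    by (auto simp: quotient_module_def A_RCOSETS_defs a_r_coset_defs)
  have zero: "\<zero>\<^bsub>?Q\<^esub> = ?q \<zero>\<^bsub>V\<^esub>"
    using M.a_coset_add_zero[OF B.a_subset] by (simp add: quotient_module_def)
  have add: "?q v \<oplus>\<^bsub>?Q\<^esub> ?q w = ?q (v \<oplus>\<^bsub>V\<^esub> w)" if "v \<in> carrier V" "w \<in> carrier V" for v w
    using B.a_rcos_sum[OF that] by (simp add: quotient_module_def)
  have smult: "c \<odot>\<^bsub>?Q\<^esub> ?q v = ?q (c \<odot>\<^bsub>V\<^esub> v)" if cv: "c \<in> carrier K" "v \<in> carrier V" for c v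
  proof -
    \<comment> \<open>Scalar multiplication on the quotient is defined as a union over all
      representatives. They all yield the same coset, so the union collapses to it.\<close>
    have eq: "?q (c \<odot>\<^bsub>V\<^esub> w) = ?q (c \<odot>\<^bsub>V\<^esub> v)" if w: "w \<in> ?q v" for w
    proof -
      obtain b where b: "b \<in> B" "w = b \<oplus>\<^bsub>V\<^esub> v" using w by (auto simp: a_r_coset_def')
      then have "c \<odot>\<^bsub>V\<^esub> w = c \<odot>\<^bsub>V\<^esub> b \<oplus>\<^bsub>V\<^esub> c \<odot>\<^bsub>V\<^esub> v" using cv by (simp add: smult_r_distr B.a_Hcarr)
      moreover have "c \<odot>\<^bsub>V\<^esub> b \<in> B" using sm b cv by (simp add: submodule_def)
      ultimately have "c \<odot>\<^bsub>V\<^esub> w \<in> ?q (c \<odot>\<^bsub>V\<^esub> v)" by (auto simp: a_r_coset_def')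
      then show ?thesis using cv by (metis B.a_repr_independence' smult_closed)
    qed
    have "v \<in> ?q v" using cv by (intro B.a_rcos_self)
    then have "(\<Union>w\<in>?q v. ?q (c \<odot>\<^bsub>V\<^esub> v)) = ?q (c \<odot>\<^bsub>V\<^esub> v)" by blast
    moreover have "(\<Union>w\<in>?q v. ?q (c \<odot>\<^bsub>V\<^esub> w)) = (\<Union>w\<in>?q v. ?q (c \<odot>\<^bsub>V\<^esub> v))"
      by (rule SUP_cong[OF refl eq])
    ultimately show ?thesis by (simp add: quotient_module_def)
  qed
  show vs: "vectorspace K ?Q"
  proof (rule vs_criteria)
    show "field K" by unfold_locales
    show "\<zero>\<^bsub>?Q\<^esub> \<in> carrier ?Q" unfolding zero car by blast
    show "\<forall>v\<in>carrier ?Q. \<exists>neg_v\<in>carrier ?Q. v \<oplus>\<^bsub>?Q\<^esub> neg_v = \<zero>\<^bsub>?Q\<^esub>"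
    proof
      fix y assume "y \<in> carrier ?Q"
      then obtain v where v: "v \<in> carrier V" "y = ?q v" unfolding car by blast
      then have "y \<oplus>\<^bsub>?Q\<^esub> ?q (\<ominus>\<^bsub>V\<^esub> v) = \<zero>\<^bsub>?Q\<^esub>" unfolding zero by (simp add: add M.r_neg)
      then show "\<exists>neg_v\<in>carrier ?Q. y \<oplus>\<^bsub>?Q\<^esub> neg_v = \<zero>\<^bsub>?Q\<^esub>" using v unfolding car by blast
    qed
  qed (auto simp: car zero add smult M.a_ac smult_l_distr smult_r_distr smult_assoc1)
  show "linear_map K V ?Q ?q"
  proof -
    interpret Q: vectorspace K ?Q by (rule vs)
    show ?thesis
      by unfold_locales (auto simp: module_hom_def car add smult)
  qed
qed

lemma quotient_module_zero: "\<zero>\<^bsub>quotient_module V B\<^esub> = B"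
  by (simp add: quotient_module_def)

lemma dim_quotient_module:
  assumes fd: fin_dim and B: "subspace K B V"
  shows "vectorspace.fin_dim K (quotient_module V B)"
    "vectorspace.dim K (quotient_module V B) + vectorspace.dim K (vs B) = dim"
proof -
  interpret T: linear_map K V "quotient_module V B" "\<lambda>v. B +>\<^bsub>V\<^esub> v"
    by (rule quotient_module_linear_map[OF B])
  interpret B: abelian_subgroup B V by (rule abelian_subgroup_subspace[OF B])
  have surj: "(\<lambda>v. B +>\<^bsub>V\<^esub> v) ` carrier V = carrier (quotient_module V B)"
    by (auto simp: quotient_module_def A_RCOSETS_defs a_r_coset_defs)
  have ker: "T.ker = B"
  proof -
    have "B +>\<^bsub>V\<^esub> v = B \<longleftrightarrow> v \<in> B" if "v \<in> carrier V" for v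
      using that B.a_rcos_self B.a_rcos_const by blast
    then show ?thesis using B.a_subset by (auto simp: T.ker_def quotient_module_zero)
  qed
  show "vectorspace.fin_dim K (quotient_module V B)" by (rule T.surj_fin_dim[OF fd surj])
  show "vectorspace.dim K (quotient_module V B) + vectorspace.dim K (vs B) = dim"
    using T.rank_nullity[OF fd] unfolding ker T.surj_imp_imT_carrier[OF surj] by simp
qed

end

text \<open>The composite V -> V'/B' has kernel inside B, so its rank is at least dim V - dim B. For
  homology the kernel condition will come from a homotopy.\<close>

lemma dim_quotient_module_le:
  assumes V: "vectorspace K V" "vectorspace.fin_dim K V" "subspace K B V"
    and V': "vectorspace K V'" "vectorspace.fin_dim K V'" "subspace K B' V'"
    and f: "f \<in> module_hom K V V'" and inj: "\<And>v. v \<in> carrier V \<Longrightarrow> f v \<in> B' \<Longrightarrow> v \<in> B"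
  shows "vectorspace.dim K (quotient_module V B) \<le> vectorspace.dim K (quotient_module V' B')"
proof -
  interpret V: vectorspace K V by (rule V)
  interpret V': vectorspace K V' by (rule V')
  interpret q: linear_map K V' "quotient_module V' B'" "\<lambda>v. B' +>\<^bsub>V'\<^esub> v"
    by (rule V'.quotient_module_linear_map[OF V'(3)])
  interpret B': abelian_subgroup B' V' by (rule V'.abelian_subgroup_subspace[OF V'(3)])
  let ?T = "\<lambda>v. B' +>\<^bsub>V'\<^esub> f v"
  have fc: "f v \<in> carrier V'" if "v \<in> carrier V" for v using f that by (auto simp: module_hom_def)
  interpret T: linear_map K V "quotient_module V' B'" ?T
  proof unfold_locales
    show "?T \<in> module_hom K V (quotient_module V' B')"
      using fc f by (auto simp: module_hom_def)
  qed
  have kerB: "T.ker \<subseteq> B"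
  proof
    fix v assume "v \<in> T.ker"
    then have v: "v \<in> carrier V" "?T v = B'" by (auto simp: T.ker_def V'.quotient_module_zero)
    then have "f v \<in> B'" using B'.a_rcos_self[OF fc[OF v(1)]] by simp
    then show "v \<in> B" using inj v by blast
  qed
  have subB: "submodule K B V" using V by simp
  interpret B: vectorspace K "V\<lparr>carrier := B\<rparr>" by (rule V.subspace_is_vs[OF V(3)])
  have "subspace K T.ker (V\<lparr>carrier := B\<rparr>)"
    using T.kerT_is_subspace kerB B.vectorspace_axioms B.module_axioms
    by (auto simp: subspace_def submodule_def)
  from B.subspace_dim_le(2)[OF V.subspace_dim_le(1)[OF V(2,3)] this]
  have 1: "vectorspace.dim K (V\<lparr>carrier := T.ker\<rparr>) \<le> vectorspace.dim K (V\<lparr>carrier := B\<rparr>)" by simp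
  have 2: "vectorspace.dim K ((quotient_module V' B')\<lparr>carrier := T.im\<rparr>) \<le> vectorspace.dim K (quotient_module V' B')"
    by (rule q.W.subspace_dim_le(2)[OF V'.dim_quotient_module(1)[OF V'(2,3)] T.imT_is_subspace])
  show ?thesis
    using 1 2 T.rank_nullity[OF V(2)] V.dim_quotient_module(2)[OF V(2,3)] by linarith
qed

text \<open>The scalars enter through a homomorphism into degree 0, which makes each graded piece of
  a free module a vector space over K.\<close>

locale graded_cring_over = graded_cring R H + K: field K
  for R (structure) and H and K :: "('k, 'd) ring_scheme" +
  fixes \<kappa> :: "'k \<Rightarrow> 'a"
  assumes \<kappa>_hom: "\<kappa> \<in> ring_hom K R" and \<kappa>_H: "c \<in> carrier K \<Longrightarrow> \<kappa> c \<in> H 0"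
begin

text \<open>The fields are filled exactly as in \<open>tensor_part\<close>, so that the two records
  are equal and not merely isomorphic.\<close>

definition gspace :: "nat \<Rightarrow> (nat \<Rightarrow> int) \<Rightarrow> int \<Rightarrow> ('k, nat \<Rightarrow> 'a) module" where
  "gspace r dg d = \<lparr>carrier = gvec r dg d, monoid.mult = undefined, one = undefined,
     zero = zero_vec R r, add = vadd R r, smult = (\<lambda>c. vscale R r (\<kappa> c))\<rparr>"

lemma gspace_simps [simp]: "carrier (gspace r dg d) = gvec r dg d" "\<zero>\<^bsub>gspace r dg d\<^esub> = zero_vec R r"
   "v \<oplus>\<^bsub>gspace r dg d\<^esub> w = vadd R r v w" "c \<odot>\<^bsub>gspace r dg d\<^esub> v = vscale R r (\<kappa> c) v"
  by (simp_all add: gspace_def)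

lemma gvec_vadd: "v \<in> gvec r dg d \<Longrightarrow> w \<in> gvec r dg d \<Longrightarrow> vadd R r v w \<in> gvec r dg d"
  unfolding gvec_def vadd_def by (rule restrict_PiE_iff [THEN iffD2]) (auto intro: H_add)

lemma gvec_zero: "zero_vec R r \<in> gvec r dg d"
  unfolding gvec_def zero_vec_def by (rule restrict_PiE_iff [THEN iffD2]) (auto intro: H_zero)

lemma gvec_vscale:
  assumes "c \<in> carrier K" "v \<in> gvec r dg d"
  shows "vscale R r (\<kappa> c) v \<in> gvec r dg d"
  unfolding gvec_def vscale_def
proof (rule restrict_PiE_iff [THEN iffD2], rule ballI)
  fix a assume "a \<in> {..<r}"
  then show "\<kappa> c \<otimes> v a \<in> H (d - dg a)"
    using H_mult[OF \<kappa>_H[OF assms(1)], of "v a" "d - dg a"] assms(2) by (auto simp: gvec_def)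
qed

lemma \<kappa>_closed: "c \<in> carrier K \<Longrightarrow> \<kappa> c \<in> carrier R"
  using \<kappa>_H H_carrier by blast

lemma gspace_vectorspace: "vectorspace K (gspace r dg d)"
proof (rule vs_criteria)
  show "field K" by (rule K.field_axioms)
  have ext: "\<And>v a. v \<in> gvec r dg d \<Longrightarrow> \<not> a < r \<Longrightarrow> v a = undefined"
    by (auto simp: gvec_def PiE_def extensional_def)
  note c = vset_nth[OF gvec_vset]
  note defs = vadd_def vscale_def zero_vec_def
  show "\<forall>v\<in>carrier (gspace r dg d). \<exists>neg_v\<in>carrier (gspace r dg d). v \<oplus>\<^bsub>gspace r dg d\<^esub> neg_v = \<zero>\<^bsub>gspace r dg d\<^esub>"
  proof
    fix v assume v: "v \<in> carrier (gspace r dg d)"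
    have "vadd R r v (vscale R r (\<kappa> (\<ominus>\<^bsub>K\<^esub> \<one>\<^bsub>K\<^esub>)) v) = zero_vec R r"
    proof -
      interpret h: ring_hom_ring K R \<kappa>
        using \<kappa>_hom by (intro ring_hom_ringI2) (unfold_locales)
      show ?thesis using v by (auto simp: fun_eq_iff defs c[of v r dg d] l_minus r_neg)
    qed
    then show "\<exists>neg_v\<in>carrier (gspace r dg d). v \<oplus>\<^bsub>gspace r dg d\<^esub> neg_v = \<zero>\<^bsub>gspace r dg d\<^esub>"
      using v gvec_vscale[of "\<ominus>\<^bsub>K\<^esub> \<one>\<^bsub>K\<^esub>" v] by auto
  qed
  show "\<forall>v\<in>carrier (gspace r dg d). \<one>\<^bsub>K\<^esub> \<odot>\<^bsub>gspace r dg d\<^esub> v = v"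
    using ring_hom_one[OF \<kappa>_hom] by (auto simp: defs fun_eq_iff c ext)
  show "\<forall>v\<in>carrier (gspace r dg d). v \<oplus>\<^bsub>gspace r dg d\<^esub> \<zero>\<^bsub>gspace r dg d\<^esub> = v"
    by (auto simp: defs fun_eq_iff c ext)
  show "\<forall>a b v. a \<in> carrier K \<and> b \<in> carrier K \<and> v \<in> carrier (gspace r dg d) \<longrightarrow>
       (a \<oplus>\<^bsub>K\<^esub> b) \<odot>\<^bsub>gspace r dg d\<^esub> v = a \<odot>\<^bsub>gspace r dg d\<^esub> v \<oplus>\<^bsub>gspace r dg d\<^esub> b \<odot>\<^bsub>gspace r dg d\<^esub> v"
    using ring_hom_add[OF \<kappa>_hom] by (auto simp: defs fun_eq_iff c \<kappa>_closed l_distr)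
  show "\<forall>a b v. a \<in> carrier K \<and> b \<in> carrier K \<and> v \<in> carrier (gspace r dg d) \<longrightarrow>
       (a \<otimes>\<^bsub>K\<^esub> b) \<odot>\<^bsub>gspace r dg d\<^esub> v = a \<odot>\<^bsub>gspace r dg d\<^esub> (b \<odot>\<^bsub>gspace r dg d\<^esub> v)"
    using ring_hom_mult[OF \<kappa>_hom] by (auto simp: defs fun_eq_iff c \<kappa>_closed m_assoc)
  show "\<forall>u v w. u \<in> carrier (gspace r dg d) \<and> v \<in> carrier (gspace r dg d) \<and> w \<in> carrier (gspace r dg d) \<longrightarrow>
       u \<oplus>\<^bsub>gspace r dg d\<^esub> v \<oplus>\<^bsub>gspace r dg d\<^esub> w = u \<oplus>\<^bsub>gspace r dg d\<^esub> (v \<oplus>\<^bsub>gspace r dg d\<^esub> w)"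
    by (auto simp: vadd_def fun_eq_iff c a_assoc)
  show "\<forall>v w. v \<in> carrier (gspace r dg d) \<and> w \<in> carrier (gspace r dg d) \<longrightarrow>
       v \<oplus>\<^bsub>gspace r dg d\<^esub> w = w \<oplus>\<^bsub>gspace r dg d\<^esub> v"
    by (auto simp: vadd_def fun_eq_iff c a_comm)
  show "\<forall>a v w. a \<in> carrier K \<and> v \<in> carrier (gspace r dg d) \<and> w \<in> carrier (gspace r dg d) \<longrightarrow>
       a \<odot>\<^bsub>gspace r dg d\<^esub> (v \<oplus>\<^bsub>gspace r dg d\<^esub> w) = a \<odot>\<^bsub>gspace r dg d\<^esub> v \<oplus>\<^bsub>gspace r dg d\<^esub> a \<odot>\<^bsub>gspace r dg d\<^esub> w"
    by (auto simp: vadd_def vscale_def fun_eq_iff c r_distr \<kappa>_closed)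
qed (auto simp: gvec_vadd gvec_zero gvec_vscale)

lemma gmat_module_hom:
  assumes "gmat r s dr ds A"
  shows "mat_vec R r s A \<in> module_hom K (gspace s ds d) (gspace r dr d)"
  using gmat_gvec[OF assms] linop_add[OF gmat_linop[OF assms]] linop_scale[OF gmat_linop[OF assms]]
  by (auto simp: module_hom_def gvec_vset \<kappa>_closed)

end

section \<open>Tor computed by an arbitrary resolution\<close>

definition vmap :: "('r \<Rightarrow> 's) \<Rightarrow> nat \<Rightarrow> (nat \<Rightarrow> 'r) \<Rightarrow> nat \<Rightarrow> 's" where
  "vmap h r v = (\<lambda>a\<in>{..<r}. h (v a))"

lemma module_hom_restrict:
  assumes f: "f \<in> module_hom K V W" and A: "A \<subseteq> carrier V" and B: "\<And>v. v \<in> A \<Longrightarrow> f v \<in> B"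
  shows "f \<in> module_hom K (V\<lparr>carrier := A\<rparr>) (W\<lparr>carrier := B\<rparr>)"
proof -
  have "\<And>v. v \<in> A \<Longrightarrow> v \<in> carrier V" using A by blast
  then show ?thesis
    using B module_hom_add[OF f] module_hom_smult[OF f] by (simp add: module_hom_def)
qed

context ring_hom_cring
begin

lemma vmap_mat_vec:
  assumes A: "\<And>a b. a < r \<Longrightarrow> b < s \<Longrightarrow> A a b \<in> carrier R" and v: "v \<in> vset R s"
  shows "mat_vec S r s (\<lambda>a b. h (A a b)) (vmap h s v) = vmap h r (mat_vec R r s A v)"
proof
  fix a
  show "mat_vec S r s (\<lambda>a b. h (A a b)) (vmap h s v) a = vmap h r (mat_vec R r s A v) a"
  proof (cases "a < r")
    case True
    have f: "(\<lambda>b. A a b \<otimes> v b) \<in> {..<s} \<rightarrow> carrier R" using A[OF True] v by (auto simp: vset_nth)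
    have "h (\<Oplus>b\<in>{..<s}. A a b \<otimes> v b) = (\<Oplus>\<^bsub>S\<^esub>b\<in>{..<s}. h (A a b \<otimes> v b))"
      using hom_finsum[OF f] by (simp add: o_def)
    also have "\<dots> = (\<Oplus>\<^bsub>S\<^esub>b\<in>{..<s}. h (A a b) \<otimes>\<^bsub>S\<^esub> vmap h s v b)"
      using A[OF True] v by (intro S.finsum_cong') (auto simp: vset_nth vmap_def)
    finally show ?thesis using True by (simp add: mat_vec_def vmap_def)
  qed (simp add: mat_vec_def vmap_def)
qed

lemma vmap_vsub: "v \<in> vset R r \<Longrightarrow> w \<in> vset R r \<Longrightarrow> vmap h r (vsub R r v w) = vsub S r (vmap h r v) (vmap h r w)"
  by (auto simp: vmap_def vsub_def fun_eq_iff vset_nth a_minus_def)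

lemma vmap_zero: "vmap h r (zero_vec R r) = zero_vec S r"
  by (auto simp: vmap_def zero_vec_def)

lemma vmap_surj:
  assumes "h ` carrier R = carrier S" "w \<in> vset S r"
  shows "\<exists>v\<in>vset R r. vmap h r v = w"
proof -
  have "\<forall>a\<in>{..<r}. \<exists>x. x \<in> carrier R \<and> h x = w a"
    using assms by (metis imageE lessThan_iff vset_nth)
  then obtain v where v: "\<forall>a\<in>{..<r}. v a \<in> carrier R \<and> h (v a) = w a" by metis
  have "restrict v {..<r} \<in> vset R r" using v by (auto simp: vset_def)
  moreover have "vmap h r (restrict v {..<r}) = w"
    using v assms(2) by (auto simp: vmap_def fun_eq_iff vset_def PiE_def extensional_def)
  ultimately show ?thesis by blast
qed

end

context poly_over
begin

definition hcomp :: "int \<Rightarrow> 'a mpoly \<Rightarrow> 'a mpoly" where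
  "hcomp d f = (\<lambda>m. if int (size m) = d then f m else \<zero>)"

lemma homogeneousD: "f \<in> homogeneous K n d \<Longrightarrow> f \<in> carrier S"
  "f \<in> homogeneous K n d \<Longrightarrow> int (size m) \<noteq> d \<Longrightarrow> f m = \<zero>"
  by (auto simp: homogeneous_def)

lemma homogeneousI: "f \<in> carrier S \<Longrightarrow> (\<And>m. int (size m) \<noteq> d \<Longrightarrow> f m = \<zero>) \<Longrightarrow> f \<in> homogeneous K n d"
  by (auto simp: homogeneous_def)

lemma hcomp_closed: "f \<in> carrier S \<Longrightarrow> hcomp d f \<in> carrier S"
proof -
  assume f: "f \<in> carrier S"
  have "{m. hcomp d f m \<noteq> \<zero>} \<subseteq> {m. f m \<noteq> \<zero>}" by (auto simp: hcomp_def)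
  moreover have "finite {m. f m \<noteq> \<zero>}" using f unfolding carrier_S by blast
  ultimately have "finite {m. hcomp d f m \<noteq> \<zero>}" by (rule finite_subset)
  then show ?thesis using f unfolding carrier_S hcomp_def by auto
qed

lemma mterm_homogeneous: "c \<in> carrier K \<Longrightarrow> vars_ok m \<Longrightarrow> mterm c m \<in> homogeneous K n (int (size m))"
  by (rule homogeneousI, rule mterm_closed) (auto simp: mterm_def)

lemma homogeneous_mult:
  assumes f: "f \<in> homogeneous K n d" and g: "g \<in> homogeneous K n e"
  shows "f \<otimes>\<^bsub>S\<^esub> g \<in> homogeneous K n (d + e)"
proof (rule homogeneousI)
  show "f \<otimes>\<^bsub>S\<^esub> g \<in> carrier S" using f g by (intro S.m_closed homogeneousD)
  fix m :: "nat multiset" assume m: "int (size m) \<noteq> d + e"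
  have "f s \<otimes> g (m - s) = \<zero>" if s: "s \<subseteq># m" for s
  proof -
    have "int (size s) \<noteq> d \<or> int (size (m - s)) \<noteq> e"
      using m s size_Diff_submset[OF s] size_mset_mono[OF s] by auto
    then show ?thesis
      using homogeneousD(2)[OF f] homogeneousD(2)[OF g] S_coeff[OF homogeneousD(1)[OF f]] S_coeff[OF homogeneousD(1)[OF g]]
      by (metis l_null r_null)
  qed
  then show "(f \<otimes>\<^bsub>S\<^esub> g) m = \<zero>" unfolding S_mult by (intro add.finprod_one_eqI) auto
qed

lemma hcomp_mult:
  assumes a: "a \<in> homogeneous K n e" and x: "x \<in> carrier S"
  shows "hcomp d (a \<otimes>\<^bsub>S\<^esub> x) = a \<otimes>\<^bsub>S\<^esub> hcomp (d - e) x"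
proof
  fix m :: "nat multiset"
  note c = S_coeff[OF x] S_coeff[OF homogeneousD(1)[OF a]] S_coeff[OF hcomp_closed[OF x]]
  show "hcomp d (a \<otimes>\<^bsub>S\<^esub> x) m = (a \<otimes>\<^bsub>S\<^esub> hcomp (d - e) x) m"
  proof (cases "int (size m) = d")
    case True
    have "a s \<otimes> x (m - s) = a s \<otimes> hcomp (d - e) x (m - s)" if s: "s \<subseteq># m" for s
    proof (cases "int (size s) = e")
      case e: True
      then have "int (size (m - s)) = d - e"
        using True size_Diff_submset[OF s] size_mset_mono[OF s] by auto
      then show ?thesis by (simp add: hcomp_def)
    next
      case False
      then have "a s = \<zero>" by (rule homogeneousD(2)[OF a])
      then show ?thesis using c by simp
    qed
    then have "(a \<otimes>\<^bsub>S\<^esub> x) m = (a \<otimes>\<^bsub>S\<^esub> hcomp (d - e) x) m"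
      unfolding S_mult using c by (intro finsum_cong') auto
    with True show ?thesis by (simp add: hcomp_def)
  next
    case False
    have "(a \<otimes>\<^bsub>S\<^esub> hcomp (d - e) x) m = \<zero>"
    proof (rule homogeneousD(2))
      have "hcomp (d - e) x \<in> homogeneous K n (d - e)"
        by (rule homogeneousI[OF hcomp_closed[OF x]]) (simp add: hcomp_def)
      from homogeneous_mult[OF a this] show "a \<otimes>\<^bsub>S\<^esub> hcomp (d - e) x \<in> homogeneous K n d" by simp
    qed (use False in simp)
    with False show ?thesis by (simp add: hcomp_def)
  qed
qed

end

sublocale poly_over \<subseteq> S: graded_cring_comp "mpoly_ring K n" "homogeneous K n" hcomp
proof unfold_locales
  fix d e x y
  show "\<zero>\<^bsub>S\<^esub> \<in> homogeneous K n d" by (rule homogeneousI) (simp, simp add: S_zero)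
  show "\<one>\<^bsub>S\<^esub> \<in> homogeneous K n 0" using mterm_homogeneous[of \<one> "{#}"] by (simp add: S_one)
  show "hcomp d \<zero>\<^bsub>S\<^esub> = \<zero>\<^bsub>S\<^esub>" by (auto simp: hcomp_def S_zero)
  show "x \<in> carrier S" if "x \<in> homogeneous K n d" using that by (rule homogeneousD)
  show "x \<otimes>\<^bsub>S\<^esub> y \<in> homogeneous K n (d + e)" if "x \<in> homogeneous K n d" "y \<in> homogeneous K n e"
    using that by (rule homogeneous_mult)
  show "hcomp d (x \<otimes>\<^bsub>S\<^esub> y) = x \<otimes>\<^bsub>S\<^esub> hcomp (d - e) y" if "x \<in> homogeneous K n e" "y \<in> carrier S"
    using that by (rule hcomp_mult)
  show "hcomp d x \<in> homogeneous K n d" if "x \<in> carrier S"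
    using that by (intro homogeneousI hcomp_closed) (auto simp: hcomp_def)
  show "hcomp d x = x" if "x \<in> homogeneous K n d"
    using homogeneousD(2)[OF that] by (auto simp: hcomp_def fun_eq_iff)
  show "hcomp d (x \<oplus>\<^bsub>S\<^esub> y) = hcomp d x \<oplus>\<^bsub>S\<^esub> hcomp d y" if "x \<in> carrier S" "y \<in> carrier S"
    by (auto simp: hcomp_def S_add)
  show "x \<oplus>\<^bsub>S\<^esub> y \<in> homogeneous K n d" if "x \<in> homogeneous K n d" "y \<in> homogeneous K n d"
    using that homogeneousD[of x d] homogeneousD[of y d] by (intro homogeneousI S.a_closed) (auto simp: S_add)
  show "\<ominus>\<^bsub>S\<^esub> x \<in> homogeneous K n d" if "x \<in> homogeneous K n d"
    using homogeneousD[OF that] by (intro homogeneousI S.a_inv_closed) (auto simp: S_minus)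
qed

context poly_over
begin

lemma graded_free_resolution_iff: "graded_free_resolution K n I F \<longleftrightarrow> S.gres I F"
  by (simp add: graded_free_resolution_def S.gres_def S.gmat_def Let_def)

lemma const_hom: "(\<lambda>c. mterm c {#}) \<in> ring_hom K S"
proof (rule ring_hom_memI)
  show "mterm (x \<oplus> y) {#} = mterm x {#} \<oplus>\<^bsub>S\<^esub> mterm y {#}" if "x \<in> carrier K" "y \<in> carrier K" for x y
    using that by (auto simp: S_add mterm_def)
qed (auto simp: mterm_mult_mterm S_one)

end

section \<open>Resolutions tensored with a quotient S/J\<close>

locale poly_quotient = poly_over K n + J: ideal J "mpoly_ring K n"
  for K :: "('a, 'c) ring_scheme" (structure) and n J
begin

abbreviation Q where "Q \<equiv> S Quot J"

abbreviation HQ :: "int \<Rightarrow> 'a mpoly set set" where "HQ d \<equiv> a_r_coset S J ` homogeneous K n d"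

abbreviation kQ where "kQ c \<equiv> J +>\<^bsub>S\<^esub> indexed_const c"

end

sublocale poly_quotient \<subseteq> Q: cring "mpoly_ring K n Quot J"
  by (rule J.quotient_is_cring[OF S_cring])

sublocale poly_quotient \<subseteq> q: ring_hom_cring "mpoly_ring K n" "mpoly_ring K n Quot J" "a_r_coset (mpoly_ring K n) J"
  by (rule J.rcos_ring_hom_cring[OF S_cring])

sublocale poly_quotient \<subseteq> Q: graded_cring_over "mpoly_ring K n Quot J" "\<lambda>d. a_r_coset (mpoly_ring K n) J ` homogeneous K n d" K
   "\<lambda>c. a_r_coset (mpoly_ring K n) J (indexed_const c)"
proof unfold_locales
  fix d e x y
  show "x \<in> carrier Q" if "x \<in> HQ d" using that homogeneousD(1) q.hom_closed by blast
  show "\<zero>\<^bsub>Q\<^esub> \<in> HQ d" using S.H_zero q.hom_zero by (metis imageI)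
  show "\<one>\<^bsub>Q\<^esub> \<in> HQ 0" using S.H_one q.hom_one by (metis imageI)
  show "x \<oplus>\<^bsub>Q\<^esub> y \<in> HQ d" if "x \<in> HQ d" "y \<in> HQ d"
    using that S.H_add homogeneousD(1) q.hom_add by (smt (verit) imageE imageI)
  show "\<ominus>\<^bsub>Q\<^esub> x \<in> HQ d" if "x \<in> HQ d"
    using that S.H_uminus homogeneousD(1) q.hom_a_inv by (smt (verit) imageE imageI)
  show "x \<otimes>\<^bsub>Q\<^esub> y \<in> HQ (d + e)" if "x \<in> HQ d" "y \<in> HQ e"
    using that S.H_mult homogeneousD(1) q.hom_mult by (smt (verit) imageE imageI)
  show "(\<lambda>c. J +>\<^bsub>S\<^esub> indexed_const c) \<in> ring_hom K Q"
    using ring_hom_trans[OF const_hom J.rcos_ring_hom] by (simp add: o_def indexed_const_mterm)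
  show "J +>\<^bsub>S\<^esub> indexed_const c \<in> HQ 0" if "c \<in> carrier K" for c
    using mterm_homogeneous[OF that, of "{#}"] by (simp add: indexed_const_mterm)
qed

context poly_quotient
begin

lemma tensor_part_gspace: "tensor_part K n J F i j = Q.gspace (frank F i) (fdeg F i) j"
  by (simp add: tensor_part_def Q.gspace_def Q.gvec_def vadd_def vscale_def fun_eq_iff Let_def)

lemma tensor_vectorspace: "vectorspace K (tensor_part K n J F i j)"
  unfolding tensor_part_gspace by (rule Q.gspace_vectorspace)

abbreviation qmat where "qmat M \<equiv> (\<lambda>a b. J +>\<^bsub>S\<^esub> M a b)"

lemma qmat_gmat: "S.gmat r s dr ds M \<Longrightarrow> Q.gmat r s dr ds (qmat M)"
  by (auto simp: S.gmat_def Q.gmat_def)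

lemma tensor_map_gmat:
  "S.gres I F \<Longrightarrow> Q.gmat (frank F i) (frank F (Suc i)) (fdeg F i) (fdeg F (Suc i)) (qmat (fdiff F i))"
  by (rule qmat_gmat[OF S.gres_gmat])

lemma tensor_map_mat_vec: "tensor_map K n J F i = mat_vec Q (frank F i) (frank F (Suc i)) (qmat (fdiff F i))"
  by (simp add: tensor_map_def Let_def)

lemma tensor_map_hom:
  assumes "S.gres I F"
  shows "tensor_map K n J F i \<in> module_hom K (tensor_part K n J F (Suc i) j) (tensor_part K n J F i j)"
  unfolding tensor_map_mat_vec tensor_part_gspace by (rule Q.gmat_module_hom[OF tensor_map_gmat[OF assms]])

lemma tensor_map_linear:
  assumes "S.gres I F"
  shows "linear_map K (tensor_part K n J F (Suc i) j) (tensor_part K n J F i j) (tensor_map K n J F i)"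
proof -
  interpret A: vectorspace K "tensor_part K n J F (Suc i) j" by (rule tensor_vectorspace)
  interpret B: vectorspace K "tensor_part K n J F i j" by (rule tensor_vectorspace)
  show ?thesis by unfold_locales (rule tensor_map_hom[OF assms])
qed

lemma q_surj: "a_r_coset S J ` carrier S = carrier Q"
  by (auto simp: FactRing_def A_RCOSETS_defs a_r_coset_defs)

text \<open>Identities between maps over S/J are proved by lifting the vector entrywise and
  computing over S.\<close>

lemma vset_Q_cases:
  assumes "w \<in> vset Q r"
  obtains v where "v \<in> vset S r" "w = vmap (a_r_coset S J) r v"
  using q.vmap_surj[OF q_surj assms] by blast

lemma tensor_map_vmap:
  assumes "S.gres I F" "v \<in> vset S (frank F (Suc i))"
  shows "tensor_map K n J F i (vmap (a_r_coset S J) (frank F (Suc i)) v) =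
     vmap (a_r_coset S J) (frank F i) (free_map S F i v)"
  unfolding tensor_map_mat_vec free_map_def
  using S.gres_gmat[OF assms(1), of i] assms(2) homogeneousD(1) unfolding S.gmat_def
  by (intro q.vmap_mat_vec) blast+

lemma qmat_vmap:
  assumes "S.gmat r s dr ds M" "v \<in> vset S s"
  shows "mat_vec Q r s (qmat M) (vmap (a_r_coset S J) s v) = vmap (a_r_coset S J) r (mat_vec S r s M v)"
  using assms homogeneousD(1) unfolding S.gmat_def by (intro q.vmap_mat_vec) blast+

lemma tensor_map_dd:
  assumes F: "S.gres I F" and v: "v \<in> vset Q (frank F (Suc (Suc i)))"
  shows "tensor_map K n J F i (tensor_map K n J F (Suc i) v) = zero_vec Q (frank F i)"
proof -
  obtain v' where v': "v' \<in> vset S (frank F (Suc (Suc i)))" "v = vmap (a_r_coset S J) (frank F (Suc (Suc i))) v'"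
    using v by (rule vset_Q_cases)
  show ?thesis unfolding v'(2)
    using v'(1) S.gres_dd[OF F v'(1)] linop_closed[OF S.gres_linop[OF F] v'(1)]
    by (simp add: tensor_map_vmap[OF F] q.vmap_zero)
qed

lemma tor_cycles_subspace:
  assumes F: "S.gres I F"
  shows "subspace K (tor_cycles K n J F (Suc h) j) (tensor_part K n J F (Suc h) j)"
proof -
  interpret T: linear_map K "tensor_part K n J F (Suc h) j" "tensor_part K n J F h j" "tensor_map K n J F h"
    by (rule tensor_map_linear[OF F])
  have "tor_cycles K n J F (Suc h) j = T.ker"
    by (simp add: T.ker_def tor_cycles_def) (simp add: tensor_part_gspace)
  then show ?thesis using T.kerT_is_subspace by simp
qed

lemma tor_boundaries_subset:
  assumes F: "S.gres I F"
  shows "tor_boundaries K n J F (Suc h) j \<subseteq> tor_cycles K n J F (Suc h) j"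
proof
  fix w assume "w \<in> tor_boundaries K n J F (Suc h) j"
  then obtain v where v: "v \<in> carrier (tensor_part K n J F (Suc (Suc h)) j)" "w = tensor_map K n J F (Suc h) v"
    by (auto simp: tor_boundaries_def)
  have "w \<in> carrier (tensor_part K n J F (Suc h) j)"
    using module_hom_closed[OF tensor_map_hom[OF F, of "Suc h" j]] v by blast
  moreover have "tensor_map K n J F h w = zero_vec Q (frank F h)"
    using v tensor_map_dd[OF F] Q.gvec_vset by (auto simp: tensor_part_gspace)
  ultimately show "w \<in> tor_cycles K n J F (Suc h) j" by (simp add: tor_cycles_def)
qed

lemma tor_boundaries_subspace:
  assumes F: "S.gres I F"
  shows "subspace K (tor_boundaries K n J F (Suc h) j)
    (tensor_part K n J F (Suc h) j\<lparr>carrier := tor_cycles K n J F (Suc h) j\<rparr>)"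
proof -
  interpret T: linear_map K "tensor_part K n J F (Suc (Suc h)) j" "tensor_part K n J F (Suc h) j" "tensor_map K n J F (Suc h)"
    by (rule tensor_map_linear[OF F])
  have im: "tor_boundaries K n J F (Suc h) j = T.im" by (simp add: T.im_def tor_boundaries_def)
  have vs: "vectorspace K (tensor_part K n J F (Suc h) j\<lparr>carrier := tor_cycles K n J F (Suc h) j\<rparr>)"
    by (rule T.W.subspace_is_vs[OF tor_cycles_subspace[OF F]])
  interpret Z: vectorspace K "tensor_part K n J F (Suc h) j\<lparr>carrier := tor_cycles K n J F (Suc h) j\<rparr>" by (rule vs)
  show ?thesis
    using T.imT_is_subspace tor_boundaries_subset[OF F, of h j] vs Z.module_axioms
    unfolding im by (auto simp: subspace_def submodule_def)
qed

text \<open>Boundaries reduce the dimension of the cycles by one rank, and rank-nullity for the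
  outgoing differential accounts for the other. Written without subtraction, for natural
  numbers.\<close>

lemma homology_dim:
  assumes F: "S.gres I F" and fd: "vectorspace.fin_dim K (tensor_part K n J F (Suc h) j)"
  shows "vectorspace.dim K (homology_part K n J F (Suc h) j) +
      vectorspace.dim K (tensor_part K n J F (Suc h) j\<lparr>carrier := tor_boundaries K n J F (Suc h) j\<rparr>) +
      vectorspace.dim K (tensor_part K n J F h j\<lparr>carrier := tor_boundaries K n J F h j\<rparr>)
    = vectorspace.dim K (tensor_part K n J F (Suc h) j)"
proof -
  interpret T: linear_map K "tensor_part K n J F (Suc h) j" "tensor_part K n J F h j" "tensor_map K n J F h"
    by (rule tensor_map_linear[OF F])
  have ker: "tor_cycles K n J F (Suc h) j = T.ker"
    by (simp add: T.ker_def tor_cycles_def) (simp add: tensor_part_gspace)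
  have im: "tor_boundaries K n J F h j = T.im" by (simp add: T.im_def tor_boundaries_def)
  interpret Z: vectorspace K "tensor_part K n J F (Suc h) j\<lparr>carrier := tor_cycles K n J F (Suc h) j\<rparr>"
    by (rule T.V.subspace_is_vs[OF tor_cycles_subspace[OF F]])
  have "Z.fin_dim" by (rule T.V.subspace_dim_le(1)[OF fd tor_cycles_subspace[OF F]])
  from Z.dim_quotient_module(2)[OF this tor_boundaries_subspace[OF F]] T.rank_nullity[OF fd]
  show ?thesis by (simp add: homology_part_def ker im)
qed

text \<open>A chain map \<phi> from F to G is injective on homology, since \<psi> \<phi> is
  homotopic to the identity for a chain map \<psi> in the other direction. Exchanging F and G gives
  the independence of Tor from the resolution.\<close>

lemma homology_dim_le:
  assumes F: "S.gres I F" and G: "S.gres I G"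
    and fdF: "vectorspace.fin_dim K (tensor_part K n J F (Suc h) j)"
    and fdG: "vectorspace.fin_dim K (tensor_part K n J G (Suc h) j)"
  shows "vectorspace.dim K (homology_part K n J F (Suc h) j) \<le> vectorspace.dim K (homology_part K n J G (Suc h) j)"
proof -
  let ?\<pi> = "vmap (a_r_coset S J)"
  obtain \<phi> where \<phi>: "\<And>k. S.gmap G F k k (\<phi> k)" "\<And>v. v \<in> vset S 1 \<Longrightarrow> S.act G F 0 0 (\<phi> 0) v = v"
    "\<And>k v. v \<in> vset S (frank F (Suc k)) \<Longrightarrow>
       free_map S G k (S.act G F (Suc k) (Suc k) (\<phi> (Suc k)) v) = S.act G F k k (\<phi> k) (free_map S F k v)"
    using S.chain_map_exists[OF F G] by blast
  obtain \<psi> where \<psi>: "\<And>k. S.gmap F G k k (\<psi> k)" "\<And>v. v \<in> vset S 1 \<Longrightarrow> S.act F G 0 0 (\<psi> 0) v = v"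
    "\<And>k v. v \<in> vset S (frank G (Suc k)) \<Longrightarrow>
       free_map S F k (S.act F G (Suc k) (Suc k) (\<psi> (Suc k)) v) = S.act F G k k (\<psi> k) (free_map S G k v)"
    using S.chain_map_exists[OF G F] by blast
  \<comment> \<open>Both chain maps are the identity in degree 0, so this difference vanishes there
    and is null-homotopic.\<close>
  define \<theta> where "\<theta> k v = vsub S (frank F k) (S.act F G k k (\<psi> k) (S.act G F k k (\<phi> k) v)) v" for k v
  note lin = S.act_linop[OF \<phi>(1)] S.act_linop[OF \<psi>(1)]
  have rk: "frank F 0 = 1" "frank G 0 = 1" using F G by (auto simp: S.gres_def)
  obtain s where s: "\<And>k. S.gmap F F (Suc k) k (s k)"
    "\<And>k v. v \<in> vset S (frank F (Suc k)) \<Longrightarrow> free_map S F (Suc k) (S.act F F (Suc (Suc k)) (Suc k) (s (Suc k)) v) =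
         vsub S (frank F (Suc k)) (\<theta> (Suc k) v) (S.act F F (Suc k) k (s k) (free_map S F k v))"
  proof -
    have "\<exists>s. (\<forall>k. S.gmap F F (Suc k) k (s k)) \<and> (\<forall>k. \<forall>v\<in>vset S (frank F (Suc k)).
       free_map S F (Suc k) (S.act F F (Suc (Suc k)) (Suc k) (s (Suc k)) v) =
         vsub S (frank F (Suc k)) (\<theta> (Suc k) v) (S.act F F (Suc k) k (s k) (free_map S F k v)))"
    proof (rule S.null_homotopy_exists[OF F])
      show "linop S (frank F k) (frank F k) (\<theta> k)" for k
        unfolding \<theta>_def by (intro S.linop_diff S.linop_id linop_comp[OF lin])
      show "\<theta> k v \<in> S.gvec (frank F k) (fdeg F k) d" if "v \<in> S.gvec (frank F k) (fdeg F k) d" for k v d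
        unfolding \<theta>_def S.act_def using that by (intro S.gvec_vsub S.gmat_gvec[OF \<psi>(1)] S.gmat_gvec[OF \<phi>(1)])
      show "\<theta> 0 v = zero_vec S (frank F 0)" if "v \<in> vset S (frank F 0)" for v
        using that \<phi>(2) \<psi>(2) by (simp add: \<theta>_def rk S.vsub_self)
      fix k v assume v: "v \<in> vset S (frank F (Suc k))"
      show "free_map S F k (\<theta> (Suc k) v) = \<theta> k (free_map S F k v)"
        unfolding \<theta>_def
        using v \<phi>(3)[OF v] \<psi>(3)[OF linop_closed[OF lin(1) v]]
          S.linop_sub[OF S.gres_linop[OF F] linop_closed[OF lin(2) linop_closed[OF lin(1) v]] v]
        by simp
    qed
    then show ?thesis using that by blast
  qed
  let ?\<Phi> = "\<lambda>k. mat_vec Q (frank G k) (frank F k) (qmat (\<phi> k))"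
  let ?\<Psi> = "\<lambda>k. mat_vec Q (frank F k) (frank G k) (qmat (\<psi> k))"
  let ?s = "\<lambda>k. mat_vec Q (frank F (Suc k)) (frank F k) (qmat (s k))"
  have \<Phi>: "Q.gmat (frank G k) (frank F k) (fdeg G k) (fdeg F k) (qmat (\<phi> k))" for k by (rule qmat_gmat[OF \<phi>(1)])
  have \<Psi>: "Q.gmat (frank F k) (frank G k) (fdeg F k) (fdeg G k) (qmat (\<psi> k))" for k by (rule qmat_gmat[OF \<psi>(1)])
  have sg: "Q.gmat (frank F (Suc k)) (frank F k) (fdeg F (Suc k)) (fdeg F k) (qmat (s k))" for k by (rule qmat_gmat[OF s(1)])
  have chain\<Phi>: "tensor_map K n J G k (?\<Phi> (Suc k) v) = ?\<Phi> k (tensor_map K n J F k v)"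
    if v: "v \<in> vset Q (frank F (Suc k))" for k v
  proof -
    obtain v' where v': "v' \<in> vset S (frank F (Suc k))" "v = ?\<pi> (frank F (Suc k)) v'"
      using v by (rule vset_Q_cases)
    show ?thesis unfolding v'(2)
      using v'(1) \<phi>(3)[OF v'(1)] linop_closed[OF lin(1) v'(1)] linop_closed[OF S.gres_linop[OF F] v'(1)]
      by (simp add: qmat_vmap[OF \<phi>(1)] tensor_map_vmap[OF F] tensor_map_vmap[OF G] S.act_def)
  qed
  have chain\<Psi>: "tensor_map K n J F k (?\<Psi> (Suc k) v) = ?\<Psi> k (tensor_map K n J G k v)"
    if v: "v \<in> vset Q (frank G (Suc k))" for k v
  proof -
    obtain v' where v': "v' \<in> vset S (frank G (Suc k))" "v = ?\<pi> (frank G (Suc k)) v'"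
      using v by (rule vset_Q_cases)
    show ?thesis unfolding v'(2)
      using v'(1) \<psi>(3)[OF v'(1)] linop_closed[OF lin(2) v'(1)] linop_closed[OF S.gres_linop[OF G] v'(1)]
      by (simp add: qmat_vmap[OF \<psi>(1)] tensor_map_vmap[OF F] tensor_map_vmap[OF G] S.act_def)
  qed
  \<comment> \<open>The homotopy descends to S/J entrywise: d s v = (\<psi> \<phi> v - v) - s d
    v.\<close>
  have homot: "tensor_map K n J F (Suc k) (?s (Suc k) v) =
      vsub Q (frank F (Suc k)) (vsub Q (frank F (Suc k)) (?\<Psi> (Suc k) (?\<Phi> (Suc k) v)) v) (?s k (tensor_map K n J F k v))"
    if v: "v \<in> vset Q (frank F (Suc k))" for k v
  proof -
    obtain v' where v': "v' \<in> vset S (frank F (Suc k))" "v = ?\<pi> (frank F (Suc k)) v'"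
      using v by (rule vset_Q_cases)
    note c = linop_closed[OF lin(1) v'(1)] linop_closed[OF lin(2) linop_closed[OF lin(1) v'(1)]]
      linop_closed[OF S.gres_linop[OF F] v'(1)]
      linop_closed[OF S.act_linop[OF s(1)] linop_closed[OF S.gres_linop[OF F] v'(1)]]
      linop_closed[OF S.act_linop[OF s(1)] v'(1)]
    show ?thesis unfolding v'(2)
      using v'(1) s(2)[OF v'(1)] c
      by (simp add: qmat_vmap[OF \<phi>(1)] qmat_vmap[OF \<psi>(1)] qmat_vmap[OF s(1)] tensor_map_vmap[OF F]
          S.act_def \<theta>_def q.vmap_vsub S.vsub_closed)
  qed
  let ?TF = "tensor_part K n J F (Suc h) j" and ?TG = "tensor_part K n J G (Suc h) j"
  interpret TF: vectorspace K ?TF by (rule tensor_vectorspace)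
  interpret TG: vectorspace K ?TG by (rule tensor_vectorspace)
  have zero: "?\<Phi> k (zero_vec Q (frank F k)) = zero_vec Q (frank G k)" for k
    by (rule Q.linop_zero[OF Q.gmat_linop[OF \<Phi>]])
  have \<Phi>Z: "?\<Phi> (Suc h) v \<in> tor_cycles K n J G (Suc h) j" if v: "v \<in> tor_cycles K n J F (Suc h) j" for v
    using v chain\<Phi>[of v h] zero Q.gmat_gvec[OF \<Phi>, of v "Suc h" j] Q.gvec_vset
    by (auto simp: tor_cycles_def tensor_part_gspace)
  show ?thesis unfolding homology_part_def
  proof (rule dim_quotient_module_le)
    show "vectorspace K (?TF\<lparr>carrier := tor_cycles K n J F (Suc h) j\<rparr>)"
      by (rule TF.subspace_is_vs[OF tor_cycles_subspace[OF F]])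
    show "vectorspace K (?TG\<lparr>carrier := tor_cycles K n J G (Suc h) j\<rparr>)"
      by (rule TG.subspace_is_vs[OF tor_cycles_subspace[OF G]])
    show "vectorspace.fin_dim K (?TF\<lparr>carrier := tor_cycles K n J F (Suc h) j\<rparr>)"
      by (rule TF.subspace_dim_le[OF fdF tor_cycles_subspace[OF F]])
    show "vectorspace.fin_dim K (?TG\<lparr>carrier := tor_cycles K n J G (Suc h) j\<rparr>)"
      by (rule TG.subspace_dim_le[OF fdG tor_cycles_subspace[OF G]])
    show "subspace K (tor_boundaries K n J F (Suc h) j) (?TF\<lparr>carrier := tor_cycles K n J F (Suc h) j\<rparr>)"
      by (rule tor_boundaries_subspace[OF F])
    show "subspace K (tor_boundaries K n J G (Suc h) j) (?TG\<lparr>carrier := tor_cycles K n J G (Suc h) j\<rparr>)"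
      by (rule tor_boundaries_subspace[OF G])
    have "tor_cycles K n J F (Suc h) j \<subseteq> carrier ?TF" by (auto simp: tor_cycles_def)
    then show "?\<Phi> (Suc h) \<in> module_hom K (?TF\<lparr>carrier := tor_cycles K n J F (Suc h) j\<rparr>) (?TG\<lparr>carrier := tor_cycles K n J G (Suc h) j\<rparr>)"
      using Q.gmat_module_hom[OF \<Phi>, of "Suc h" j] \<Phi>Z
      unfolding tensor_part_gspace[symmetric] by (intro module_hom_restrict) auto
    fix v assume "v \<in> carrier (?TF\<lparr>carrier := tor_cycles K n J F (Suc h) j\<rparr>)"
      and b: "?\<Phi> (Suc h) v \<in> tor_boundaries K n J G (Suc h) j"
    then have v: "v \<in> tor_cycles K n J F (Suc h) j" by simp
    then have vg: "v \<in> Q.gvec (frank F (Suc h)) (fdeg F (Suc h)) j" and dv: "tensor_map K n J F h v = zero_vec Q (frank F h)"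
      by (simp_all add: tor_cycles_def tensor_part_gspace)
    note vv = Q.gvec_vset[OF vg]
    obtain u where u: "u \<in> Q.gvec (frank G (Suc (Suc h))) (fdeg G (Suc (Suc h))) j" "?\<Phi> (Suc h) v = tensor_map K n J G (Suc h) u"
      using b by (auto simp: tor_boundaries_def tensor_part_gspace)
    \<comment> \<open>If v is a cycle and \<phi> v = d u, then d \<psi> u = \<psi> \<phi> v and d s
      v = \<psi> \<phi> v - v. Hence v = d (\<psi> u - s v).\<close>
    let ?w = "vsub Q (frank F (Suc (Suc h))) (?\<Psi> (Suc (Suc h)) u) (?s (Suc h) v)"
    have wg: "?w \<in> Q.gvec (frank F (Suc (Suc h))) (fdeg F (Suc (Suc h))) j"
      by (intro Q.gvec_vsub Q.gmat_gvec[OF \<Psi>] Q.gmat_gvec[OF sg] u vg)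
    have lF: "linop Q (frank F (Suc (Suc h))) (frank F (Suc h)) (tensor_map K n J F (Suc h))"
      unfolding tensor_map_mat_vec by (rule Q.gmat_linop[OF tensor_map_gmat[OF F]])
    note c1 = linop_closed[OF Q.gmat_linop[OF \<Psi>] Q.gvec_vset[OF u(1)]]
    note c2 = linop_closed[OF Q.gmat_linop[OF sg] vv]
    note c3 = linop_closed[OF Q.gmat_linop[OF \<Psi>] linop_closed[OF Q.gmat_linop[OF \<Phi>] vv]]
    have "tensor_map K n J F (Suc h) ?w = vsub Q (frank F (Suc h)) (?\<Psi> (Suc h) (?\<Phi> (Suc h) v))
        (vsub Q (frank F (Suc h)) (?\<Psi> (Suc h) (?\<Phi> (Suc h) v)) v)"
      using Q.linop_sub[OF lF c1 c2] chain\<Psi>[OF Q.gvec_vset[OF u(1)]] u(2) homot[OF vv] dv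
        Q.linop_zero[OF Q.gmat_linop[OF sg]]
        Q.vsub_zero[OF Q.vsub_closed[OF c3 vv]]
      by simp
    also have "\<dots> = v"
    proof (rule vset_eqI[OF _ vv])
      show "vsub Q (frank F (Suc h)) (?\<Psi> (Suc h) (?\<Phi> (Suc h) v)) (vsub Q (frank F (Suc h)) (?\<Psi> (Suc h) (?\<Phi> (Suc h) v)) v)
          \<in> vset Q (frank F (Suc h))" by (intro Q.vsub_closed c3 vv)
      fix a assume a: "a < frank F (Suc h)"
      have "x \<ominus>\<^bsub>Q\<^esub> (x \<ominus>\<^bsub>Q\<^esub> y) = y" if "x \<in> carrier Q" "y \<in> carrier Q" for x y
        using that by (simp add: a_minus_def Q.minus_add Q.r_neg1 Q.a_assoc [symmetric] Q.r_neg)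
      then show "vsub Q (frank F (Suc h)) (?\<Psi> (Suc h) (?\<Phi> (Suc h) v)) (vsub Q (frank F (Suc h)) (?\<Psi> (Suc h) (?\<Phi> (Suc h) v)) v) a = v a"
        using a vset_nth[OF c3 a] vset_nth[OF vv a] by (simp add: vsub_def)
    qed
    finally have "v = tensor_map K n J F (Suc h) ?w" by (rule sym)
    then show "v \<in> tor_boundaries K n J F (Suc h) j"
      using wg unfolding tor_boundaries_def tensor_part_gspace Q.gspace_simps by (rule image_eqI)
  qed
qed

end

section \<open>Function spaces and matrix ranks\<close>

context module
begin

lemma submodule_finsum_closed:
  assumes W: "submodule R W M" and "finite I" "\<And>i. i \<in> I \<Longrightarrow> f i \<in> W"
  shows "(\<Oplus>\<^bsub>M\<^esub>i\<in>I. f i) \<in> W"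
  using assms(2,3)
proof (induction I rule: finite_induct)
  case empty
  show ?case using W by (simp add: submodule_def)
next
  case (insert i I)
  have "f \<in> I \<rightarrow> carrier M" "f i \<in> carrier M" using insert.prems W by (auto simp: submodule_def)
  with insert W show ?case by (simp add: submodule_def)
qed

end

context vectorspace
begin

lemma dim_le_spanning_family:
  assumes I: "finite I" and e: "\<And>i. i \<in> I \<Longrightarrow> e i \<in> carrier V"
    and sp: "\<And>v. v \<in> carrier V \<Longrightarrow> \<exists>c\<in>I \<rightarrow> carrier K. v = (\<Oplus>\<^bsub>V\<^esub>i\<in>I. c i \<odot>\<^bsub>V\<^esub> e i)"
  shows "fin_dim" "dim \<le> card I"
proof -
  have eI: "e ` I \<subseteq> carrier V" using e by blast
  have "span (e ` I) = carrier V"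
  proof
    show "span (e ` I) \<subseteq> carrier V" using span_closed[OF eI] by blast
    show "carrier V \<subseteq> span (e ` I)"
    proof
      fix v assume "v \<in> carrier V"
      then obtain c where c: "c \<in> I \<rightarrow> carrier K" "v = (\<Oplus>\<^bsub>V\<^esub>i\<in>I. c i \<odot>\<^bsub>V\<^esub> e i)" using sp by blast
      have sm: "submodule K (span (e ` I)) V" by (rule span_is_submodule[OF eI])
      show "v \<in> span (e ` I)" unfolding c(2)
      proof (rule submodule_finsum_closed[OF sm I])
        fix i assume i: "i \<in> I"
        then have "e i \<in> span (e ` I)" using in_own_span[OF eI] by blast
        then show "c i \<odot>\<^bsub>V\<^esub> e i \<in> span (e ` I)" using sm c i by (auto simp: submodule_def)
      qed
    qed
  qed
  then show "fin_dim" "dim \<le> card I"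
    using I eI gen_ge_dim[of "e ` I"] card_image_le[OF I, of e] unfolding fin_dim_def
    by (blast, meson finite_imageI le_trans)
qed

text \<open>\<open>lin_indpt\<close> speaks of a set of vectors and does not see repetitions in a
  family. Injectivity is what lets the index set be counted instead of the set of vectors.\<close>

lemma
  assumes I: "finite I" and e: "\<And>i. i \<in> I \<Longrightarrow> e i \<in> carrier V"
    and ind: "\<And>c i. c \<in> I \<rightarrow> carrier K \<Longrightarrow> (\<Oplus>\<^bsub>V\<^esub>i\<in>I. c i \<odot>\<^bsub>V\<^esub> e i) = \<zero>\<^bsub>V\<^esub> \<Longrightarrow> i \<in> I \<Longrightarrow> c i = \<zero>\<^bsub>K\<^esub>"
  shows independent_family_inj: "inj_on e I"
    and independent_family_lin_indpt: "lin_indpt (e ` I)"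
proof -
  show inj: "inj_on e I"
  proof (rule inj_onI, rule ccontr)
    fix i j assume ij: "i \<in> I" "j \<in> I" "e i = e j" "i \<noteq> j"
    \<comment> \<open>If e i = e j, then e i - e j = 0 is a nontrivial relation of the
      family.\<close>
    define c where "c k = (if k = i then \<one>\<^bsub>K\<^esub> else if k = j then \<ominus>\<^bsub>K\<^esub> \<one>\<^bsub>K\<^esub> else \<zero>\<^bsub>K\<^esub>)" for k
    have c: "c \<in> I \<rightarrow> carrier K" by (auto simp: c_def)
    have I': "I = insert i (insert j (I - {i, j}))" using ij by blast
    have "(\<Oplus>\<^bsub>V\<^esub>k\<in>I - {i, j}. c k \<odot>\<^bsub>V\<^esub> e k) = \<zero>\<^bsub>V\<^esub>"
      using e by (intro M.add.finprod_one_eqI) (auto simp: c_def)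
    moreover have "(\<Oplus>\<^bsub>V\<^esub>k\<in>I. c k \<odot>\<^bsub>V\<^esub> e k) =
        c i \<odot>\<^bsub>V\<^esub> e i \<oplus>\<^bsub>V\<^esub> (c j \<odot>\<^bsub>V\<^esub> e j \<oplus>\<^bsub>V\<^esub> (\<Oplus>\<^bsub>V\<^esub>k\<in>I - {i, j}. c k \<odot>\<^bsub>V\<^esub> e k))"
    proof -
      have t: "c k \<odot>\<^bsub>V\<^esub> e k \<in> carrier V" if "k \<in> I" for k using c e[OF that] that by (auto simp: Pi_iff)
      have "(\<Oplus>\<^bsub>V\<^esub>k\<in>insert i (insert j (I - {i, j})). c k \<odot>\<^bsub>V\<^esub> e k) =
          c i \<odot>\<^bsub>V\<^esub> e i \<oplus>\<^bsub>V\<^esub> (\<Oplus>\<^bsub>V\<^esub>k\<in>insert j (I - {i, j}). c k \<odot>\<^bsub>V\<^esub> e k)"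
        using I ij(1,2,4) t by (intro M.finsum_insert) (auto simp: Pi_iff)
      also have "(\<Oplus>\<^bsub>V\<^esub>k\<in>insert j (I - {i, j}). c k \<odot>\<^bsub>V\<^esub> e k) =
          c j \<odot>\<^bsub>V\<^esub> e j \<oplus>\<^bsub>V\<^esub> (\<Oplus>\<^bsub>V\<^esub>k\<in>I - {i, j}. c k \<odot>\<^bsub>V\<^esub> e k)"
        using I ij(1,2,4) t by (intro M.finsum_insert) (auto simp: Pi_iff)
      finally show ?thesis unfolding I'[symmetric] .
    qed
    moreover have "c i = \<one>\<^bsub>K\<^esub>" "c j = \<ominus>\<^bsub>K\<^esub> \<one>\<^bsub>K\<^esub>" using ij(4) by (auto simp: c_def)
    moreover have "\<one>\<^bsub>K\<^esub> \<odot>\<^bsub>V\<^esub> e j \<oplus>\<^bsub>V\<^esub> ((\<ominus>\<^bsub>K\<^esub> \<one>\<^bsub>K\<^esub>) \<odot>\<^bsub>V\<^esub> e j \<oplus>\<^bsub>V\<^esub> \<zero>\<^bsub>V\<^esub>) = \<zero>\<^bsub>V\<^esub>"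
      using e[OF ij(2)] M.r_neg[OF e[OF ij(2)]] smult_minus_1[OF e[OF ij(2)]] smult_one[OF e[OF ij(2)]]
      by (metis M.a_inv_closed M.r_zero)
    ultimately have "(\<Oplus>\<^bsub>V\<^esub>k\<in>I. c k \<odot>\<^bsub>V\<^esub> e k) = \<zero>\<^bsub>V\<^esub>"
      unfolding ij(3) by metis
    from ind[OF c this ij(1)] show False by (simp add: c_def)
  qed
  show "lin_indpt (e ` I)"
  proof (rule finite_lin_indpt2)
    fix a assume a: "a \<in> e ` I \<rightarrow> carrier K" "lincomb a (e ` I) = \<zero>\<^bsub>V\<^esub>"
    have "lincomb a (e ` I) = (\<Oplus>\<^bsub>V\<^esub>i\<in>I. a (e i) \<odot>\<^bsub>V\<^esub> e i)"
      unfolding lincomb_def using a e inj by (intro M.finsum_reindex) (auto simp: Pi_iff)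
    then have z: "(\<Oplus>\<^bsub>V\<^esub>i\<in>I. a (e i) \<odot>\<^bsub>V\<^esub> e i) = \<zero>\<^bsub>V\<^esub>" using a(2) by simp
    have "(\<lambda>i. a (e i)) \<in> I \<rightarrow> carrier K" using a(1) by auto
    from ind[OF this z] show "\<forall>v\<in>e ` I. a v = \<zero>\<^bsub>K\<^esub>" by blast
  qed (use I e in auto)
qed

lemma
  assumes fd: fin_dim and I: "finite I" and e: "\<And>i. i \<in> I \<Longrightarrow> e i \<in> carrier V"
    and ind: "\<And>c i. c \<in> I \<rightarrow> carrier K \<Longrightarrow> (\<Oplus>\<^bsub>V\<^esub>i\<in>I. c i \<odot>\<^bsub>V\<^esub> e i) = \<zero>\<^bsub>V\<^esub> \<Longrightarrow> i \<in> I \<Longrightarrow> c i = \<zero>\<^bsub>K\<^esub>"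
  shows card_independent_family_le: "card I \<le> dim"
proof -
  have *: "inj_on e I" "lin_indpt (e ` I)"
    by (rule independent_family_inj[OF I e], assumption, rule ind, assumption+,
      rule independent_family_lin_indpt[OF I e], assumption, rule ind)
  have eI: "e ` I \<subseteq> carrier V" using e by blast
  show "card I \<le> dim" using li_le_dim(2)[OF fd eI *(2)] card_image[OF *(1)] by simp
qed

end

lemma dim_linear_bij_image:
  assumes T: "linear_map K V W T" and inj: "inj_on T (carrier V)" and B: "subspace K B V"
    and fd: "vectorspace.fin_dim K V"
  shows "vectorspace.dim K (V\<lparr>carrier := B\<rparr>) = vectorspace.dim K (W\<lparr>carrier := T ` B\<rparr>)"
proof -
  interpret T: linear_map K V W T by (rule T)
  have sm: "submodule K B V" using B by simp
  have BV: "B \<subseteq> carrier V" using sm by (simp add: submodule_def)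
  interpret B: vectorspace K "V\<lparr>carrier := B\<rparr>" by (rule T.V.subspace_is_vs[OF B])
  have hom: "T \<in> module_hom K (V\<lparr>carrier := B\<rparr>) (W\<lparr>carrier := T ` B\<rparr>)"
    by (rule module_hom_restrict[OF T.T_hom BV]) auto
  have homW: "T \<in> module_hom K (V\<lparr>carrier := B\<rparr>) W"
    using T.T_hom BV by (auto simp: module_hom_def Pi_iff subset_iff)
  interpret TB: linear_map K "V\<lparr>carrier := B\<rparr>" W T by unfold_locales (rule homW)
  have "subspace K (T ` B) W" using TB.imT_is_subspace by (simp add: TB.im_def)
  then interpret TBs: vectorspace K "W\<lparr>carrier := T ` B\<rparr>" by (rule T.W.subspace_is_vs)
  interpret TB': linear_map K "V\<lparr>carrier := B\<rparr>" "W\<lparr>carrier := T ` B\<rparr>" T by unfold_locales (rule hom)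
  show ?thesis
    by (rule TB'.dim_eq[OF T.V.subspace_dim_le(1)[OF fd B]]) (use inj BV in \<open>auto intro: inj_on_subset\<close>)
qed

section \<open>Function spaces as coordinate spaces, and the rank of a matrix\<close>

context field
begin

lemma func_space_vectorspace: "vectorspace R (func_space A)"
  by (intro vectorspace.intro func_space_is_module field_axioms)

lemma func_space_simps [simp]: "carrier (func_space A) = A \<rightarrow>\<^sub>E carrier R"
  "\<zero>\<^bsub>func_space A\<^esub> = (\<lambda>a\<in>A. \<zero>)" "f \<oplus>\<^bsub>func_space A\<^esub> g = (\<lambda>a\<in>A. f a \<oplus> g a)"
  "c \<odot>\<^bsub>func_space A\<^esub> f = (\<lambda>a\<in>A. c \<otimes> f a)"
  by (simp_all add: func_space_def)

lemma finsum_func_space: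
  assumes "finite I" "\<And>i. i \<in> I \<Longrightarrow> f i \<in> A \<rightarrow>\<^sub>E carrier R"
  shows "(\<Oplus>\<^bsub>func_space A\<^esub>i\<in>I. f i) = (\<lambda>a\<in>A. \<Oplus>i\<in>I. f i a)"
proof -
  interpret F: vectorspace R "func_space A" by (rule func_space_vectorspace)
  show ?thesis using assms
  proof (induction I rule: finite_induct)
    case (insert i I)
    then have "f \<in> I \<rightarrow> carrier (func_space A)" "f i \<in> carrier (func_space A)" by auto
    moreover have "(\<lambda>i. f i a) \<in> I \<rightarrow> carrier R" "f i a \<in> carrier R" if "a \<in> A" for a
      using insert.prems that by auto
    ultimately show ?case using insert by (auto simp: fun_eq_iff)
  qed simp
qed

lemma func_space_dim:
  assumes A: "finite A"
  shows "vectorspace.fin_dim R (func_space A)" "vectorspace.dim R (func_space A) = card A"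
proof -
  interpret F: vectorspace R "func_space A" by (rule func_space_vectorspace)
  define e where "e a = (\<lambda>x\<in>A. if x = a then \<one> else \<zero>)" for a
  have e: "e a \<in> carrier (func_space A)" for a by (auto simp: e_def)
  have sum: "(\<Oplus>\<^bsub>func_space A\<^esub>a\<in>A. c a \<odot>\<^bsub>func_space A\<^esub> e a) = (\<lambda>a\<in>A. c a)" if c: "c \<in> A \<rightarrow> carrier R" for c
  proof -
    have "(\<Oplus>\<^bsub>func_space A\<^esub>a\<in>A. c a \<odot>\<^bsub>func_space A\<^esub> e a) =
        (\<lambda>x\<in>A. \<Oplus>a\<in>A. (c a \<odot>\<^bsub>func_space A\<^esub> e a) x)"
      by (rule finsum_func_space[OF A]) (use c in \<open>auto simp: e_def\<close>)
    also have "\<dots> = (\<lambda>a\<in>A. c a)"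
    proof (rule restrict_ext)
      fix x assume x: "x \<in> A"
      have "(\<Oplus>a\<in>A. (c a \<odot>\<^bsub>func_space A\<^esub> e a) x) = (c x \<odot>\<^bsub>func_space A\<^esub> e x) x"
        using x A c by (intro finsum_single) (auto simp: e_def Pi_iff)
      then show "(\<Oplus>a\<in>A. (c a \<odot>\<^bsub>func_space A\<^esub> e a) x) = c x" using x c by (auto simp: e_def Pi_iff)
    qed
    finally show ?thesis .
  qed
  have "\<exists>c\<in>A \<rightarrow> carrier R. v = (\<Oplus>\<^bsub>func_space A\<^esub>a\<in>A. c a \<odot>\<^bsub>func_space A\<^esub> e a)"
    if v: "v \<in> carrier (func_space A)" for v
    using v sum[of v] by (intro bexI[of _ v]) (auto simp: PiE_def extensional_restrict)
  note * = F.dim_le_spanning_family[OF A e this]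
  show "F.fin_dim" by (rule *(1))
  have "card A \<le> F.dim"
  proof (rule F.card_independent_family_le[OF *(1) A e])
    fix c i assume c: "c \<in> A \<rightarrow> carrier R" and z: "(\<Oplus>\<^bsub>func_space A\<^esub>a\<in>A. c a \<odot>\<^bsub>func_space A\<^esub> e a) = \<zero>\<^bsub>func_space A\<^esub>"
      and i: "i \<in> A"
    from fun_cong[OF z, of i] show "c i = \<zero>" using sum[OF c] i by simp
  qed
  with *(2) show "F.dim = card A" by simp
qed

definition mat_image :: "'i set \<Rightarrow> 'j set \<Rightarrow> ('i \<Rightarrow> 'j \<Rightarrow> 'a) \<Rightarrow> ('i \<Rightarrow> 'a) set" where
  "mat_image A C M = (\<lambda>x. \<lambda>a\<in>A. \<Oplus>c\<in>C. M a c \<otimes> x c) ` (C \<rightarrow>\<^sub>E carrier R)"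

text \<open>Rank as the dimension of the column space. The index types are arbitrary because rows
  and columns will be indexed by pairs of a basis number and a monomial.\<close>

definition mat_rank :: "'i set \<Rightarrow> 'j set \<Rightarrow> ('i \<Rightarrow> 'j \<Rightarrow> 'a) \<Rightarrow> nat" where
  "mat_rank A C M = vectorspace.dim R (func_space A\<lparr>carrier := mat_image A C M\<rparr>)"

end

section \<open>Monomial ideals\<close>

context poly_over
begin

lemma S_induct_terms:
  assumes f: "f \<in> carrier S" and zero: "\<zero>\<^bsub>S\<^esub> \<in> U"
    and add: "\<And>g h. g \<in> U \<Longrightarrow> h \<in> U \<Longrightarrow> g \<oplus>\<^bsub>S\<^esub> h \<in> U"
    and terms: "\<And>m. f m \<noteq> \<zero> \<Longrightarrow> mterm (f m) m \<in> U"
  shows "f \<in> U"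
proof -
  have "finite A \<Longrightarrow> (\<lambda>m. if m \<in> A then f m else \<zero>) \<in> U" for A
  proof (induction A rule: finite_induct)
    case empty
    show ?case using zero by (simp add: S_zero)
  next
    case (insert s A)
    have eq: "(\<lambda>m. if m \<in> insert s A then f m else \<zero>) = (\<lambda>m. if m \<in> A then f m else \<zero>) \<oplus>\<^bsub>S\<^esub> mterm (f s) s"
      using insert.hyps S_coeff[OF f] by (auto simp: S_add mterm_def fun_eq_iff)
    have "mterm (f s) s \<in> U"
    proof (cases "f s = \<zero>")
      case True
      then show ?thesis using zero by (auto simp: mterm_def S_zero cong: if_cong)
    qed (rule terms)
    then show ?case unfolding eq by (intro add insert.IH)
  qed
  moreover have "finite {m. f m \<noteq> \<zero>}" using f unfolding carrier_S by blast
  ultimately have "(\<lambda>m. if m \<in> {m. f m \<noteq> \<zero>} then f m else \<zero>) \<in> U" by blast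
  moreover have "(\<lambda>m. if m \<in> {m. f m \<noteq> \<zero>} then f m else \<zero>) = f" by auto
  ultimately show ?thesis by simp
qed

text \<open>Monomials divisible by no generator are closed under taking divisors, so the right-hand
  side is an ideal. Conversely each of its elements is a sum of terms, and each term is a multiple
  of a generator.\<close>

lemma monomial_ideal:
  assumes G: "\<And>s. s \<in> G \<Longrightarrow> vars_ok s"
  shows "genideal S (monomial K ` G) = {f \<in> carrier S. \<forall>m. (\<forall>s\<in>G. \<not> s \<subseteq># m) \<longrightarrow> f m = \<zero>}" (is "_ = ?I")
proof
  have sub: "monomial K ` G \<subseteq> carrier S" using G by (auto simp: monomial_mterm)
  interpret g: ideal "genideal S (monomial K ` G)" S by (rule S.genideal_ideal[OF sub])
  have "ideal ?I S"
  proof (rule idealI)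
    show "ring S" by (rule S.ring_axioms)
    show "subgroup ?I (add_monoid S)"
    proof (rule S.add.subgroupI)
      show "?I \<noteq> {}" using S.zero_closed by (auto simp: S_zero)
    qed (auto simp: S_minus S_add uminus_closed_S S_add_closed[unfolded S_add])
    show l: "x \<otimes>\<^bsub>S\<^esub> a \<in> ?I" if a: "a \<in> ?I" and x: "x \<in> carrier S" for a x
    proof -
      have "(x \<otimes>\<^bsub>S\<^esub> a) m = \<zero>" if m: "\<forall>s\<in>G. \<not> s \<subseteq># m" for m
      proof -
        have "x t \<otimes> a (m - t) = \<zero>" if "t \<subseteq># m" for t
        proof -
          have "\<forall>s\<in>G. \<not> s \<subseteq># m - t" using m by (meson diff_subset_eq_self subset_mset.order_trans)
          then have "a (m - t) = \<zero>" using a by blast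
          then show ?thesis using S_coeff[OF x] by simp
        qed
        then show ?thesis unfolding S_mult by (intro add.finprod_one_eqI) auto
      qed
      then show ?thesis using a x S.m_closed by blast
    qed
    show "a \<otimes>\<^bsub>S\<^esub> x \<in> ?I" if "a \<in> ?I" "x \<in> carrier S" for a x
      using l[OF that] that S.m_comm[of a x] by simp
  qed
  moreover have "monomial K ` G \<subseteq> ?I" using sub by (auto simp: monomial_def)
  ultimately show "genideal S (monomial K ` G) \<subseteq> ?I" by (rule S.genideal_minimal)
  show "?I \<subseteq> genideal S (monomial K ` G)"
  proof
    fix f assume f: "f \<in> ?I"
    then have fS: "f \<in> carrier S" by simp
    show "f \<in> genideal S (monomial K ` G)"
    proof (rule S_induct_terms[OF fS])
      fix m assume nz: "f m \<noteq> \<zero>"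
      then obtain s where s: "s \<in> G" "s \<subseteq># m" using f by blast
      have ok: "vars_ok m" using nz fS by (auto simp: carrier_S)
      have "mterm (f m) m = mterm (f m) (m - s) \<otimes>\<^bsub>S\<^esub> monomial K s"
        using s S_coeff[OF fS] by (simp add: monomial_mterm mterm_mult_mterm)
      moreover have "monomial K s \<in> genideal S (monomial K ` G)"
        using S.genideal_self[OF sub] s by blast
      ultimately show "mterm (f m) m \<in> genideal S (monomial K ` G)"
        using g.I_l_closed[OF _ mterm_closed[OF S_coeff[OF fS] vars_ok_diff[OF ok]]] by metis
    qed (auto intro: g.a_closed)
  qed
qed

text \<open>Every admissible monomial except the empty one is divisible by a variable.\<close>

lemma irrelevant_ideal_eq: "irrelevant_ideal K n = {f \<in> carrier S. f {#} = \<zero>}"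
proof -
  have "{monomial K {#i#} | i. i \<in> {1..n}} = monomial K ` ((\<lambda>i. {#i#}) ` {1..n})" by auto
  moreover have ok: "\<And>s. s \<in> (\<lambda>i. {#i#}) ` {1..n} \<Longrightarrow> vars_ok s" by auto
  ultimately have "irrelevant_ideal K n = {f \<in> carrier S. \<forall>m. (\<forall>s\<in>(\<lambda>i. {#i#}) ` {1..n}. \<not> s \<subseteq># m) \<longrightarrow> f m = \<zero>}"
    unfolding irrelevant_ideal_def using monomial_ideal[OF ok] by simp
  moreover have "(\<forall>m. (\<forall>s\<in>(\<lambda>i. {#i#}) ` {1..n}. \<not> s \<subseteq># m) \<longrightarrow> f m = \<zero>) \<longleftrightarrow> f {#} = \<zero>" if f: "f \<in> carrier S" for f
  proof
    assume z: "f {#} = \<zero>"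
    show "\<forall>m. (\<forall>s\<in>(\<lambda>i. {#i#}) ` {1..n}. \<not> s \<subseteq># m) \<longrightarrow> f m = \<zero>"
    proof (intro allI impI, rule ccontr)
      fix m assume m: "\<forall>s\<in>(\<lambda>i. {#i#}) ` {1..n}. \<not> s \<subseteq># m" and nz: "f m \<noteq> \<zero>"
      have "vars_ok m" using nz f by (auto simp: carrier_S)
      have "i \<notin># m" for i
      proof
        assume "i \<in># m"
        then have "{#i#} \<subseteq># m" "i \<in> {1..n}" using \<open>vars_ok m\<close> by (auto simp: vars_ok_def)
        then show False using m by blast
      qed
      then have "set_mset m = {}" by blast
      then show False using nz z by simp
    qed
  qed simp
  ultimately show ?thesis by blast
qed

end

section \<open>Betti numbers of a Stanley--Reisner ring as ranks\<close>

locale sr_over = poly_over K n for K :: "('a, 'c) ring_scheme" (structure) and n +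
  fixes \<Delta> :: "nat set set"
  assumes \<Delta>_vertices: "w \<in> \<Delta> \<Longrightarrow> w \<subseteq> {1..n}" and \<Delta>_down: "w \<in> \<Delta> \<Longrightarrow> w' \<subseteq> w \<Longrightarrow> w' \<in> \<Delta>"
begin

abbreviation J where "J \<equiv> sr_ideal K n \<Delta>"

text \<open>As \<Delta> is closed under subsets, a monomial is divisible by the monomial of a
  non-face exactly if its own support is a non-face. So the monomials supported on faces are a basis
  of S/J.\<close>

lemma sr_ideal_eq: "J = {f \<in> carrier S. \<forall>m. set_mset m \<in> \<Delta> \<longrightarrow> f m = \<zero>}"
proof -
  let ?G = "mset_set ` {w. w \<subseteq> {1..n} \<and> w \<notin> \<Delta>}"
  have fin: "finite w" if "w \<subseteq> {1..n}" for w :: "nat set" using that finite_subset by blast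
  have "{monomial K (mset_set w) | w. w \<subseteq> {1..n} \<and> w \<notin> \<Delta>} = monomial K ` ?G" by auto
  moreover have ok: "vars_ok s" if s: "s \<in> ?G" for s
  proof -
    obtain w where "s = mset_set w" "w \<subseteq> {1..n}" using s by blast
    with fin show ?thesis unfolding vars_ok_def by (simp only: finite_set_mset_mset_set)
  qed
  ultimately have Jeq: "J = {f \<in> carrier S. \<forall>m. (\<forall>s\<in>?G. \<not> s \<subseteq># m) \<longrightarrow> f m = \<zero>}"
    unfolding sr_ideal_def using monomial_ideal[OF ok] by (simp only:)
  have iff: "(\<forall>s\<in>?G. \<not> s \<subseteq># m) \<longleftrightarrow> set_mset m \<in> \<Delta>" if m: "vars_ok m" for m
  proof
    assume *: "\<forall>s\<in>?G. \<not> s \<subseteq># m"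
    show "set_mset m \<in> \<Delta>"
    proof (rule ccontr)
      assume "set_mset m \<notin> \<Delta>"
      then have "mset_set (set_mset m) \<in> ?G" using m by (auto simp: vars_ok_def)
      moreover have "mset_set (set_mset m) \<subseteq># m" by (simp add: mset_set_set_mset_msubset)
      ultimately show False using * by blast
    qed
  next
    assume *: "set_mset m \<in> \<Delta>"
    show "\<forall>s\<in>?G. \<not> s \<subseteq># m"
    proof clarify
      fix w assume w: "w \<subseteq> {1..n}" "w \<notin> \<Delta>" "mset_set w \<subseteq># m"
      have "w \<subseteq> set_mset m" using set_mset_mono[OF w(3)] fin[OF w(1)] by simp
      then show False using \<Delta>_down[OF *] w(2) by blast
    qed
  qed
  have van: "f m = \<zero>" if "f \<in> carrier S" "\<not> vars_ok m" for f m using that unfolding carrier_S by blast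
  have ok': "vars_ok m" if "set_mset m \<in> \<Delta>" for m using \<Delta>_vertices[OF that] by (simp add: vars_ok_def)
  have "(\<forall>m. (\<forall>s\<in>?G. \<not> s \<subseteq># m) \<longrightarrow> f m = \<zero>) \<longleftrightarrow> (\<forall>m. set_mset m \<in> \<Delta> \<longrightarrow> f m = \<zero>)"
    if f: "f \<in> carrier S" for f
    using iff ok' van[OF f] by metis
  then show ?thesis unfolding Jeq by (intro Collect_cong conj_cong refl)
qed

lemma J_ideal: "ideal J S"
  unfolding sr_ideal_def
proof (rule S.genideal_ideal, clarify)
  fix w assume w: "w \<subseteq> {1..n}"
  then have "finite w" by (rule finite_subset) simp
  with w have "vars_ok (mset_set w)" by (simp add: vars_ok_def)
  then show "monomial K (mset_set w) \<in> carrier S" unfolding monomial_mterm by (intro mterm_closed) simp_all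
qed

end

sublocale sr_over \<subseteq> poly_quotient K n "sr_ideal K n \<Delta>"
  by (intro poly_quotient.intro poly_over_axioms J_ideal)

context sr_over
begin

text \<open>For \<open>set_mset m \<in> \<Delta>\<close> the coefficient of \<open>m\<close> does not depend on the chosen representative,
  as it vanishes on the monomial ideal \<open>J\<close>. For the other \<open>m\<close> the value is meaningless.\<close>

definition coeff_of :: "'a mpoly set \<Rightarrow> nat multiset \<Rightarrow> 'a" where
  "coeff_of U m = (SOME f. f \<in> U) m"

lemma coeff_of_coset:
  assumes f: "f \<in> carrier S" and m: "set_mset m \<in> \<Delta>"
  shows "coeff_of (J +>\<^bsub>S\<^esub> f) m = f m"
proof -
  define y where "y = (SOME g. g \<in> J +>\<^bsub>S\<^esub> f)"
  have "f \<in> J +>\<^bsub>S\<^esub> f" using f by (rule J.a_rcos_self)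
  then have "y \<in> J +>\<^bsub>S\<^esub> f" unfolding y_def by (rule someI[of "\<lambda>g. g \<in> J +>\<^bsub>S\<^esub> f"])
  then obtain h where h: "h \<in> J" "y = h \<oplus>\<^bsub>S\<^esub> f" unfolding a_r_coset_def' by blast
  have "h m = \<zero>" using h(1) m unfolding sr_ideal_eq by blast
  then have "y m = f m" using S_coeff[OF f] unfolding h(2) S_add by simp
  then show ?thesis unfolding coeff_of_def y_def .
qed

text \<open>The pair (b, m) stands for m e_b. These elements form a K-basis of the degree-d part of
  the direct sum of the (S/J)(- dg b).\<close>

definition basis_index :: "nat \<Rightarrow> (nat \<Rightarrow> int) \<Rightarrow> int \<Rightarrow> (nat \<times> nat multiset) set" where
  "basis_index r dg d = (SIGMA b:{..<r}. {m. int (size m) = d - dg b \<and> set_mset m \<in> \<Delta>})"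

lemma finite_basis_index: "finite (basis_index r dg d)"
  unfolding basis_index_def
proof (rule finite_SigmaI)
  fix b
  have "{m. int (size m) = d - dg b \<and> set_mset m \<in> \<Delta>} \<subseteq> multisets_of_size {1..n} (nat (d - dg b))"
    using \<Delta>_vertices by (auto simp: multisets_of_size_def)
  then show "finite {m. int (size m) = d - dg b \<and> set_mset m \<in> \<Delta>}"
    by (rule finite_subset) auto
qed simp

definition coord :: "nat \<Rightarrow> (nat \<Rightarrow> int) \<Rightarrow> int \<Rightarrow> (nat \<Rightarrow> 'a mpoly set) \<Rightarrow> nat \<times> nat multiset \<Rightarrow> 'a" where
  "coord r dg d v = (\<lambda>x\<in>basis_index r dg d. coeff_of (v (fst x)) (snd x))"

lemma gvec_Q_cases:
  assumes "v \<in> Q.gvec r dg d"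
  obtains f where "f \<in> S.gvec r dg d" "v = vmap (a_r_coset S J) r f"
proof -
  have "\<forall>b\<in>{..<r}. \<exists>f. f \<in> homogeneous K n (d - dg b) \<and> J +>\<^bsub>S\<^esub> f = v b"
    using assms by (fastforce simp: Q.gvec_def PiE_iff)
  then obtain f where f: "\<forall>b\<in>{..<r}. f b \<in> homogeneous K n (d - dg b) \<and> J +>\<^bsub>S\<^esub> f b = v b" by metis
  show ?thesis
  proof (rule that)
    show "restrict f {..<r} \<in> S.gvec r dg d" using f by (auto simp: S.gvec_def)
    show "v = vmap (a_r_coset S J) r (restrict f {..<r})"
      using f assms by (auto simp: vmap_def fun_eq_iff Q.gvec_def PiE_def extensional_def)
  qed
qed

lemma coord_vmap:
  assumes f: "f \<in> S.gvec r dg d"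
  shows "coord r dg d (vmap (a_r_coset S J) r f) = (\<lambda>x\<in>basis_index r dg d. f (fst x) (snd x))"
  unfolding coord_def
proof (rule restrict_ext)
  fix x assume "x \<in> basis_index r dg d"
  then have x: "fst x < r" "set_mset (snd x) \<in> \<Delta>" by (auto simp: basis_index_def)
  have "f (fst x) \<in> homogeneous K n (d - dg (fst x))" using f x(1) by (auto simp: S.gvec_def)
  note fc = homogeneousD(1)[OF this]
  show "coeff_of (vmap (a_r_coset S J) r f (fst x)) (snd x) = f (fst x) (snd x)"
    using x(1) coeff_of_coset[OF fc x(2)] by (simp add: vmap_def)
qed

lemma coord_closed:
  assumes v: "v \<in> Q.gvec r dg d"
  shows "coord r dg d v \<in> basis_index r dg d \<rightarrow>\<^sub>E carrier K"
proof -
  obtain f where f: "f \<in> S.gvec r dg d" "v = vmap (a_r_coset S J) r f" using v by (rule gvec_Q_cases)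
  have "f b m \<in> carrier K" if "b < r" for b m
    using f that by (intro S_coeff homogeneousD(1)) (auto simp: S.gvec_def)
  then show ?thesis unfolding f(2) coord_vmap[OF f(1)] by (auto simp: basis_index_def)
qed

lemma coord_linear: "linear_map K (Q.gspace r dg d) (func_space (basis_index r dg d)) (coord r dg d)"
proof -
  interpret A: vectorspace K "Q.gspace r dg d" by (rule Q.gspace_vectorspace)
  interpret B: vectorspace K "func_space (basis_index r dg d)" by (rule func_space_vectorspace)
  have "coord r dg d (vadd Q r v w) = (\<lambda>x\<in>basis_index r dg d. coord r dg d v x \<oplus> coord r dg d w x)"
    if vw: "v \<in> Q.gvec r dg d" "w \<in> Q.gvec r dg d" for v w
  proof -
    obtain f where f: "f \<in> S.gvec r dg d" "v = vmap (a_r_coset S J) r f" using vw(1) by (rule gvec_Q_cases)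
    obtain g where g: "g \<in> S.gvec r dg d" "w = vmap (a_r_coset S J) r g" using vw(2) by (rule gvec_Q_cases)
    have c: "f b \<in> carrier S" "g b \<in> carrier S" if "b < r" for b
      using f g that by (auto simp: S.gvec_def intro!: homogeneousD(1))
    have "vadd Q r v w = vmap (a_r_coset S J) r (vadd S r f g)"
      using c by (auto simp: vadd_def f(2) g(2) vmap_def fun_eq_iff)
    moreover have "vadd S r f g \<in> S.gvec r dg d"
      using f g unfolding S.gvec_def vadd_def by (intro restrict_PiE_iff [THEN iffD2]) (auto intro: S.H_add)
    ultimately have "coord r dg d (vadd Q r v w) = (\<lambda>x\<in>basis_index r dg d. vadd S r f g (fst x) (snd x))"
      by (simp only: coord_vmap)
    also have "\<dots> = (\<lambda>x\<in>basis_index r dg d. coord r dg d v x \<oplus> coord r dg d w x)"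
      unfolding f(2) g(2) coord_vmap[OF f(1)] coord_vmap[OF g(1)]
    proof (rule restrict_ext)
      fix x assume x: "x \<in> basis_index r dg d"
      then have "fst x < r" by (auto simp: basis_index_def)
      then have "vadd S r f g (fst x) = f (fst x) \<oplus>\<^bsub>S\<^esub> g (fst x)" by (simp add: vadd_def)
      then show "vadd S r f g (fst x) (snd x) = (\<lambda>x\<in>basis_index r dg d. f (fst x) (snd x)) x \<oplus>
          (\<lambda>x\<in>basis_index r dg d. g (fst x) (snd x)) x"
        using x by (simp only: S_add restrict_apply if_True)
    qed
    finally show ?thesis .
  qed
  moreover have "coord r dg d (vscale Q r (kQ c) v) = (\<lambda>x\<in>basis_index r dg d. c \<otimes> coord r dg d v x)"
    if cv: "c \<in> carrier K" "v \<in> Q.gvec r dg d" for c v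
  proof -
    obtain f where f: "f \<in> S.gvec r dg d" "v = vmap (a_r_coset S J) r f" using cv(2) by (rule gvec_Q_cases)
    have fc: "f b \<in> carrier S" if "b < r" for b
      using f that by (auto simp: S.gvec_def intro!: homogeneousD(1))
    have mc: "mterm c {#} \<in> homogeneous K n 0" using mterm_homogeneous[OF cv(1), of "{#}"] by simp
    have "vscale Q r (kQ c) v = vmap (a_r_coset S J) r (vscale S r (mterm c {#}) f)"
      using fc cv by (auto simp: vscale_def f(2) vmap_def fun_eq_iff indexed_const_mterm)
    moreover have "vscale S r (mterm c {#}) f \<in> S.gvec r dg d"
      using f S.H_mult[OF mc] unfolding S.gvec_def vscale_def
      by (intro restrict_PiE_iff [THEN iffD2]) fastforce
    moreover have "(mterm c {#} \<otimes>\<^bsub>S\<^esub> f b) m = c \<otimes> f b m" if "b < r" for b m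
      using fc[OF that] cv by (simp add: mterm_mult S_coeff)
    ultimately have e: "coord r dg d (vscale Q r (kQ c) v) =
          (\<lambda>x\<in>basis_index r dg d. vscale S r (mterm c {#}) f (fst x) (snd x))"
      and mm: "\<And>b m. b < r \<Longrightarrow> (mterm c {#} \<otimes>\<^bsub>S\<^esub> f b) m = c \<otimes> f b m"
      by (simp_all only: coord_vmap)
    note e
    also have "(\<lambda>x\<in>basis_index r dg d. vscale S r (mterm c {#}) f (fst x) (snd x)) =
        (\<lambda>x\<in>basis_index r dg d. c \<otimes> coord r dg d v x)"
      unfolding f(2) coord_vmap[OF f(1)]
    proof (rule restrict_ext)
      fix x assume x: "x \<in> basis_index r dg d"
      then have l: "fst x < r" by (auto simp: basis_index_def)
      then have "vscale S r (mterm c {#}) f (fst x) = mterm c {#} \<otimes>\<^bsub>S\<^esub> f (fst x)" by (simp add: vscale_def)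
      then show "vscale S r (mterm c {#}) f (fst x) (snd x) = c \<otimes> (\<lambda>x\<in>basis_index r dg d. f (fst x) (snd x)) x"
        using x mm[OF l] by (simp only: restrict_apply if_True)
    qed
    finally show ?thesis .
  qed
  ultimately show ?thesis
    by unfold_locales (auto simp: module_hom_def coord_closed simp del: restrict_apply)
qed

text \<open>Two homogeneous lifts with the same coordinates agree on all monomials supported on
  faces, so they differ by an element of J. For surjectivity the given coordinates themselves serve
  as coefficients of a lift.\<close>

lemma coord_bij: "bij_betw (coord r dg d) (Q.gvec r dg d) (basis_index r dg d \<rightarrow>\<^sub>E carrier K)"
  unfolding bij_betw_def
proof
  show "inj_on (coord r dg d) (Q.gvec r dg d)"
  proof (rule inj_onI)
    fix v w assume v: "v \<in> Q.gvec r dg d" and w: "w \<in> Q.gvec r dg d" and eq: "coord r dg d v = coord r dg d w"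
    obtain f where f: "f \<in> S.gvec r dg d" "v = vmap (a_r_coset S J) r f" using v by (rule gvec_Q_cases)
    obtain g where g: "g \<in> S.gvec r dg d" "w = vmap (a_r_coset S J) r g" using w by (rule gvec_Q_cases)
    have "v b = w b" if b: "b < r" for b
    proof -
      have h: "f b \<in> homogeneous K n (d - dg b)" "g b \<in> homogeneous K n (d - dg b)"
        using f g b by (auto simp: S.gvec_def)
      note c = homogeneousD(1)[OF h(1)] homogeneousD(1)[OF h(2)]
      have e: "f b m = g b m" if "set_mset m \<in> \<Delta>" for m
      proof (cases "int (size m) = d - dg b")
        case True
        then have "(b, m) \<in> basis_index r dg d" using b that by (simp add: basis_index_def)
        then show ?thesis using fun_cong[OF eq, of "(b, m)"] by (simp add: f(2) g(2) coord_vmap f(1) g(1))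
      qed (use homogeneousD(2)[OF h(1)] homogeneousD(2)[OF h(2)] in simp)
      have "f b \<ominus>\<^bsub>S\<^esub> g b \<in> J"
        unfolding sr_ideal_eq
      proof (intro CollectI conjI allI impI)
        show "f b \<ominus>\<^bsub>S\<^esub> g b \<in> carrier S" using c by (rule S.minus_closed)
        fix m assume "set_mset m \<in> \<Delta>"
        then have "f b m = g b m" by (rule e)
        moreover have "(f b \<ominus>\<^bsub>S\<^esub> g b) m = f b m \<oplus> \<ominus> g b m" by (simp only: a_minus_def S_add S_minus[OF c(2)])
        ultimately show "(f b \<ominus>\<^bsub>S\<^esub> g b) m = \<zero>" using r_neg[OF S_coeff[OF c(2)], of m] by (simp only:)
      qed
      then have "J +>\<^bsub>S\<^esub> f b = J +>\<^bsub>S\<^esub> g b" 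
        using c J.a_rcos_module_minus[OF S.ring_axioms c(2,1)] J.a_repr_independence'[of "f b" "g b"] by simp
      then show ?thesis using b by (simp add: f(2) g(2) vmap_def)
    qed
    then show "v = w" using Q.gvec_vset[OF v] Q.gvec_vset[OF w] by (intro vset_eqI)
  qed
  show "coord r dg d ` Q.gvec r dg d = basis_index r dg d \<rightarrow>\<^sub>E carrier K"
  proof
    show "coord r dg d ` Q.gvec r dg d \<subseteq> basis_index r dg d \<rightarrow>\<^sub>E carrier K" using coord_closed by blast
    show "basis_index r dg d \<rightarrow>\<^sub>E carrier K \<subseteq> coord r dg d ` Q.gvec r dg d"
    proof
      fix x assume x: "x \<in> basis_index r dg d \<rightarrow>\<^sub>E carrier K"
      define f where "f = (\<lambda>b\<in>{..<r}. \<lambda>m. if (b, m) \<in> basis_index r dg d then x (b, m) else \<zero>)"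
      have "f b \<in> homogeneous K n (d - dg b)" if b: "b < r" for b
      proof (rule homogeneousI)
        have "{m. f b m \<noteq> \<zero>} \<subseteq> snd ` basis_index r dg d"
          using b by (force simp: f_def split: if_splits)
        then have "finite {m. f b m \<noteq> \<zero>}" using finite_basis_index finite_subset by blast
        moreover have "f b m \<in> carrier K" for m using x b by (auto simp: f_def)
        moreover have "vars_ok m" if "f b m \<noteq> \<zero>" for m
          using that b \<Delta>_vertices by (auto simp: f_def basis_index_def vars_ok_def split: if_splits)
        ultimately show "f b \<in> carrier S" unfolding carrier_S by blast
        show "f b m = \<zero>" if "int (size m) \<noteq> d - dg b" for m
          using that b by (auto simp: f_def basis_index_def)
      qed
      then have f: "f \<in> S.gvec r dg d" by (auto simp: S.gvec_def f_def)
      have "coord r dg d (vmap (a_r_coset S J) r f) = x"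
        unfolding coord_vmap[OF f]
      proof (rule PiE_ext[OF _ x])
        show "(\<lambda>y\<in>basis_index r dg d. f (fst y) (snd y)) \<in> basis_index r dg d \<rightarrow>\<^sub>E carrier K"
          using x by (auto simp: f_def basis_index_def)
        fix y assume "y \<in> basis_index r dg d"
        then show "(\<lambda>y\<in>basis_index r dg d. f (fst y) (snd y)) y = x y" by (auto simp: f_def basis_index_def)
      qed
      moreover have "vmap (a_r_coset S J) r f \<in> Q.gvec r dg d"
        using f by (auto simp: S.gvec_def Q.gvec_def vmap_def)
      ultimately show "x \<in> coord r dg d ` Q.gvec r dg d" by blast
    qed
  qed
qed

text \<open>Finite dimension is carried over along the inverse of \<open>coord\<close>, a surjection
  from the function space; then \<open>coord\<close> compares the dimensions.\<close>

lemma gspace_dim: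
  "vectorspace.fin_dim K (Q.gspace r dg d)" "vectorspace.dim K (Q.gspace r dg d) = card (basis_index r dg d)"
proof -
  interpret T: linear_map K "Q.gspace r dg d" "func_space (basis_index r dg d)" "coord r dg d"
    by (rule coord_linear)
  let ?T' = "the_inv_into (Q.gvec r dg d) (coord r dg d)"
  note b = coord_bij[of r dg d, unfolded bij_betw_def]
  have b': "bij_betw ?T' (basis_index r dg d \<rightarrow>\<^sub>E carrier K) (Q.gvec r dg d)"
    by (rule bij_betw_the_inv_into[OF coord_bij])
  interpret T': linear_map K "func_space (basis_index r dg d)" "Q.gspace r dg d" ?T'
  proof unfold_locales
    have inv: "?T' (coord r dg d v) = v" if "v \<in> Q.gvec r dg d" for v
      by (rule the_inv_into_f_f[OF conjunct1[OF b] that])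
    have cases: "\<exists>v\<in>Q.gvec r dg d. coord r dg d v = x" if "x \<in> basis_index r dg d \<rightarrow>\<^sub>E carrier K" for x
      using that unfolding conjunct2[OF b, symmetric] by blast
    have "?T' (x \<oplus>\<^bsub>func_space (basis_index r dg d)\<^esub> y) = ?T' x \<oplus>\<^bsub>Q.gspace r dg d\<^esub> ?T' y"
      if xy: "x \<in> basis_index r dg d \<rightarrow>\<^sub>E carrier K" "y \<in> basis_index r dg d \<rightarrow>\<^sub>E carrier K" for x y
    proof -
      obtain v w where "v \<in> Q.gvec r dg d" "x = coord r dg d v" "w \<in> Q.gvec r dg d" "y = coord r dg d w"
        using cases xy by metis
      then show ?thesis using T.T_add[of v w] inv T.V.module.M.a_closed[of v w] by (metis Q.gspace_simps(1))
    qed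
    moreover have "?T' (c \<odot>\<^bsub>func_space (basis_index r dg d)\<^esub> x) = c \<odot>\<^bsub>Q.gspace r dg d\<^esub> ?T' x"
      if cx: "c \<in> carrier K" "x \<in> basis_index r dg d \<rightarrow>\<^sub>E carrier K" for c x
    proof -
      obtain v where "v \<in> Q.gvec r dg d" "x = coord r dg d v" using cases cx by metis
      then show ?thesis using T.T_smult[of c v] inv T.V.module.smult_closed[of c v] cx by (metis Q.gspace_simps(1))
    qed
    ultimately show "?T' \<in> module_hom K (func_space (basis_index r dg d)) (Q.gspace r dg d)"
      using bij_betw_imp_funcset[OF b'] unfolding module_hom_def func_space_simps(1) Q.gspace_simps(1) by blast
  qed
  show fd: "vectorspace.fin_dim K (Q.gspace r dg d)"
    by (rule T'.surj_fin_dim[OF func_space_dim(1)[OF finite_basis_index]])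
      (use b' in \<open>simp add: bij_betw_def\<close>)
  show "vectorspace.dim K (Q.gspace r dg d) = card (basis_index r dg d)"
    using T.dim_eq[OF fd] b func_space_dim(2)[OF finite_basis_index] by simp
qed

text \<open>In the monomial bases the entry at row (a, m) and column (b, t) is the coefficient of m
  / t in D a b. The convolution over all divisors t of m may be restricted to basis monomials, since
  a divisor of m is again supported on a face and f b vanishes outside its degree.\<close>

lemma coord_mat_vec:
  assumes D: "S.gmat r s dr ds D" and v: "v \<in> Q.gvec s ds d"
  shows "coord r dr d (mat_vec Q r s (qmat D) v) = (\<lambda>x\<in>basis_index r dr d. \<Oplus>y\<in>basis_index s ds d.
     (if snd y \<subseteq># snd x then D (fst x) (fst y) (snd x - snd y) else \<zero>) \<otimes> coord s ds d v y)"
proof -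
  obtain f where f: "f \<in> S.gvec s ds d" "v = vmap (a_r_coset S J) s f" using v by (rule gvec_Q_cases)
  have fh: "f b \<in> homogeneous K n (d - ds b)" if "b < s" for b using f that by (auto simp: S.gvec_def)
  have eq: "mat_vec Q r s (qmat D) v = vmap (a_r_coset S J) r (mat_vec S r s D f)"
    unfolding f(2) by (rule qmat_vmap[OF D S.gvec_vset[OF f(1)]])
  show ?thesis
    unfolding eq coord_vmap[OF S.gmat_gvec[OF D f(1)]]
  proof (rule restrict_ext)
    fix x assume x: "x \<in> basis_index r dr d"
    obtain a m where am: "x = (a, m)" "a < r" "set_mset m \<in> \<Delta>" using x by (auto simp: basis_index_def)
    have Dc: "D a b \<in> carrier S" if "b < s" for b
      using D that am by (auto simp: S.gmat_def intro: homogeneousD(1))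
    have fc: "f b \<in> carrier S" if "b < s" for b using fh[OF that] by (rule homogeneousD(1))
    note cc = S_coeff[OF Dc] S_coeff[OF fc]
    let ?g = "\<lambda>b t. (if t \<subseteq># m then D a b (m - t) else \<zero>) \<otimes> f b t"
    let ?C = "\<lambda>b. {t. int (size t) = d - ds b \<and> set_mset t \<in> \<Delta>}"
    have finC: "finite (?C b)" if "b < s" for b
    proof -
      have "?C b \<subseteq> snd ` basis_index s ds d" using that by (force simp: basis_index_def)
      then show ?thesis using finite_basis_index finite_subset by blast
    qed
    have "mat_vec S r s D f a m = (\<Oplus>b\<in>{..<s}. (D a b \<otimes>\<^bsub>S\<^esub> f b) m)"
    proof -
      have "mat_vec S r s D f a m = (\<Oplus>\<^bsub>S\<^esub>b\<in>{..<s}. D a b \<otimes>\<^bsub>S\<^esub> f b) m"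
        using am by (simp add: mat_vec_def)
      also have "\<dots> = (\<Oplus>b\<in>{..<s}. (D a b \<otimes>\<^bsub>S\<^esub> f b) m)"
        by (rule S_finsum_coeff) (use Dc fc in \<open>auto intro: S.m_closed\<close>)
      finally show ?thesis .
    qed
    also have "\<dots> = (\<Oplus>b\<in>{..<s}. \<Oplus>t\<in>?C b. ?g b t)"
    proof (rule finsum_cong')
      show "(\<lambda>b. \<Oplus>t\<in>?C b. ?g b t) \<in> {..<s} \<rightarrow> carrier K"
        using cc by (auto intro!: finsum_closed)
      fix b assume "b \<in> {..<s}"
      then have b: "b < s" by simp
      have "(D a b \<otimes>\<^bsub>S\<^esub> f b) m = (\<Oplus>t\<in>{t. t \<subseteq># m}. f b t \<otimes> D a b (m - t))"
        using S.m_comm[OF Dc[OF b] fc[OF b]] by (simp add: S_mult)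
      also have "\<dots> = (\<Oplus>t\<in>?C b. ?g b t)"
      proof (rule add.finprod_mono_neutral_cong)
        show "f b t \<otimes> D a b (m - t) = \<zero>" if t: "t \<in> {t. t \<subseteq># m} - ?C b" for t
        proof -
          have "set_mset t \<in> \<Delta>" using t \<Delta>_down[OF am(3)] set_mset_mono[of t m] by auto
          then have "f b t = \<zero>" using t homogeneousD(2)[OF fh[OF b]] by auto
          then show ?thesis using cc b by simp
        qed
        show "f b t \<otimes> D a b (m - t) = ?g b t" if "t \<in> {t. t \<subseteq># m} \<inter> ?C b" for t
          using that cc b by (simp add: m_comm)
      qed (use b cc finC in \<open>auto simp: finite_submultisets\<close>)
      finally show "(D a b \<otimes>\<^bsub>S\<^esub> f b) m = (\<Oplus>t\<in>?C b. ?g b t)" .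
    qed simp
    also have "\<dots> = (\<Oplus>y\<in>basis_index s ds d. ?g (fst y) (snd y))"
      unfolding basis_index_def using finC cc by (intro finsum_Sigma) auto
    also have "\<dots> = (\<Oplus>y\<in>basis_index s ds d. (if snd y \<subseteq># snd x then D (fst x) (fst y) (snd x - snd y) else \<zero>) \<otimes> coord s ds d v y)"
      using cc by (intro finsum_cong') (auto simp: am(1) f(2) coord_vmap[OF f(1)] basis_index_def)
    finally show "mat_vec S r s D f (fst x) (snd x) = (\<Oplus>y\<in>basis_index s ds d.
       (if snd y \<subseteq># snd x then D (fst x) (fst y) (snd x - snd y) else \<zero>) \<otimes> coord s ds d v y)"
      by (simp add: am(1))
  qed
qed

definition cindex :: "'a mpoly graded_free_complex \<Rightarrow> nat \<Rightarrow> int \<Rightarrow> (nat \<times> nat multiset) set" where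
  "cindex F i d = basis_index (frank F i) (fdeg F i) d"

definition cmatrix :: "'a mpoly graded_free_complex \<Rightarrow> nat \<Rightarrow> nat \<times> nat multiset \<Rightarrow> nat \<times> nat multiset \<Rightarrow> 'a" where
  "cmatrix F i x y = (if snd y \<subseteq># snd x then fdiff F i (fst x) (fst y) (snd x - snd y) else \<zero>)"

lemma boundaries_dim:
  assumes F: "S.gres I F"
  shows "vectorspace.dim K (tensor_part K n J F i d\<lparr>carrier := tor_boundaries K n J F i d\<rparr>) =
    mat_rank (cindex F i d) (cindex F (Suc i) d) (cmatrix F i)"
proof -
  let ?r = "frank F i" and ?s = "frank F (Suc i)" and ?dr = "fdeg F i" and ?ds = "fdeg F (Suc i)"
  interpret T: linear_map K "tensor_part K n J F (Suc i) d" "tensor_part K n J F i d" "tensor_map K n J F i"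
    by (rule tensor_map_linear[OF F])
  have im: "tor_boundaries K n J F i d = T.im" by (simp add: T.im_def tor_boundaries_def)
  have "coord ?r ?dr d ` tor_boundaries K n J F i d = mat_image (cindex F i d) (cindex F (Suc i) d) (cmatrix F i)"
  proof -
    have "coord ?r ?dr d ` tor_boundaries K n J F i d =
      (\<lambda>v. coord ?r ?dr d (tensor_map K n J F i v)) ` Q.gvec ?s ?ds d"
      by (simp add: tor_boundaries_def tensor_part_gspace image_image)
    also have "\<dots> = (\<lambda>v. (\<lambda>x. \<lambda>a\<in>cindex F i d. \<Oplus>c\<in>cindex F (Suc i) d. cmatrix F i a c \<otimes> x c) (coord ?s ?ds d v)) ` Q.gvec ?s ?ds d"
      by (intro image_cong refl)
        (simp add: tensor_map_mat_vec coord_mat_vec[OF S.gres_gmat[OF F]] cindex_def cmatrix_def)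
    also have "\<dots> = (\<lambda>x. \<lambda>a\<in>cindex F i d. \<Oplus>c\<in>cindex F (Suc i) d. cmatrix F i a c \<otimes> x c) ` (coord ?s ?ds d ` Q.gvec ?s ?ds d)"
      by (simp add: image_image)
    also have "coord ?s ?ds d ` Q.gvec ?s ?ds d = cindex F (Suc i) d \<rightarrow>\<^sub>E carrier K"
      using coord_bij by (simp add: bij_betw_def cindex_def)
    finally show ?thesis unfolding mat_image_def .
  qed
  moreover have "vectorspace.dim K (Q.gspace ?r ?dr d\<lparr>carrier := T.im\<rparr>) =
     vectorspace.dim K (func_space (basis_index ?r ?dr d)\<lparr>carrier := coord ?r ?dr d ` T.im\<rparr>)"
    by (rule dim_linear_bij_image[OF coord_linear _ _ gspace_dim(1)])
      (use coord_bij T.imT_is_subspace in \<open>auto simp: bij_betw_def tensor_part_gspace\<close>)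
  ultimately show ?thesis by (simp add: mat_rank_def im tensor_part_gspace cindex_def)
qed

text \<open>Once some resolution F exists, the one chosen by \<open>SOME\<close> is a resolution
  too, and the two inequalities between homology dimensions replace it by F.\<close>

lemma betti_resolution:
  assumes F: "S.gres (irrelevant_ideal K n) F"
  shows "betti K n \<Delta> (Suc h) d + mat_rank (cindex F (Suc h) d) (cindex F (Suc (Suc h)) d) (cmatrix F (Suc h)) +
     mat_rank (cindex F h d) (cindex F (Suc h) d) (cmatrix F h) = card (cindex F (Suc h) d)"
proof -
  define G where "G = (SOME F. graded_free_resolution K n (irrelevant_ideal K n) F)"
  have G: "S.gres (irrelevant_ideal K n) G"
    using someI[of "graded_free_resolution K n (irrelevant_ideal K n)" F] F
    unfolding G_def graded_free_resolution_iff[symmetric] by blast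
  have fd: "vectorspace.fin_dim K (tensor_part K n J U (Suc h) d)" for U
    unfolding tensor_part_gspace by (rule gspace_dim)
  have "betti K n \<Delta> (Suc h) d = vectorspace.dim K (homology_part K n J F (Suc h) d)"
    using homology_dim_le[OF F G fd fd] homology_dim_le[OF G F fd fd]
    by (simp add: betti_def graded_tor_def G_def [symmetric])
  then show ?thesis
    using homology_dim[OF F fd] boundaries_dim[OF F]
    by (simp add: tensor_part_gspace gspace_dim cindex_def [symmetric])
qed

end

section \<open>The Koszul complex\<close>

definition subsets_of_card :: "nat \<Rightarrow> nat \<Rightarrow> nat set set" where
  "subsets_of_card n i = {s. s \<subseteq> {1..n} \<and> card s = i}"

text \<open>A \<open>graded_free_complex\<close> numbers its basis elements, whereas the Koszul
  complex has a basis e_s indexed by sets of variables. Any bijection will do.\<close>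

definition kenum :: "nat \<Rightarrow> nat \<Rightarrow> nat \<Rightarrow> nat set" where
  "kenum n i = (SOME h. bij_betw h {..<card (subsets_of_card n i)} (subsets_of_card n i))"

definition kidx :: "nat \<Rightarrow> nat \<Rightarrow> nat set \<Rightarrow> nat" where
  "kidx n i = the_inv_into {..<card (subsets_of_card n i)} (kenum n i)"

text \<open>The number of transpositions that sort y into s; its parity is the sign in the Koszul
  differential.\<close>

definition kpos :: "nat \<Rightarrow> nat set \<Rightarrow> nat" where
  "kpos y s = card {t \<in> s. t < y}"

lemma finite_subsets_of_card: "finite (subsets_of_card n i)"
  unfolding subsets_of_card_def by (rule finite_subset[of _ "Pow {1..n}"]) auto

lemma finite_in_subsets_of_card: "s \<in> subsets_of_card n i \<Longrightarrow> finite s"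
  unfolding subsets_of_card_def using finite_subset by auto

lemma kenum_bij: "bij_betw (kenum n i) {..<card (subsets_of_card n i)} (subsets_of_card n i)"
proof -
  have "\<exists>h. bij_betw h {..<card (subsets_of_card n i)} (subsets_of_card n i)"
    using ex_bij_betw_nat_finite[OF finite_subsets_of_card] by (simp add: atLeast0LessThan)
  then show ?thesis unfolding kenum_def by (rule someI_ex)
qed

lemma kenum_mem: "a < card (subsets_of_card n i) \<Longrightarrow> kenum n i a \<in> subsets_of_card n i"
  using kenum_bij bij_betwE by blast

lemma kidx_less: "s \<in> subsets_of_card n i \<Longrightarrow> kidx n i s < card (subsets_of_card n i)"
  unfolding kidx_def using bij_betwE[OF bij_betw_the_inv_into[OF kenum_bij]] by blast

lemma kenum_kidx: "s \<in> subsets_of_card n i \<Longrightarrow> kenum n i (kidx n i s) = s"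
  unfolding kidx_def using kenum_bij by (rule f_the_inv_into_f_bij_betw) simp

lemma kidx_kenum: "a < card (subsets_of_card n i) \<Longrightarrow> kidx n i (kenum n i a) = a"
  unfolding kidx_def using kenum_bij[of n i] by (intro the_inv_into_f_f) (auto simp: bij_betw_def)

lemma insert_subsets_of_card:
  "s \<in> subsets_of_card n i \<Longrightarrow> y \<in> {1..n} \<Longrightarrow> y \<notin> s \<Longrightarrow> insert y s \<in> subsets_of_card n (Suc i)"
  using finite_in_subsets_of_card[of s n i] by (auto simp: subsets_of_card_def)

lemma remove_subsets_of_card:
  "s \<in> subsets_of_card n (Suc i) \<Longrightarrow> y \<in> s \<Longrightarrow> s - {y} \<in> subsets_of_card n i"
  using finite_in_subsets_of_card[of s n "Suc i"] by (auto simp: subsets_of_card_def)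

lemma subset_subsets_of_card:
  assumes "s \<in> subsets_of_card n i" "t \<in> subsets_of_card n (Suc i)" "s \<subseteq> t"
  shows "\<exists>y\<in>{1..n}. y \<notin> s \<and> t = insert y s"
proof -
  have f: "finite t" using finite_in_subsets_of_card assms(2) by blast
  have "card (t - s) = 1"
    using assms f card_Diff_subset[of s t] finite_subset[of s t] by (simp add: subsets_of_card_def)
  then obtain y where y: "t - s = {y}" by (auto simp: card_1_singleton_iff)
  then have "y \<in> t" "y \<notin> s" "t = insert y s" using assms(3) by blast+
  moreover have "y \<in> {1..n}" using \<open>y \<in> t\<close> assms(2) by (auto simp: subsets_of_card_def)
  ultimately show ?thesis by blast
qed

context poly_over
begin

definition sg :: "nat \<Rightarrow> 'a" where
  "sg k = (if even k then \<one> else \<ominus> \<one>)"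

lemma sg_closed [simp]: "sg k \<in> carrier K"
  by (simp add: sg_def)

lemma sg_Suc: "x \<in> carrier K \<Longrightarrow> sg (Suc k) \<otimes> x = \<ominus> (sg k \<otimes> x)"
  by (simp add: sg_def l_minus)

lemma sg_0: "x \<in> carrier K \<Longrightarrow> sg 0 \<otimes> x = x"
  by (simp add: sg_def)

text \<open>The coefficient of e_s in the differential of e_t: a signed variable y if t arises from
  s by adding y. For indices in range, s \<subseteq> t forces t - s to be a singleton, so
  \<open>the_elem\<close> is meaningful where it is used.\<close>

definition kdiff :: "nat \<Rightarrow> nat \<Rightarrow> nat \<Rightarrow> 'a mpoly" where
  "kdiff i a b = (let s = kenum n i a; t = kenum n (Suc i) b; y = the_elem (t - s) in
     if s \<subseteq> t then mterm (sg (kpos y s)) {#y#} else \<zero>\<^bsub>S\<^esub>)"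

definition koszul :: "'a mpoly graded_free_complex" where
  "koszul = \<lparr>frank = (\<lambda>i. card (subsets_of_card n i)), fdeg = (\<lambda>i b. int i), fdiff = kdiff\<rparr>"

lemma koszul_simps [simp]: "frank koszul i = card (subsets_of_card n i)" "fdeg koszul i b = int i"
  "fdiff koszul i = kdiff i"
  by (simp_all add: koszul_def)

lemma kdiff_insert:
  assumes "a < card (subsets_of_card n i)" "y \<in> {1..n}" "y \<notin> kenum n i a"
  shows "kdiff i a (kidx n (Suc i) (insert y (kenum n i a))) = mterm (sg (kpos y (kenum n i a))) {#y#}"
proof -
  have "insert y (kenum n i a) \<in> subsets_of_card n (Suc i)"
    using assms kenum_mem insert_subsets_of_card by blast
  then have "kenum n (Suc i) (kidx n (Suc i) (insert y (kenum n i a))) = insert y (kenum n i a)"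
    by (rule kenum_kidx)
  moreover have "insert y (kenum n i a) - kenum n i a = {y}" using assms by blast
  ultimately show ?thesis by (simp add: kdiff_def Let_def subset_insertI)
qed

lemma kdiff_cases:
  assumes a: "a < card (subsets_of_card n i)" and b: "b < card (subsets_of_card n (Suc i))"
  obtains (ins) y where "y \<in> {1..n}" "y \<notin> kenum n i a" "b = kidx n (Suc i) (insert y (kenum n i a))"
    "kdiff i a b = mterm (sg (kpos y (kenum n i a))) {#y#}"
  | (zero) "\<not> kenum n i a \<subseteq> kenum n (Suc i) b" "kdiff i a b = \<zero>\<^bsub>S\<^esub>"
proof (cases "kenum n i a \<subseteq> kenum n (Suc i) b")
  case True
  obtain y where y: "y \<in> {1..n}" "y \<notin> kenum n i a" "kenum n (Suc i) b = insert y (kenum n i a)"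
    using subset_subsets_of_card[OF kenum_mem[OF a] kenum_mem[OF b] True] by blast
  then have "b = kidx n (Suc i) (insert y (kenum n i a))" using kidx_kenum[OF b] by simp
  with y kdiff_insert[OF a y(1,2)] show ?thesis using ins by metis
next
  case False
  then show ?thesis using zero by (simp add: kdiff_def Let_def)
qed

lemma kdiff_homogeneous:
  assumes "a < card (subsets_of_card n i)" "b < card (subsets_of_card n (Suc i))"
  shows "kdiff i a b \<in> homogeneous K n 1"
  using assms
proof (cases rule: kdiff_cases)
  case (ins y)
  then show ?thesis using mterm_homogeneous[of "sg (kpos y (kenum n i a))" "{#y#}"] by simp
qed (simp add: S.H_zero)

lemma koszul_gmat:
  "S.gmat (frank koszul i) (frank koszul (Suc i)) (fdeg koszul i) (fdeg koszul (Suc i)) (fdiff koszul i)"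
  using kdiff_homogeneous by (simp add: S.gmat_def)

lemma koszul_linop: "linop S (frank koszul (Suc i)) (frank koszul i) (free_map S koszul i)"
  unfolding free_map_def by (rule S.gmat_linop[OF koszul_gmat])

text \<open>To the coefficient of m at e_s only those sets contribute that add to s a variable
  dividing m. This removes the enumeration and the matrix product from all later
  computations.\<close>

lemma koszul_map:
  assumes v: "v \<in> vset S (card (subsets_of_card n (Suc i)))" and s: "s \<in> subsets_of_card n i" and m: "vars_ok m"
  shows "free_map S koszul i v (kidx n i s) m =
    (\<Oplus>y\<in>set_mset m - s. sg (kpos y s) \<otimes> v (kidx n (Suc i) (insert y s)) (m - {#y#}))"
proof -
  let ?a = "kidx n i s" and ?N = "card (subsets_of_card n (Suc i))"
  have a: "?a < card (subsets_of_card n i)" and e: "kenum n i ?a = s" using s kidx_less kenum_kidx by blast+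
  have vc: "v b \<in> carrier S" if "b < ?N" for b using vset_nth[OF v that] .
  have dc: "kdiff i ?a b \<in> carrier S" if "b < ?N" for b using homogeneousD(1)[OF kdiff_homogeneous[OF a that]] .
  let ?h = "\<lambda>y. kidx n (Suc i) (insert y s)"
  have ys: "insert y s \<in> subsets_of_card n (Suc i)" if "y \<in> set_mset m - s" for y
    using that m s insert_subsets_of_card by (auto simp: vars_ok_def)
  have "inj_on ?h (set_mset m - s)"
  proof (rule inj_onI)
    fix y z assume y: "y \<in> set_mset m - s" and z: "z \<in> set_mset m - s" and eq: "?h y = ?h z"
    have "insert y s = kenum n (Suc i) (?h y)" by (rule kenum_kidx[OF ys[OF y], symmetric])
    also have "\<dots> = kenum n (Suc i) (?h z)" by (simp only: eq)
    also have "\<dots> = insert z s" by (rule kenum_kidx[OF ys[OF z]])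
    finally have "y \<in> insert z s" by (metis insertI1)
    with y show "y = z" by simp
  qed
  have tm: "(kdiff i ?a (?h y) \<otimes>\<^bsub>S\<^esub> v (?h y)) m = sg (kpos y s) \<otimes> v (?h y) (m - {#y#})"
    if y: "y \<in> set_mset m - s" for y
  proof -
    have "y \<in> {1..n}" using y m by (auto simp: vars_ok_def)
    then have "kdiff i ?a (?h y) = mterm (sg (kpos y s)) {#y#}"
      using kdiff_insert[OF a, of y] y e by simp
    moreover have "\<And>m. v (?h y) m \<in> carrier K" using S_coeff[OF vc[OF kidx_less[OF ys[OF y]]]] .
    ultimately show ?thesis using mterm_mult[of "sg (kpos y s)" "v (?h y)" "{#y#}"] y by simp
  qed
  have closed: "(kdiff i ?a b \<otimes>\<^bsub>S\<^esub> v b) m \<in> carrier K" if "b < ?N" for b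
    by (rule S_coeff[OF S.m_closed[OF dc[OF that] vc[OF that]]])
  have "free_map S koszul i v ?a m = (\<Oplus>\<^bsub>S\<^esub>b\<in>{..<?N}. kdiff i ?a b \<otimes>\<^bsub>S\<^esub> v b) m"
    using a by (simp add: free_map_def mat_vec_def)
  also have "\<dots> = (\<Oplus>b\<in>{..<?N}. (kdiff i ?a b \<otimes>\<^bsub>S\<^esub> v b) m)"
    by (rule S_finsum_coeff) (use dc vc in \<open>auto intro: S.m_closed\<close>)
  also have "\<dots> = (\<Oplus>b\<in>?h ` (set_mset m - s). (kdiff i ?a b \<otimes>\<^bsub>S\<^esub> v b) m)"
  proof (rule add.finprod_mono_neutral_cong_right)
    show "?h ` (set_mset m - s) \<subseteq> {..<?N}" using kidx_less[OF ys] by blast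
    show "(kdiff i ?a b \<otimes>\<^bsub>S\<^esub> v b) m = \<zero>" if b: "b \<in> {..<?N} - ?h ` (set_mset m - s)" for b
    proof -
      have bN: "b < ?N" using b by simp
      note cv = S_coeff[OF vc[OF bN]]
      show ?thesis
        using a bN
      proof (cases rule: kdiff_cases)
        case (ins y)
        have "y \<notin># m"
        proof
          assume "y \<in># m"
          then have "y \<in> set_mset m - s" using ins(2) unfolding e by simp
          then have "?h y \<in> ?h ` (set_mset m - s)" by (rule imageI)
          then show False using b ins(3) unfolding e by simp
        qed
        then show ?thesis using ins(4) mterm_mult[of "sg (kpos y (kenum n i ?a))" "v b" "{#y#}", OF sg_closed cv] by simp
      next
        case zero
        then show ?thesis using S.l_null[OF vc[OF bN]] by (simp add: S_zero)
      qed
    qed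
  qed (use closed in auto)
  also have "\<dots> = (\<Oplus>y\<in>set_mset m - s. (kdiff i ?a (?h y) \<otimes>\<^bsub>S\<^esub> v (?h y)) m)"
    using \<open>inj_on ?h (set_mset m - s)\<close> closed kidx_less[OF ys] by (intro finsum_reindex) blast+
  also have "\<dots> = (\<Oplus>y\<in>set_mset m - s. sg (kpos y s) \<otimes> v (?h y) (m - {#y#}))"
    using tm S_coeff[OF vc[OF kidx_less[OF ys]]] by (intro finsum_cong') (auto intro!: m_closed)
  finally show ?thesis .
qed

lemma koszul_vset_eqI:
  assumes "v \<in> vset S (card (subsets_of_card n i))" "w \<in> vset S (card (subsets_of_card n i))"
    and eq: "\<And>s m. s \<in> subsets_of_card n i \<Longrightarrow> vars_ok m \<Longrightarrow> v (kidx n i s) m = w (kidx n i s) m"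
  shows "v = w"
proof (rule vset_eqI[OF assms(1,2)])
  fix a assume a: "a < card (subsets_of_card n i)"
  show "v a = w a"
  proof
    fix m
    show "v a m = w a m"
    proof (cases "vars_ok m")
      case True
      then show ?thesis using eq[OF kenum_mem[OF a], of m] kidx_kenum[OF a] by simp
    next
      case False
      then show ?thesis using vset_nth[OF assms(1) a] vset_nth[OF assms(2) a] unfolding carrier_S by force
    qed
  qed
qed

text \<open>The coefficient is a sum over ordered pairs of distinct variables of m outside s. It is
  split into y < z and z < y, and swapping the pair matches the halves with opposite signs.\<close>

lemma koszul_dd:
  assumes v: "v \<in> vset S (card (subsets_of_card n (Suc (Suc i))))"
  shows "free_map S koszul i (free_map S koszul (Suc i) v) = zero_vec S (card (subsets_of_card n i))"
proof (rule koszul_vset_eqI)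
  have dv: "free_map S koszul (Suc i) v \<in> vset S (card (subsets_of_card n (Suc i)))"
    using linop_closed[OF koszul_linop[of "Suc i"], of v] v by simp
  show "free_map S koszul i (free_map S koszul (Suc i) v) \<in> vset S (card (subsets_of_card n i))"
    using linop_closed[OF koszul_linop[of i]] dv by simp
  show "zero_vec S (card (subsets_of_card n i)) \<in> vset S (card (subsets_of_card n i))" by (rule S.zero_vec_closed)
  fix s m assume s: "s \<in> subsets_of_card n i" and m: "vars_ok m"
  let ?A = "set_mset m - s"
  define g where "g y z = sg (kpos y s) \<otimes> (sg (kpos z (insert y s)) \<otimes>
     v (kidx n (Suc (Suc i)) (insert z (insert y s))) (m - {#y#} - {#z#}))" for y z
  have ins: "insert y s \<in> subsets_of_card n (Suc i)" if "y \<in> ?A" for y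
    using that m s insert_subsets_of_card by (auto simp: vars_ok_def)
  have ins2: "insert z (insert y s) \<in> subsets_of_card n (Suc (Suc i))" if "y \<in> ?A" "z \<in> ?A - {y}" for y z
    using that m insert_subsets_of_card[OF ins[OF that(1)], of z] by (auto simp: vars_ok_def)
  have vc: "v (kidx n (Suc (Suc i)) (insert z (insert y s))) k \<in> carrier K" if "y \<in> ?A" "z \<in> ?A - {y}" for y z k
    by (rule S_coeff[OF vset_nth[OF v kidx_less[OF ins2[OF that]]]])
  have gc: "g y z \<in> carrier K" if "y \<in> ?A" "z \<in> ?A - {y}" for y z
    unfolding g_def using vc[OF that] by (intro m_closed sg_closed)
  \<comment> \<open>Adding the smaller y first raises the position of z by one, while adding z first
    leaves the position of y unchanged.\<close>
  have anti: "g z y = \<ominus> g y z" if yz: "y \<in> ?A" "z \<in> ?A" "y < z" for y z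
  proof -
    have fin: "finite s" using s by (rule finite_in_subsets_of_card)
    have "{t \<in> insert y s. t < z} = insert y {t \<in> s. t < z}" using yz by auto
    then have 1: "kpos z (insert y s) = Suc (kpos z s)" using yz fin by (simp add: kpos_def)
    have "{t \<in> insert z s. t < y} = {t \<in> s. t < y}" using yz by auto
    then have 2: "kpos y (insert z s) = kpos y s" by (simp add: kpos_def)
    let ?V = "v (kidx n (Suc (Suc i)) (insert z (insert y s))) (m - {#y#} - {#z#})"
    have V: "?V \<in> carrier K" using vc yz by blast
    have "g z y = sg (kpos z s) \<otimes> (sg (kpos y s) \<otimes> ?V)"
      by (simp add: g_def 2 insert_commute add_mset_commute)
    also have "\<dots> = sg (kpos y s) \<otimes> (sg (kpos z s) \<otimes> ?V)" using V by (simp add: m_lcomm)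
    finally show ?thesis using V by (simp add: g_def 1 sg_Suc r_minus)
  qed
  let ?P = "Sigma ?A (\<lambda>y. ?A - {y})"
  let ?L = "{x \<in> ?P. fst x < snd x}" and ?R = "{x \<in> ?P. snd x < fst x}"
  have fin: "finite ?P" by (intro finite_SigmaI) auto
  have "free_map S koszul i (free_map S koszul (Suc i) v) (kidx n i s) m =
     (\<Oplus>y\<in>?A. sg (kpos y s) \<otimes> free_map S koszul (Suc i) v (kidx n (Suc i) (insert y s)) (m - {#y#}))"
    by (rule koszul_map[OF dv s m])
  also have "\<dots> = (\<Oplus>y\<in>?A. \<Oplus>z\<in>?A - {y}. g y z)"
  proof (rule finsum_cong')
    show "(\<lambda>y. \<Oplus>z\<in>?A - {y}. g y z) \<in> ?A \<rightarrow> carrier K" using gc by (auto intro!: finsum_closed)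
    fix y assume y: "y \<in> ?A"
    have eqA: "set_mset (m - {#y#}) - insert y s = ?A - {y}"
      using y by (auto dest: in_diffD simp: in_diff_count)
    have "free_map S koszul (Suc i) v (kidx n (Suc i) (insert y s)) (m - {#y#}) =
       (\<Oplus>z\<in>?A - {y}. sg (kpos z (insert y s)) \<otimes> v (kidx n (Suc (Suc i)) (insert z (insert y s))) (m - {#y#} - {#z#}))"
      unfolding koszul_map[OF v ins[OF y] vars_ok_diff[OF m]] eqA ..
    then show "sg (kpos y s) \<otimes> free_map S koszul (Suc i) v (kidx n (Suc i) (insert y s)) (m - {#y#}) = (\<Oplus>z\<in>?A - {y}. g y z)"
      using vc[OF y] by (simp add: g_def finsum_rdistr Pi_iff)
  qed simp
  also have "\<dots> = (\<Oplus>x\<in>?P. g (fst x) (snd x))"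
    using gc by (intro finsum_Sigma) auto
  also have "?P = ?L \<union> ?R" by auto
  also have "(\<Oplus>x\<in>?L \<union> ?R. g (fst x) (snd x)) = (\<Oplus>x\<in>?L. g (fst x) (snd x)) \<oplus> (\<Oplus>x\<in>?R. g (fst x) (snd x))"
    using gc fin by (intro finsum_Un_disjoint) (auto intro: finite_subset[OF _ fin])
  also have "(\<Oplus>x\<in>?R. g (fst x) (snd x)) = (\<Oplus>x\<in>?L. g (snd x) (fst x))"
  proof -
    have R: "?R = prod.swap ` ?L" by (auto simp: image_iff)
    have "(\<Oplus>x\<in>prod.swap ` ?L. g (fst x) (snd x)) = (\<Oplus>x\<in>?L. g (fst (prod.swap x)) (snd (prod.swap x)))"
      using gc by (intro finsum_reindex) (auto simp: inj_on_def)
    then show ?thesis unfolding R by simp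
  qed
  also have "(\<Oplus>x\<in>?L. g (fst x) (snd x)) \<oplus> (\<Oplus>x\<in>?L. g (snd x) (fst x)) =
      (\<Oplus>x\<in>?L. g (fst x) (snd x) \<oplus> g (snd x) (fst x))"
    using gc by (intro finsum_addf [symmetric]) auto
  also have "\<dots> = \<zero>"
  proof (rule add.finprod_one_eqI)
    fix x assume x: "x \<in> ?L"
    then have "g (snd x) (fst x) = \<ominus> g (fst x) (snd x)" by (intro anti) auto
    moreover have "g (fst x) (snd x) \<in> carrier K" using x by (intro gc) auto
    ultimately show "g (fst x) (snd x) \<oplus> g (snd x) (fst x) = \<zero>" by (simp add: r_neg)
  qed
  finally show "free_map S koszul i (free_map S koszul (Suc i) v) (kidx n i s) m =
      zero_vec S (card (subsets_of_card n i)) (kidx n i s) m"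
    using kidx_less[OF s] by (simp add: zero_vec_def S_zero)
qed

text \<open>A contracting homotopy: it moves the least variable of \<open>e\<^sub>s \<otimes> m\<close> from \<open>m\<close> to \<open>s\<close>, and is zero
  if that variable is already in \<open>s\<close>.\<close>

definition kcontract :: "nat \<Rightarrow> (nat \<Rightarrow> 'a mpoly) \<Rightarrow> nat \<Rightarrow> 'a mpoly" where
  "kcontract i v = (\<lambda>c\<in>{..<card (subsets_of_card n (Suc i))}. \<lambda>m.
     let t = kenum n (Suc i) c; x = Min t in
     if \<forall>z\<in>#m. x \<le> z then v (kidx n i (t - {x})) (add_mset x m) else \<zero>)"

lemma kcontract_apply:
  assumes "t \<in> subsets_of_card n (Suc i)"
  shows "kcontract i v (kidx n (Suc i) t) m =
    (if \<forall>z\<in>#m. Min t \<le> z then v (kidx n i (t - {Min t})) (add_mset (Min t) m) else \<zero>)"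
  using kidx_less[OF assms] kenum_kidx[OF assms] by (simp add: kcontract_def Let_def)

lemma Min_subsets_of_card: "t \<in> subsets_of_card n (Suc i) \<Longrightarrow> Min t \<in> t"
  using finite_in_subsets_of_card[of t n "Suc i"] by (intro Min_in) (auto simp: subsets_of_card_def)

lemma kcontract_closed:
  assumes v: "v \<in> vset S (card (subsets_of_card n i))"
  shows "kcontract i v \<in> vset S (card (subsets_of_card n (Suc i)))"
proof -
  have "kcontract i v c \<in> carrier S" if c: "c < card (subsets_of_card n (Suc i))" for c
  proof -
    let ?t = "kenum n (Suc i) c"
    let ?x = "Min ?t"
    let ?f = "v (kidx n i (?t - {?x}))"
    note t = kenum_mem[OF c]
    have f: "?f \<in> carrier S"
      by (rule vset_nth[OF v kidx_less[OF remove_subsets_of_card[OF t Min_subsets_of_card[OF t]]]])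
    have ap: "kcontract i v c m = (if \<forall>z\<in>#m. ?x \<le> z then ?f (add_mset ?x m) else \<zero>)" for m
      using kcontract_apply[OF t, of v m] kidx_kenum[OF c] by simp
    have "{m. kcontract i v c m \<noteq> \<zero>} \<subseteq> (\<lambda>m. m - {#?x#}) ` {m. ?f m \<noteq> \<zero>}"
    proof
      fix m assume "m \<in> {m. kcontract i v c m \<noteq> \<zero>}"
      then have "?f (add_mset ?x m) \<noteq> \<zero>" by (auto simp: ap split: if_splits)
      then show "m \<in> (\<lambda>m. m - {#?x#}) ` {m. ?f m \<noteq> \<zero>}" by (intro image_eqI[of _ _ "add_mset ?x m"]) auto
    qed
    moreover have "finite {m. ?f m \<noteq> \<zero>}" using f unfolding carrier_S by blast
    ultimately have "finite {m. kcontract i v c m \<noteq> \<zero>}" using finite_subset finite_imageI by metis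
    moreover have "kcontract i v c m \<in> carrier K" for m using S_coeff[OF f, of "add_mset ?x m"] by (simp add: ap)
    moreover have "vars_ok m" if nz: "kcontract i v c m \<noteq> \<zero>" for m
    proof -
      have "?f (add_mset ?x m) \<noteq> \<zero>" using nz by (auto simp: ap split: if_splits)
      then have "vars_ok (add_mset ?x m)" using f unfolding carrier_S by blast
      then show ?thesis by simp
    qed
    ultimately show ?thesis unfolding carrier_S by blast
  qed
  then show ?thesis by (simp add: vset_def kcontract_def)
qed

text \<open>The case where the least variable x of e_s m divides m and is not in s. In the
  differential of the contraction only the summand y = x survives: for any other y the variable x
  still divides the monomial and lies below the minimum of s with y added, so the contraction is
  zero there.\<close>

lemma kcontract_outside:
  assumes v: "v \<in> vset S (card (subsets_of_card n i))" and s: "s \<in> subsets_of_card n i" and m: "vars_ok m"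
    and x: "x \<in># m" "x \<notin> s" "\<And>z. z \<in> s \<union> set_mset m \<Longrightarrow> x \<le> z"
  shows "free_map S koszul i (kcontract i v) (kidx n i s) m = v (kidx n i s) m"
proof -
  let ?A = "set_mset m - s"
  note u = kcontract_closed[OF v]
  have fin: "finite s" using s by (rule finite_in_subsets_of_card)
  have ins: "insert y s \<in> subsets_of_card n (Suc i)" if "y \<in> ?A" for y
    using that m s insert_subsets_of_card by (auto simp: vars_ok_def)
  have xA: "x \<in> ?A" using x by simp
  have Minx: "Min (insert x s) = x" using fin x by (intro Min_eqI) auto
  have tx: "sg (kpos x s) \<otimes> kcontract i v (kidx n (Suc i) (insert x s)) (m - {#x#}) = v (kidx n i s) m"
  proof -
    have "{t \<in> s. t < x} = {}" using x(3) by force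
    then have "kpos x s = 0" unfolding kpos_def by simp
    moreover have "insert x s - {x} = s" using x by blast
    moreover have "\<forall>z\<in>#m - {#x#}. x \<le> z" using x(3) by (auto dest: in_diffD)
    moreover have "add_mset x (m - {#x#}) = m" using x by simp
    ultimately show ?thesis
      using sg_0[OF S_coeff[OF vset_nth[OF v kidx_less[OF s]], of m]] by (simp add: kcontract_apply[OF ins[OF xA]] Minx)
  qed
  have "free_map S koszul i (kcontract i v) (kidx n i s) m =
     (\<Oplus>y\<in>?A. sg (kpos y s) \<otimes> kcontract i v (kidx n (Suc i) (insert y s)) (m - {#y#}))"
    by (rule koszul_map[OF u s m])
  also have "\<dots> = sg (kpos x s) \<otimes> kcontract i v (kidx n (Suc i) (insert x s)) (m - {#x#})"
  proof (rule finsum_single[OF xA])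
    show "sg (kpos x s) \<otimes> kcontract i v (kidx n (Suc i) (insert x s)) (m - {#x#}) \<in> carrier K"
      unfolding tx by (rule S_coeff[OF vset_nth[OF v kidx_less[OF s]]])
    fix y assume y: "y \<in> ?A" "y \<noteq> x"
    have "Min (insert y s) \<in> insert y s" using fin by (intro Min_in) auto
    then have "x \<le> Min (insert y s)" "Min (insert y s) \<noteq> x" using x y by auto
    moreover have "x \<in># m - {#y#}" using x y by (simp add: in_diff_count)
    ultimately have "\<not> (\<forall>z\<in>#m - {#y#}. Min (insert y s) \<le> z)" by force
    then have "kcontract i v (kidx n (Suc i) (insert y s)) (m - {#y#}) = \<zero>"
      unfolding kcontract_apply[OF ins[OF y(1)]] by (rule if_not_P)
    then show "sg (kpos y s) \<otimes> kcontract i v (kidx n (Suc i) (insert y s)) (m - {#y#}) = \<zero>" by simp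
  qed simp
  finally show ?thesis unfolding tx .
qed

text \<open>The case where the least variable x already lies in s. Now every summand contracts back
  to x, and the cycle condition is what evaluates their sum. The sign is right because x precedes
  every y, so removing x from s lowers the position of y by one.\<close>

lemma kcontract_inside:
  assumes v: "v \<in> vset S (card (subsets_of_card n (Suc i)))" and s: "s \<in> subsets_of_card n (Suc i)" and m: "vars_ok m"
    and dv: "free_map S koszul i v = zero_vec S (card (subsets_of_card n i))"
    and x: "x \<in> s" "\<And>z. z \<in> s \<union> set_mset m \<Longrightarrow> x \<le> z"
  shows "free_map S koszul (Suc i) (kcontract (Suc i) v) (kidx n (Suc i) s) m = v (kidx n (Suc i) s) m"
proof -
  let ?A = "set_mset m - s"
  let ?s = "s - {x}"
  note u = kcontract_closed[OF v]
  have fin: "finite s" using s by (rule finite_in_subsets_of_card)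
  have s': "?s \<in> subsets_of_card n i" by (rule remove_subsets_of_card[OF s x(1)])
  have ins: "insert y s \<in> subsets_of_card n (Suc (Suc i))" if "y \<in> ?A" for y
    using that m s insert_subsets_of_card by (auto simp: vars_ok_def)
  have xn: "x \<in> {1..n}" using x s by (auto simp: subsets_of_card_def)
  have ins': "insert y ?s \<in> subsets_of_card n (Suc i)" if "y \<in> ?A" for y
    using that m s' insert_subsets_of_card by (auto simp: vars_ok_def)
  define g where "g y = v (kidx n (Suc i) (insert y ?s)) (add_mset x m - {#y#})" for y
  have gc: "g y \<in> carrier K" if "y \<in> insert x ?A" for y
    unfolding g_def using that ins' s x by (cases "y = x") (auto intro!: S_coeff vset_nth[OF v] kidx_less simp: insert_absorb)
  have t: "sg (kpos y s) \<otimes> kcontract (Suc i) v (kidx n (Suc (Suc i)) (insert y s)) (m - {#y#}) =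
       \<ominus> (sg (kpos y ?s) \<otimes> g y)" if y: "y \<in> ?A" for y
  proof -
    have xy: "x < y" using x y by (metis DiffD1 DiffD2 UnI2 le_neq_implies_less)
    have "Min (insert y s) = x" using fin x y by (intro Min_eqI) auto
    moreover have "insert y s - {x} = insert y ?s" using xy by blast
    moreover have "\<forall>z\<in>#m - {#y#}. x \<le> z" using x(2) by (auto dest: in_diffD)
    moreover have "add_mset x (m - {#y#}) = add_mset x m - {#y#}" using y by simp
    ultimately have "kcontract (Suc i) v (kidx n (Suc (Suc i)) (insert y s)) (m - {#y#}) = g y"
      by (simp add: kcontract_apply[OF ins[OF y]] g_def)
    moreover have "kpos y s = Suc (kpos y ?s)"
    proof -
      have "{t \<in> s. t < y} = insert x {t \<in> ?s. t < y}" using x xy by auto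
      then show ?thesis using fin by (simp add: kpos_def)
    qed
    ultimately show ?thesis using sg_Suc[OF gc[of y]] y by simp
  qed
  \<comment> \<open>The cycle condition is read at the basis element without x and the monomial with
    an additional x. Its summand y = x is the coefficient sought, and the others are the negatives
    of the summands for the contraction.\<close>
  have "\<zero> = free_map S koszul i v (kidx n i ?s) (add_mset x m)"
    using kidx_less[OF s'] by (simp add: dv zero_vec_def S_zero)
  also have "\<dots> = (\<Oplus>y\<in>set_mset (add_mset x m) - ?s. sg (kpos y ?s) \<otimes> g y)"
    unfolding g_def using xn m by (intro koszul_map[OF v s']) simp
  also have "set_mset (add_mset x m) - ?s = insert x ?A" using x by auto
  also have "(\<Oplus>y\<in>insert x ?A. sg (kpos y ?s) \<otimes> g y) = sg (kpos x ?s) \<otimes> g x \<oplus> (\<Oplus>y\<in>?A. sg (kpos y ?s) \<otimes> g y)"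
    using gc x by (intro finsum_insert) auto
  also have "sg (kpos x ?s) \<otimes> g x = v (kidx n (Suc i) s) m"
  proof -
    have "{t \<in> ?s. t < x} = {}" using x(2) by force
    then have "kpos x ?s = 0" unfolding kpos_def by simp
    then show ?thesis using sg_0[OF gc[of x]] x by (simp add: g_def insert_absorb)
  qed
  finally have z: "v (kidx n (Suc i) s) m \<oplus> (\<Oplus>y\<in>?A. sg (kpos y ?s) \<otimes> g y) = \<zero>" by simp
  have sc: "(\<Oplus>y\<in>?A. sg (kpos y ?s) \<otimes> g y) \<in> carrier K" using gc by (intro finsum_closed) auto
  have vc: "v (kidx n (Suc i) s) m \<in> carrier K" by (rule S_coeff[OF vset_nth[OF v kidx_less[OF s]]])
  have "(\<Oplus>y\<in>?A. sg (kpos y s) \<otimes> kcontract (Suc i) v (kidx n (Suc (Suc i)) (insert y s)) (m - {#y#})) =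
     (\<Oplus>y\<in>?A. \<ominus> (sg (kpos y ?s) \<otimes> g y))"
    using t gc by (intro finsum_cong') auto
  also have "\<dots> = \<ominus> (\<Oplus>y\<in>?A. sg (kpos y ?s) \<otimes> g y)"
  proof -
    have "(\<Oplus>y\<in>?A. \<ominus> (sg (kpos y ?s) \<otimes> g y)) \<oplus> (\<Oplus>y\<in>?A. sg (kpos y ?s) \<otimes> g y) = (\<Oplus>y\<in>?A. \<ominus> (sg (kpos y ?s) \<otimes> g y) \<oplus> sg (kpos y ?s) \<otimes> g y)"
      using gc by (intro finsum_addf [symmetric]) auto
    also have "\<dots> = \<zero>" using gc by (intro add.finprod_one_eqI) (auto simp: l_neg)
    finally show ?thesis using gc sc by (intro minus_equality [symmetric]) (auto intro!: finsum_closed)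
  qed
  also have "\<dots> = v (kidx n (Suc i) s) m" using minus_equality[OF z sc vc] .
  finally show ?thesis unfolding koszul_map[OF u s m] .
qed

lemma koszul_exact:
  assumes v: "v \<in> vset S (card (subsets_of_card n (Suc i)))"
    and dv: "free_map S koszul i v = zero_vec S (card (subsets_of_card n i))"
  shows "free_map S koszul (Suc i) (kcontract (Suc i) v) = v"
proof (rule koszul_vset_eqI[OF _ v])
  show "free_map S koszul (Suc i) (kcontract (Suc i) v) \<in> vset S (card (subsets_of_card n (Suc i)))"
    using linop_closed[OF koszul_linop[of "Suc i"]] kcontract_closed[OF v] by simp
  fix s m assume s: "s \<in> subsets_of_card n (Suc i)" and m: "vars_ok m"
  let ?x = "Min (s \<union> set_mset m)"
  have fin: "finite (s \<union> set_mset m)" using finite_in_subsets_of_card[OF s] by simp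
  have "s \<noteq> {}" using s by (auto simp: subsets_of_card_def)
  then have "?x \<in> s \<union> set_mset m" using fin by (intro Min_in) auto
  moreover have le: "\<And>z. z \<in> s \<union> set_mset m \<Longrightarrow> ?x \<le> z" using fin by (rule Min_le)
  ultimately show "free_map S koszul (Suc i) (kcontract (Suc i) v) (kidx n (Suc i) s) m = v (kidx n (Suc i) s) m"
    using kcontract_inside[OF v s m dv _ le] kcontract_outside[OF v s m _ _ le] by blast
qed

lemma subsets_of_card_0: "subsets_of_card n 0 = {{}}"
  unfolding subsets_of_card_def using finite_subset by fastforce

lemma koszul_gres: "S.gres (irrelevant_ideal K n) koszul"
  unfolding S.gres_def
proof (intro conjI allI)
  show "frank koszul 0 = 1" "fdeg koszul 0 0 = 0" by (simp_all add: subsets_of_card_0)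
  show "S.gmat (frank koszul i) (frank koszul (Suc i)) (fdeg koszul i) (fdeg koszul (Suc i)) (fdiff koszul i)" for i
    by (rule koszul_gmat)
  have c0: "card (subsets_of_card n 0) = 1" by (simp add: subsets_of_card_0)
  have k0: "kidx n 0 {} = 0" using kidx_less[of "{}" n 0] by (simp add: subsets_of_card_0)
  have e0: "{} \<in> subsets_of_card n 0" by (simp add: subsets_of_card_0)
  show "(\<lambda>v. v 0) ` free_map S koszul 0 ` free_part S koszul 1 = irrelevant_ideal K n"
  proof
    show "(\<lambda>v. v 0) ` free_map S koszul 0 ` free_part S koszul 1 \<subseteq> irrelevant_ideal K n"
    proof clarify
      fix v assume "v \<in> free_part S koszul 1"
      then have v: "v \<in> vset S (card (subsets_of_card n (Suc 0)))" by (simp add: free_part_vset)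
      have "free_map S koszul 0 v \<in> vset S 1" using linop_closed[OF koszul_linop[of 0]] v by (simp add: c0)
      then have "free_map S koszul 0 v 0 \<in> carrier S" by (rule vset_nth) simp
      moreover have "free_map S koszul 0 v 0 {#} = \<zero>"
        using koszul_map[OF v e0, of "{#}"] by (simp add: k0)
      ultimately show "free_map S koszul 0 v 0 \<in> irrelevant_ideal K n" unfolding irrelevant_ideal_eq by blast
    qed
    show "irrelevant_ideal K n \<subseteq> (\<lambda>v. v 0) ` free_map S koszul 0 ` free_part S koszul 1"
    proof
      fix f assume "f \<in> irrelevant_ideal K n"
      then have f: "f \<in> carrier S" "f {#} = \<zero>" unfolding irrelevant_ideal_eq by blast+
      define v where "v = (\<lambda>a\<in>{..<1::nat}. f)"
      have v: "v \<in> vset S (card (subsets_of_card n 0))" using f by (simp add: v_def vset_def c0)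
      note u = kcontract_closed[OF v]
      \<comment> \<open>Exactness at degree 0: f has no constant term, so every other monomial has a
        least variable, which lies outside the empty set s.\<close>
      have "free_map S koszul 0 (kcontract 0 v) = v"
      proof (rule koszul_vset_eqI[OF _ v])
        show "free_map S koszul 0 (kcontract 0 v) \<in> vset S (card (subsets_of_card n 0))"
          using linop_closed[OF koszul_linop[of 0]] u by simp
        fix s m assume s: "s \<in> subsets_of_card n 0" and m: "vars_ok m"
        then have s0: "s = {}" by (simp add: subsets_of_card_0)
        show "free_map S koszul 0 (kcontract 0 v) (kidx n 0 s) m = v (kidx n 0 s) m"
        proof (cases "m = {#}")
          case True
          then show ?thesis using koszul_map[OF u e0, of "{#}"] f by (simp add: s0 k0 v_def)
        next
          case False
          then have "Min (set_mset m) \<in># m" by (intro Min_in) auto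
          then show ?thesis using s0 by (intro kcontract_outside[OF v s m]) auto
        qed
      qed
      then have "f = free_map S koszul 0 (kcontract 0 v) 0" by (simp add: v_def)
      then show "f \<in> (\<lambda>v. v 0) ` free_map S koszul 0 ` free_part S koszul 1"
        using u by (auto simp: free_part_vset)
    qed
  qed
  fix i
  show "{v \<in> free_part S koszul (Suc i). free_map S koszul i v = zero_vec S (frank koszul i)} =
      free_map S koszul (Suc i) ` free_part S koszul (Suc (Suc i))"
  proof
    show "{v \<in> free_part S koszul (Suc i). free_map S koszul i v = zero_vec S (frank koszul i)} \<subseteq>
        free_map S koszul (Suc i) ` free_part S koszul (Suc (Suc i))"
    proof clarify
      fix v assume "v \<in> free_part S koszul (Suc i)" and d: "free_map S koszul i v = zero_vec S (frank koszul i)"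
      then have v: "v \<in> vset S (card (subsets_of_card n (Suc i)))" by (simp add: free_part_vset)
      have "v = free_map S koszul (Suc i) (kcontract (Suc i) v)" using koszul_exact[OF v] d by simp
      moreover have "kcontract (Suc i) v \<in> free_part S koszul (Suc (Suc i))"
        using kcontract_closed[OF v] by (simp add: free_part_vset)
      ultimately show "v \<in> free_map S koszul (Suc i) ` free_part S koszul (Suc (Suc i))" by (rule image_eqI)
    qed
    show "free_map S koszul (Suc i) ` free_part S koszul (Suc (Suc i)) \<subseteq>
        {v \<in> free_part S koszul (Suc i). free_map S koszul i v = zero_vec S (frank koszul i)}"
    proof clarify
      fix v assume "v \<in> free_part S koszul (Suc (Suc i))"
      then have v: "v \<in> vset S (card (subsets_of_card n (Suc (Suc i))))" by (simp add: free_part_vset)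
      then show "free_map S koszul (Suc i) v \<in> free_part S koszul (Suc i) \<and>
          free_map S koszul i (free_map S koszul (Suc i) v) = zero_vec S (frank koszul i)"
        using linop_closed[OF koszul_linop[of "Suc i"]] koszul_dd[OF v] by (simp add: free_part_vset)
    qed
  qed
qed

end

section \<open>Ranks over the rationals and over prime fields\<close>

context vectorspace
begin

lemma finsum_subspace:
  assumes W: "subspace K W V" and "finite I" "\<And>i. i \<in> I \<Longrightarrow> f i \<in> W"
  shows "(\<Oplus>\<^bsub>vs W\<^esub>i\<in>I. f i) = (\<Oplus>\<^bsub>V\<^esub>i\<in>I. f i)"
proof -
  interpret W: vectorspace K "vs W" by (rule subspace_is_vs[OF W])
  have sub: "W \<subseteq> carrier V" using W by (simp add: subspace_def submodule_def)
  show ?thesis using assms(2,3)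
  proof (induction I rule: finite_induct)
    case (insert i I)
    have 1: "f \<in> I \<rightarrow> carrier (vs W)" "f i \<in> carrier (vs W)" using insert.prems by auto
    have 2: "f \<in> I \<rightarrow> carrier V" "f i \<in> carrier V" using insert.prems sub by auto
    show ?case
      using W.M.finsum_insert[OF insert.hyps(1,2) 1] M.finsum_insert[OF insert.hyps(1,2) 2] insert by simp
  qed simp
qed

end

section \<open>Upper and lower bounds for the rank over a field\<close>

context field
begin

lemma mat_map_hom:
  assumes C: "finite C" and M: "\<And>a c. a \<in> A \<Longrightarrow> c \<in> C \<Longrightarrow> M a c \<in> carrier R"
  shows "linear_map R (func_space C) (func_space A) (\<lambda>x. \<lambda>a\<in>A. \<Oplus>c\<in>C. M a c \<otimes> x c)"
proof -
  interpret VC: vectorspace R "func_space C" by (rule func_space_vectorspace)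
  interpret VA: vectorspace R "func_space A" by (rule func_space_vectorspace)
  show ?thesis
  proof unfold_locales
    have xc: "x c \<in> carrier R" if "x \<in> C \<rightarrow>\<^sub>E carrier R" "c \<in> C" for x c using that by auto
    have 1: "(\<lambda>a\<in>A. \<Oplus>c\<in>C. M a c \<otimes> x c) \<in> A \<rightarrow>\<^sub>E carrier R" if "x \<in> C \<rightarrow>\<^sub>E carrier R" for x
      using M xc[OF that] by (auto intro!: finsum_closed)
    have 2: "(\<Oplus>c\<in>C. M a c \<otimes> (\<lambda>c\<in>C. x c \<oplus> y c) c) = (\<Oplus>c\<in>C. M a c \<otimes> x c) \<oplus> (\<Oplus>c\<in>C. M a c \<otimes> y c)"
      if "x \<in> C \<rightarrow>\<^sub>E carrier R" "y \<in> C \<rightarrow>\<^sub>E carrier R" "a \<in> A" for x y a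
    proof -
      have "(\<Oplus>c\<in>C. M a c \<otimes> (\<lambda>c\<in>C. x c \<oplus> y c) c) = (\<Oplus>c\<in>C. M a c \<otimes> x c \<oplus> M a c \<otimes> y c)"
        using M xc that by (intro finsum_cong') (auto simp: r_distr)
      also have "\<dots> = (\<Oplus>c\<in>C. M a c \<otimes> x c) \<oplus> (\<Oplus>c\<in>C. M a c \<otimes> y c)"
        using M xc that by (intro finsum_addf) auto
      finally show ?thesis .
    qed
    have 3: "(\<Oplus>c\<in>C. M a c \<otimes> (\<lambda>c\<in>C. k \<otimes> x c) c) = k \<otimes> (\<Oplus>c\<in>C. M a c \<otimes> x c)"
      if "x \<in> C \<rightarrow>\<^sub>E carrier R" "k \<in> carrier R" "a \<in> A" for x k a
    proof -
      have "(\<Oplus>c\<in>C. M a c \<otimes> (\<lambda>c\<in>C. k \<otimes> x c) c) = (\<Oplus>c\<in>C. k \<otimes> (M a c \<otimes> x c))"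
        using M xc that by (intro finsum_cong') (auto simp: m_lcomm)
      also have "\<dots> = k \<otimes> (\<Oplus>c\<in>C. M a c \<otimes> x c)"
        using M xc that C by (intro finsum_rdistr [symmetric]) auto
      finally show ?thesis .
    qed
    show "(\<lambda>x. \<lambda>a\<in>A. \<Oplus>c\<in>C. M a c \<otimes> x c) \<in> module_hom R (func_space C) (func_space A)"
      unfolding module_hom_def
    proof (intro CollectI conjI allI impI)
      show "(\<lambda>x. \<lambda>a\<in>A. \<Oplus>c\<in>C. M a c \<otimes> x c) \<in> carrier (func_space C) \<rightarrow> carrier (func_space A)"
        using 1 unfolding func_space_simps(1) by blast
    next
      fix x y assume "x \<in> carrier (func_space C) \<and> y \<in> carrier (func_space C)"
      then have "x \<in> C \<rightarrow>\<^sub>E carrier R" "y \<in> C \<rightarrow>\<^sub>E carrier R" by simp_all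
      note this' = 2[OF this]
      show "(\<lambda>a\<in>A. \<Oplus>c\<in>C. M a c \<otimes> (x \<oplus>\<^bsub>func_space C\<^esub> y) c) =
          (\<lambda>a\<in>A. \<Oplus>c\<in>C. M a c \<otimes> x c) \<oplus>\<^bsub>func_space A\<^esub> (\<lambda>a\<in>A. \<Oplus>c\<in>C. M a c \<otimes> y c)"
        unfolding func_space_simps by (rule restrict_ext) (use this' in simp)
    next
      fix k x assume "k \<in> carrier R \<and> x \<in> carrier (func_space C)"
      then have "x \<in> C \<rightarrow>\<^sub>E carrier R" "k \<in> carrier R" by simp_all
      note this' = 3[OF this]
      show "(\<lambda>a\<in>A. \<Oplus>c\<in>C. M a c \<otimes> (k \<odot>\<^bsub>func_space C\<^esub> x) c) =
          k \<odot>\<^bsub>func_space A\<^esub> (\<lambda>a\<in>A. \<Oplus>c\<in>C. M a c \<otimes> x c)"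
        unfolding func_space_simps by (rule restrict_ext) (use this' in simp)
    qed
  qed
qed

lemma mat_image_subspace:
  assumes C: "finite C" and M: "\<And>a c. a \<in> A \<Longrightarrow> c \<in> C \<Longrightarrow> M a c \<in> carrier R"
  shows "subspace R (mat_image A C M) (func_space A)"
proof -
  interpret T: linear_map R "func_space C" "func_space A" "\<lambda>x. \<lambda>a\<in>A. \<Oplus>c\<in>C. M a c \<otimes> x c"
    using assms by (rule mat_map_hom)
  have "T.im = mat_image A C M" by (simp add: T.im_def mat_image_def)
  then show ?thesis using T.imT_is_subspace by simp
qed

lemma mat_rank_le_spanning:
  assumes A: "finite A" and C: "finite C" and M: "\<And>a c. a \<in> A \<Longrightarrow> c \<in> C \<Longrightarrow> M a c \<in> carrier R"
    and B: "B \<subseteq> C"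
    and sp: "\<And>c. c \<in> C \<Longrightarrow> \<exists>q\<in>B \<rightarrow> carrier R. \<forall>a\<in>A. M a c = (\<Oplus>b\<in>B. M a b \<otimes> q b)"
  shows "mat_rank A C M \<le> card B"
proof -
  interpret V: vectorspace R "func_space A" by (rule func_space_vectorspace)
  let ?col = "\<lambda>c. \<lambda>a\<in>A. M a c"
  have finB: "finite B" using B C finite_subset by blast
  have colV: "?col c \<in> carrier (func_space A)" if "c \<in> C" for c using M that by auto
  have colB: "?col ` B \<subseteq> carrier (func_space A)" using colV B by blast
  have sum: "(\<Oplus>\<^bsub>func_space A\<^esub>i\<in>I. q i \<odot>\<^bsub>func_space A\<^esub> ?col i) = (\<lambda>a\<in>A. \<Oplus>i\<in>I. M a i \<otimes> q i)"
    if I: "I \<subseteq> C" and q: "q \<in> I \<rightarrow> carrier R" for I q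
  proof -
    have finI: "finite I" using I C finite_subset by blast
    have Mi: "M a i \<in> carrier R" if "a \<in> A" "i \<in> I" for a i using M I that by blast
    have qi: "q i \<in> carrier R" if "i \<in> I" for i using q that by blast
    have "(\<Oplus>\<^bsub>func_space A\<^esub>i\<in>I. q i \<odot>\<^bsub>func_space A\<^esub> ?col i) =
        (\<lambda>a\<in>A. \<Oplus>i\<in>I. (q i \<odot>\<^bsub>func_space A\<^esub> ?col i) a)"
      by (rule finsum_func_space[OF finI]) (use Mi qi in auto)
    also have "\<dots> = (\<lambda>a\<in>A. \<Oplus>i\<in>I. M a i \<otimes> q i)"
      using Mi qi by (intro restrict_ext finsum_cong') (auto simp: m_comm)
    finally show ?thesis .
  qed
  have sub: "subspace R (mat_image A C M) (func_space A)" by (rule mat_image_subspace[OF C M])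
  have smspan: "submodule R (V.span (?col ` B)) (func_space A)" by (rule V.span_is_submodule[OF colB])
  have colspan: "?col c \<in> V.span (?col ` B)" if c: "c \<in> C" for c
  proof -
    obtain q where q: "q \<in> B \<rightarrow> carrier R" "\<forall>a\<in>A. M a c = (\<Oplus>b\<in>B. M a b \<otimes> q b)" using sp[OF c] by blast
    have "?col c = (\<Oplus>\<^bsub>func_space A\<^esub>i\<in>B. q i \<odot>\<^bsub>func_space A\<^esub> ?col i)"
      unfolding sum[OF B q(1)] using q(2) by (intro restrict_ext) blast
    also have "\<dots> \<in> V.span (?col ` B)"
    proof (rule V.submodule_finsum_closed[OF smspan finB])
      fix i assume i: "i \<in> B"
      then have "?col i \<in> V.span (?col ` B)" using V.in_own_span[OF colB] by blast
      then show "q i \<odot>\<^bsub>func_space A\<^esub> ?col i \<in> V.span (?col ` B)"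
        using submodule.smult_closed[OF smspan, of "q i"] q(1) i by blast
    qed
    finally show ?thesis .
  qed
  have span: "mat_image A C M \<subseteq> V.span (?col ` B)"
  proof
    fix v assume "v \<in> mat_image A C M"
    then obtain x where x: "x \<in> C \<rightarrow>\<^sub>E carrier R" "v = (\<lambda>a\<in>A. \<Oplus>c\<in>C. M a c \<otimes> x c)"
      unfolding mat_image_def by blast
    have x': "x \<in> C \<rightarrow> carrier R" using x(1) by blast
    have "v = (\<Oplus>\<^bsub>func_space A\<^esub>i\<in>C. x i \<odot>\<^bsub>func_space A\<^esub> ?col i)"
      unfolding sum[OF order_refl x'] x(2) ..
    also have "\<dots> \<in> V.span (?col ` B)"
    proof (rule V.submodule_finsum_closed[OF smspan C])
      fix i assume i: "i \<in> C"
      show "x i \<odot>\<^bsub>func_space A\<^esub> ?col i \<in> V.span (?col ` B)"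
        using submodule.smult_closed[OF smspan, of "x i"] x' i colspan[OF i] by blast
    qed
    finally show "v \<in> V.span (?col ` B)" .
  qed
  have colim: "?col ` B \<subseteq> mat_image A C M"
  proof
    fix v assume "v \<in> ?col ` B"
    then obtain b where b: "b \<in> B" "v = ?col b" by blast
    let ?x = "\<lambda>c\<in>C. if c = b then \<one> else \<zero>"
    have bC: "b \<in> C" using b B by blast
    have e: "(\<Oplus>c\<in>C. M a c \<otimes> ?x c) = M a b" if "a \<in> A" for a
      using finsum_single[OF bC C, of "\<lambda>c. M a c \<otimes> ?x c"] M[OF that] bC by simp
    have "v = (\<lambda>a\<in>A. \<Oplus>c\<in>C. M a c \<otimes> ?x c)"
      unfolding b(2) by (rule restrict_ext) (simp only: e)
    then show "v \<in> mat_image A C M" unfolding mat_image_def by (rule image_eqI[of _ _ ?x]) auto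
  qed
  interpret W: vectorspace R "func_space A\<lparr>carrier := mat_image A C M\<rparr>" by (rule V.subspace_is_vs[OF sub])
  have smW: "submodule R (mat_image A C M) (func_space A)" using sub by simp
  have "W.span (?col ` B) = mat_image A C M"
    using V.span_li_not_depend(1)[OF colim smW] span V.span_is_subset[OF colim smW] by simp
  then have "W.dim \<le> card (?col ` B)"
    using finB colim by (intro W.gen_ge_dim) auto
  then show ?thesis unfolding mat_rank_def using card_image_le[OF finB, of ?col] by linarith
qed

lemma card_le_mat_rank:
  assumes A: "finite A" and C: "finite C" and M: "\<And>a c. a \<in> A \<Longrightarrow> c \<in> C \<Longrightarrow> M a c \<in> carrier R"
    and I: "finite I" and e: "\<And>i. i \<in> I \<Longrightarrow> e i \<in> mat_image A C M"
    and ind: "\<And>q i. q \<in> I \<rightarrow> carrier R \<Longrightarrow> (\<And>a. a \<in> A \<Longrightarrow> (\<Oplus>i\<in>I. q i \<otimes> e i a) = \<zero>) \<Longrightarrow> i \<in> I \<Longrightarrow> q i = \<zero>"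
  shows "card I \<le> mat_rank A C M"
proof -
  interpret V: vectorspace R "func_space A" by (rule func_space_vectorspace)
  have sub: "subspace R (mat_image A C M) (func_space A)" by (rule mat_image_subspace[OF C M])
  interpret W: vectorspace R "func_space A\<lparr>carrier := mat_image A C M\<rparr>" by (rule V.subspace_is_vs[OF sub])
  have smW: "submodule R (mat_image A C M) (func_space A)" using sub by simp
  have eV: "e i \<in> A \<rightarrow>\<^sub>E carrier R" if "i \<in> I" for i
    using e[OF that] submodule.subset[OF smW] by auto
  have "card I \<le> W.dim"
  proof (rule W.card_independent_family_le[OF V.subspace_dim_le(1)[OF func_space_dim(1)[OF A] sub] I])
    show "e i \<in> carrier (func_space A\<lparr>carrier := mat_image A C M\<rparr>)" if "i \<in> I" for i using e[OF that] by simp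
    fix q i assume q: "q \<in> I \<rightarrow> carrier R" and i: "i \<in> I"
      and z: "(\<Oplus>\<^bsub>func_space A\<lparr>carrier := mat_image A C M\<rparr>\<^esub>i\<in>I. q i \<odot>\<^bsub>func_space A\<lparr>carrier := mat_image A C M\<rparr>\<^esub> e i) =
        \<zero>\<^bsub>func_space A\<lparr>carrier := mat_image A C M\<rparr>\<^esub>"
    have qe: "q i \<odot>\<^bsub>func_space A\<^esub> e i \<in> mat_image A C M" if "i \<in> I" for i
      using submodule.smult_closed[OF smW, of "q i"] q that e[OF that] by blast
    have "(\<Oplus>\<^bsub>func_space A\<^esub>i\<in>I. q i \<odot>\<^bsub>func_space A\<^esub> e i) = (\<lambda>a\<in>A. \<zero>)"
      using z V.finsum_subspace[OF sub I qe] by simp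
    moreover have "(\<Oplus>\<^bsub>func_space A\<^esub>i\<in>I. q i \<odot>\<^bsub>func_space A\<^esub> e i) = (\<lambda>a\<in>A. \<Oplus>i\<in>I. (q i \<odot>\<^bsub>func_space A\<^esub> e i) a)"
    proof (rule finsum_func_space[OF I])
      fix i assume "i \<in> I"
      then show "q i \<odot>\<^bsub>func_space A\<^esub> e i \<in> A \<rightarrow>\<^sub>E carrier R"
        using subsetD[OF submodule.subset[OF smW] qe] by (simp only: func_space_simps(1))
    qed
    ultimately have zz: "(\<lambda>a\<in>A. \<Oplus>i\<in>I. (q i \<odot>\<^bsub>func_space A\<^esub> e i) a) = (\<lambda>a\<in>A. \<zero>)" by simp
    show "q i = \<zero>"
    proof (rule ind[OF q _ i])
      fix a assume a: "a \<in> A"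
      have "(\<Oplus>i\<in>I. q i \<otimes> e i a) = (\<Oplus>i\<in>I. (q i \<odot>\<^bsub>func_space A\<^esub> e i) a)"
        using a q eV by (intro finsum_cong') auto
      also have "\<dots> = \<zero>" using fun_cong[OF zz, of a] a by simp
      finally show "(\<Oplus>i\<in>I. q i \<otimes> e i a) = \<zero>" .
    qed
  qed
  then show ?thesis by (simp add: mat_rank_def)
qed

end

section \<open>One integer matrix over the rationals and over a prime field\<close>

abbreviation rat_ring :: "rat ring" where "rat_ring \<equiv> ring_of_type_algebra"

lemma rat_ring_simps [simp]: "carrier rat_ring = UNIV" "x \<otimes>\<^bsub>rat_ring\<^esub> y = x * y"
  "x \<oplus>\<^bsub>rat_ring\<^esub> y = x + y" "\<zero>\<^bsub>rat_ring\<^esub> = 0" "\<one>\<^bsub>rat_ring\<^esub> = 1"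
  by (simp_all add: ring_of_type_algebra_def)

lemma rat_field: "field rat_ring"
  by (rule field_from_type_algebra)

lemma finsum_rat_ring:
  assumes "finite A"
  shows "finsum rat_ring f A = sum f A"
proof -
  interpret rat_ring: field rat_ring by (rule rat_field)
  show ?thesis using assms by (induction A rule: finite_induct) auto
qed

lemma uminus_rat_ring: "\<ominus>\<^bsub>rat_ring\<^esub> x = - x"
proof -
  interpret rat_ring: field rat_ring by (rule rat_field)
  show ?thesis by (rule rat_ring.minus_equality) auto
qed

text \<open>Independence over the field with l elements of the columns in B, expressed with integers
  so that the same B can be used for the rational rank.\<close>

definition indep_mod :: "int \<Rightarrow> 'a set \<Rightarrow> ('a \<Rightarrow> 'c \<Rightarrow> int) \<Rightarrow> 'c set \<Rightarrow> bool" where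
  "indep_mod l A D B \<longleftrightarrow> (\<forall>k. (\<forall>a\<in>A. l dvd (\<Sum>b\<in>B. D a b * k b)) \<longrightarrow> (\<forall>b\<in>B. l dvd k b))"

text \<open>A maximal set of columns that is independent modulo l spans all columns modulo
  l.\<close>

lemma mat_rank_residue_le:
  fixes l :: nat and D :: "'a \<Rightarrow> 'c \<Rightarrow> int"
  assumes l: "Factorial_Ring.prime l" and A: "finite A" and C: "finite C"
  shows "\<exists>B\<subseteq>C. indep_mod (int l) A D B \<and> field.mat_rank (residue_ring (int l)) A C (\<lambda>a c. D a c mod int l) \<le> card B"
proof -
  define R where "R = residue_ring (int l)"
  interpret residues_prime l R by unfold_locales (use l R_def in auto)
  have "{} \<subseteq> C \<and> indep_mod (int l) A D {}" by (simp add: indep_mod_def)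
  moreover have "finite B \<and> card B \<le> card C" if "B \<subseteq> C \<and> indep_mod (int l) A D B" for B
    using that C by (auto intro: card_mono finite_subset)
  ultimately obtain B where B: "B \<subseteq> C" "indep_mod (int l) A D B"
    and max: "\<And>B'. B \<subseteq> B' \<Longrightarrow> B' \<subseteq> C \<Longrightarrow> indep_mod (int l) A D B' \<Longrightarrow> B' = B"
    using maximal_exists[of "\<lambda>B. B \<subseteq> C \<and> indep_mod (int l) A D B" "card C" "{}"] by (auto simp: maximal_def)
  have finB: "finite B" using B C finite_subset by blast
  have "field.mat_rank R A C (\<lambda>a c. D a c mod int l) \<le> card B"
  proof (rule field.mat_rank_le_spanning[OF is_field A C _ B(1)])
    show "D a c mod int l \<in> carrier R" for a c by simp
    fix c assume c: "c \<in> C"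
    have eq: "(\<Oplus>\<^bsub>R\<^esub>b\<in>B. (D a b mod int l) \<otimes>\<^bsub>R\<^esub> (q b mod int l)) = (\<Sum>b\<in>B. D a b * q b) mod int l" for q a
      using sum_cong[OF finB, of "\<lambda>b. D a b * q b"] by (simp add: mult_cong)
    have "\<exists>q. \<forall>a\<in>A. D a c mod int l = (\<Sum>b\<in>B. D a b * q b) mod int l"
    proof (cases "c \<in> B")
      case True
      have "(\<Sum>b\<in>B. D a b * (if b = c then 1 else 0)) = D a c" for a
        using True finB by (simp add: if_distrib cong: if_cong)
      then show ?thesis by (intro exI[of _ "\<lambda>b. if b = c then 1 else 0"]) simp
    next
      case False
      \<comment> \<open>By maximality the column c enters a relation with those in B that is
        nontrivial modulo l. Its own coefficient is prime to l, as otherwise B would be dependent,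
        so an inverse w modulo l solves the relation for the column c.\<close>
      have "\<not> indep_mod (int l) A D (insert c B)" using max[of "insert c B"] c B False by blast
      then obtain k where k: "\<And>a. a \<in> A \<Longrightarrow> int l dvd (\<Sum>b\<in>insert c B. D a b * k b)"
        and nd: "\<exists>b\<in>insert c B. \<not> int l dvd k b"
        unfolding indep_mod_def by blast
      have k': "int l dvd D a c * k c + (\<Sum>b\<in>B. D a b * k b)" if "a \<in> A" for a
        using k[OF that] False finB by simp
      have "\<not> int l dvd k c"
      proof
        assume d: "int l dvd k c"
        have "int l dvd (\<Sum>b\<in>B. D a b * k b)" if "a \<in> A" for a
          using k'[OF that] d by (metis dvd_add_right_iff dvd_mult)
        then have "\<forall>b\<in>B. int l dvd k b" using B(2) unfolding indep_mod_def by blast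
        with nd d show False by blast
      qed
      then have "coprime (k c) (int l)" using l by (simp add: prime_imp_coprime coprime_commute)
      then obtain w where w: "[k c * w = 1] (mod int l)" using cong_solve_coprime_int by blast
      have "D a c mod int l = (\<Sum>b\<in>B. D a b * (- w * k b)) mod int l" if a: "a \<in> A" for a
      proof -
        have "[D a c * (k c * w) = D a c] (mod int l)" using cong_scalar_left[OF w, of "D a c"] by simp
        moreover have "[D a c * (k c * w) + w * (\<Sum>b\<in>B. D a b * k b) = 0] (mod int l)"
          using k'[OF a] by (simp add: cong_0_iff algebra_simps flip: distrib_left)
        ultimately have "int l dvd (D a c * (k c * w) + w * (\<Sum>b\<in>B. D a b * k b)) - (D a c * (k c * w) - D a c)"
          unfolding cong_iff_dvd_diff diff_0_right using dvd_diff by blast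
        then have "[D a c = - (w * (\<Sum>b\<in>B. D a b * k b))] (mod int l)"
          by (simp add: cong_iff_dvd_diff add.commute)
        then show ?thesis by (simp add: cong_def sum_distrib_left mult.left_commute sum_negf)
      qed
      then show ?thesis by (intro exI[of _ "\<lambda>b. - w * k b"] ballI)
    qed
    then obtain q where q: "\<forall>a\<in>A. D a c mod int l = (\<Sum>b\<in>B. D a b * q b) mod int l" by blast
    show "\<exists>q\<in>B \<rightarrow> carrier R. \<forall>a\<in>A. D a c mod int l = (\<Oplus>\<^bsub>R\<^esub>b\<in>B. (D a b mod int l) \<otimes>\<^bsub>R\<^esub> q b)"
    proof (rule bexI[of _ "\<lambda>b. q b mod int l"])
      show "\<forall>a\<in>A. D a c mod int l = (\<Oplus>\<^bsub>R\<^esub>b\<in>B. (D a b mod int l) \<otimes>\<^bsub>R\<^esub> (q b mod int l))"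
        using q unfolding eq .
    qed simp
  qed
  with B show ?thesis unfolding R_def by blast
qed

lemma common_denominator:
  fixes c :: "'i \<Rightarrow> rat"
  assumes "finite I"
  shows "\<exists>N k. N \<noteq> 0 \<and> (\<forall>i\<in>I. of_int N * c i = of_int (k i))"
  using assms
proof (induction I rule: finite_induct)
  case empty
  show ?case by (intro exI[of _ 1]) simp
next
  case (insert i I)
  then obtain N k where Nk: "N \<noteq> 0" "\<forall>i\<in>I. of_int N * c i = of_int (k i)" by blast
  obtain p q where pq: "quotient_of (c i) = (p, q)" by fastforce
  then have q: "q > 0" "c i = of_int p / of_int q"
    using quotient_of_denom_pos quotient_of_div by blast+
  have "of_int (N * q) * c i = of_int (N * p)" using q by simp
  moreover have "of_int (N * q) * c j = of_int (k j * q)" if "j \<in> I" for j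
    using Nk that by (simp add: mult.assoc mult.left_commute[of "of_int q"])
  ultimately show ?case
    using Nk q insert.hyps
    by (intro exI[of _ "N * q"] exI[of _ "\<lambda>j. if j = i then N * p else k j * q"]) auto
qed

text \<open>As long as all coefficients are divisible by l, divide by l; the sum of their absolute
  values decreases, so this stops. \<open>P\<close> stands for a homogeneous linear relation, which
  survives the division.\<close>

lemma primitive_relation:
  fixes k :: "'i \<Rightarrow> int" and l :: int
  assumes I: "finite I" and l: "l > 1" and P: "P k" and nz: "\<exists>i\<in>I. k i \<noteq> 0"
    and div: "\<And>k m. P k \<Longrightarrow> (\<And>i. i \<in> I \<Longrightarrow> k i = l * m i) \<Longrightarrow> P m"
  shows "\<exists>m. P m \<and> (\<exists>i\<in>I. \<not> l dvd m i)"
  using P nz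
proof (induction "nat (\<Sum>i\<in>I. \<bar>k i\<bar>)" arbitrary: k rule: less_induct)
  case less
  show ?case
  proof (cases "\<exists>i\<in>I. \<not> l dvd k i")
    case False
    define m where "m i = k i div l" for i
    have km: "k i = l * m i" if "i \<in> I" for i using False that by (simp add: m_def)
    have m0: "\<exists>i\<in>I. m i \<noteq> 0" using less.prems(2) km by force
    have pos: "(\<Sum>i\<in>I. \<bar>m i\<bar>) > 0"
      using m0 I by (metis (no_types, lifting) abs_ge_zero abs_zero sum_nonneg_eq_0_iff abs_eq_0 order_le_less sum_nonneg)
    have "(\<Sum>i\<in>I. \<bar>k i\<bar>) = l * (\<Sum>i\<in>I. \<bar>m i\<bar>)"
      using km l by (simp add: sum_distrib_left abs_mult)
    moreover have "(\<Sum>i\<in>I. \<bar>m i\<bar>) < l * (\<Sum>i\<in>I. \<bar>m i\<bar>)" using pos l by simp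
    ultimately have "nat (\<Sum>i\<in>I. \<bar>m i\<bar>) < nat (\<Sum>i\<in>I. \<bar>k i\<bar>)" using pos by simp
    from less.hyps[OF this div[OF less.prems(1) km] m0] show ?thesis .
  qed (use less.prems in blast)
qed

lemma mat_image_rat_ring:
  assumes "finite C"
  shows "field.mat_image rat_ring A C M = {\<lambda>a\<in>A. \<Sum>c\<in>C. M a c * x c | x. x \<in> extensional C}"
  unfolding field.mat_image_def[OF rat_field] using assms
  by (auto simp: finsum_rat_ring PiE_def image_iff cong: restrict_cong)

text \<open>A rational relation between columns, cleared of denominators and made primitive with
  respect to l, is a nontrivial relation modulo l; so independence modulo l implies independence
  over the rationals. In the second claim y represents a class of order l in the cokernel of the
  integer matrix. It lies in the rational column space and is independent of the columns in B, which
  raises the rank by one.\<close>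

lemma mat_rank_rat_ge:
  fixes l :: nat and D :: "'a \<Rightarrow> 'c \<Rightarrow> int"
  assumes l: "Factorial_Ring.prime l" and A: "finite A" and C: "finite C" and B: "B \<subseteq> C"
    and ind: "indep_mod (int l) A D B"
  shows "card B \<le> field.mat_rank rat_ring A C (\<lambda>a c. of_int (D a c))"
    and "\<lbrakk>\<And>a. a \<in> A \<Longrightarrow> int l * y a = (\<Sum>c\<in>C. D a c * x c); \<not> (\<exists>z. \<forall>a\<in>A. y a = (\<Sum>c\<in>C. D a c * z c))\<rbrakk> \<Longrightarrow>
       card B < field.mat_rank rat_ring A C (\<lambda>a c. of_int (D a c))"
proof -
  interpret rat_ring: field rat_ring by (rule rat_field)
  have l1: "int l > 1" using l prime_gt_1_nat by fastforce
  have l0: "int l \<noteq> 0" using l1 by simp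
  have finB: "finite B" using B C finite_subset by blast
  let ?M = "\<lambda>a c. of_int (D a c) :: rat"
  have col: "(\<lambda>a\<in>A. ?M a b) \<in> field.mat_image rat_ring A C ?M" if b: "b \<in> B" for b
  proof -
    have "(\<Sum>c\<in>C. ?M a c * (\<lambda>c\<in>C. if c = b then 1 else 0) c) = ?M a b" for a
    proof -
      have "(\<Sum>c\<in>C. ?M a c * (\<lambda>c\<in>C. if c = b then 1 else 0) c) = (\<Sum>c\<in>C. if c = b then ?M a b else 0)"
        by (rule sum.cong) auto
      then show ?thesis using b B C by auto
    qed
    then show ?thesis unfolding mat_image_rat_ring[OF C]
      by (intro CollectI exI[of _ "\<lambda>c\<in>C. if c = b then 1 else 0"]) auto
  qed
  show "card B \<le> field.mat_rank rat_ring A C ?M"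
  proof (rule rat_ring.card_le_mat_rank[OF A C _ finB])
    show "(\<lambda>a\<in>A. ?M a b) \<in> field.mat_image rat_ring A C ?M" if "b \<in> B" for b using col[OF that] .
    fix q :: "'c \<Rightarrow> rat" and i
    assume z: "\<And>a. a \<in> A \<Longrightarrow> (\<Oplus>\<^bsub>rat_ring\<^esub>i\<in>B. q i \<otimes>\<^bsub>rat_ring\<^esub> (\<lambda>a\<in>A. ?M a i) a) = \<zero>\<^bsub>rat_ring\<^esub>" and i: "i \<in> B"
    show "q i = \<zero>\<^bsub>rat_ring\<^esub>"
    proof (rule ccontr)
      assume qi: "q i \<noteq> \<zero>\<^bsub>rat_ring\<^esub>"
      obtain N k where Nk: "N \<noteq> 0" "\<forall>i\<in>B. of_int N * q i = of_int (k i)" using common_denominator[OF finB] by blast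
      define P where "P k \<longleftrightarrow> (\<forall>a\<in>A. (\<Sum>b\<in>B. D a b * k b) = 0)" for k
      have "P k" unfolding P_def
      proof
        fix a assume a: "a \<in> A"
        have "(of_int (\<Sum>b\<in>B. D a b * k b) :: rat) = (\<Sum>b\<in>B. of_int N * (q b * of_int (D a b)))"
          using Nk(2) by (auto intro!: sum.cong simp: mult.commute mult.left_commute)
        also have "\<dots> = of_int N * (\<Sum>b\<in>B. q b * of_int (D a b))" by (simp add: sum_distrib_left)
        also have "(\<Sum>b\<in>B. q b * of_int (D a b)) = 0" using z[OF a] a finB by (simp add: finsum_rat_ring)
        finally show "(\<Sum>b\<in>B. D a b * k b) = 0" by (simp only: mult_zero_right of_int_eq_0_iff)
      qed
      moreover have "\<exists>i\<in>B. k i \<noteq> 0" using Nk qi i by (intro bexI[OF _ i]) (metis mult_eq_0_iff of_int_eq_0_iff rat_ring_simps(4))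
      moreover have "P m" if "P k" "\<And>i. i \<in> B \<Longrightarrow> k i = int l * m i" for k m
      proof -
        have "(\<Sum>b\<in>B. D a b * k b) = int l * (\<Sum>b\<in>B. D a b * m b)" for a
          using that(2) by (simp add: sum_distrib_left mult.left_commute)
        then show ?thesis using that(1) l0 by (simp add: P_def)
      qed
      ultimately obtain m where "P m" "\<exists>i\<in>B. \<not> int l dvd m i"
        using primitive_relation[OF finB l1, of P k] by blast
      then show False using ind unfolding indep_mod_def P_def by fastforce
    qed
  qed simp
  show "card B < field.mat_rank rat_ring A C ?M"
    if ly: "\<And>a. a \<in> A \<Longrightarrow> int l * y a = (\<Sum>c\<in>C. D a c * x c)" and no: "\<not> (\<exists>z. \<forall>a\<in>A. y a = (\<Sum>c\<in>C. D a c * z c))"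
  proof -
    \<comment> \<open>\<open>None\<close> is the index of the additional vector y.\<close>
    let ?I = "insert None (Some ` B)"
    have finI: "finite ?I" using finB by simp
    define e where "e i = (case i of None \<Rightarrow> (\<lambda>a\<in>A. of_int (y a)) | Some b \<Rightarrow> (\<lambda>a\<in>A. ?M a b))" for i
    have yim: "(\<lambda>a\<in>A. of_int (y a)) \<in> field.mat_image rat_ring A C ?M"
    proof -
      have "of_int (y a) = (\<Sum>c\<in>C. ?M a c * (\<lambda>c\<in>C. of_int (x c) / of_int (int l)) c)" if "a \<in> A" for a
      proof -
        have "of_int (int l) * (of_int (y a) :: rat) = (\<Sum>c\<in>C. ?M a c * of_int (x c))"
          using arg_cong[OF ly[OF that], of "of_int :: int \<Rightarrow> rat"] by simp
        then have "of_int (y a) = (\<Sum>c\<in>C. ?M a c * of_int (x c)) / of_int (int l)"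
          using l0 by (simp add: field_simps)
        also have "\<dots> = (\<Sum>c\<in>C. ?M a c * (\<lambda>c\<in>C. of_int (x c) / of_int (int l)) c)"
          by (simp add: sum_divide_distrib)
        finally show ?thesis .
      qed
      then have "(\<lambda>a\<in>A. of_int (y a)) = (\<lambda>a\<in>A. \<Sum>c\<in>C. ?M a c * (\<lambda>c\<in>C. of_int (x c) / of_int (int l)) c)"
        by (rule restrict_ext)
      then show ?thesis unfolding mat_image_rat_ring[OF C] by blast
    qed
    have "card ?I \<le> field.mat_rank rat_ring A C ?M"
    proof (rule rat_ring.card_le_mat_rank[OF A C _ finI])
      show "e i \<in> field.mat_image rat_ring A C ?M" if "i \<in> ?I" for i using that col yim by (auto simp: e_def)
      fix q :: "'c option \<Rightarrow> rat" and i
      assume z: "\<And>a. a \<in> A \<Longrightarrow> (\<Oplus>\<^bsub>rat_ring\<^esub>i\<in>?I. q i \<otimes>\<^bsub>rat_ring\<^esub> e i a) = \<zero>\<^bsub>rat_ring\<^esub>" and i: "i \<in> ?I"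
      have sI: "(\<Sum>i\<in>?I. f i) = f None + (\<Sum>b\<in>B. f (Some b))" for f :: "'c option \<Rightarrow> rat"
        using finB by (simp add: sum.reindex)
      show "q i = \<zero>\<^bsub>rat_ring\<^esub>"
      proof (rule ccontr)
        assume qi: "q i \<noteq> \<zero>\<^bsub>rat_ring\<^esub>"
        obtain N k where Nk: "N \<noteq> 0" "\<forall>i\<in>?I. of_int N * q i = of_int (k i)" using common_denominator[OF finI] by blast
        define P where "P k \<longleftrightarrow> (\<forall>a\<in>A. y a * k None + (\<Sum>b\<in>B. D a b * k (Some b)) = 0)" for k
        have "P k" unfolding P_def
        proof
          fix a assume a: "a \<in> A"
          have "q None * of_int (y a) + (\<Sum>b\<in>B. q (Some b) * ?M a b) = 0"
            using z[OF a] a finI sI[of "\<lambda>i. q i * e i a"] by (simp only: finsum_rat_ring rat_ring_simps) (simp add: e_def)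
          then have "of_int N * (q None * of_int (y a) + (\<Sum>b\<in>B. q (Some b) * ?M a b)) = 0" by simp
          then have "(of_int N * q None) * of_int (y a) + (\<Sum>b\<in>B. (of_int N * q (Some b)) * ?M a b) = 0"
            by (simp add: distrib_left sum_distrib_left mult.assoc)
          moreover have "(\<Sum>b\<in>B. (of_int N * q (Some b)) * ?M a b) = (\<Sum>b\<in>B. of_int (k (Some b)) * ?M a b)"
            using Nk(2) by (intro sum.cong) auto
          moreover have "of_int N * q None = of_int (k None)" using Nk(2) by blast
          ultimately have "(of_int (k None * y a + (\<Sum>b\<in>B. k (Some b) * D a b)) :: rat) = 0" by simp
          then have "k None * y a + (\<Sum>b\<in>B. k (Some b) * D a b) = 0" by (simp only: of_int_eq_0_iff)
          then show "y a * k None + (\<Sum>b\<in>B. D a b * k (Some b)) = 0" by (simp add: mult.commute)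
        qed
        moreover have "\<exists>i\<in>?I. k i \<noteq> 0" using Nk qi i by (intro bexI[OF _ i]) (metis mult_eq_0_iff of_int_eq_0_iff rat_ring_simps(4))
        moreover have "P m" if "P k" "\<And>i. i \<in> ?I \<Longrightarrow> k i = int l * m i" for k m
        proof -
          have "y a * k None + (\<Sum>b\<in>B. D a b * k (Some b)) = int l * (y a * m None + (\<Sum>b\<in>B. D a b * m (Some b)))" for a
            using that(2) by (simp add: distrib_left sum_distrib_left mult.left_commute)
          then show ?thesis using that(1) l0 by (simp add: P_def)
        qed
        ultimately obtain m where m: "P m" "\<exists>i\<in>?I. \<not> int l dvd m i"
          using primitive_relation[OF finI l1, of P k] by blast
        have Pm: "(\<Sum>b\<in>B. D a b * m (Some b)) = - (y a * m None)" if "a \<in> A" for a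
          using m(1) that by (fastforce simp: P_def)
        \<comment> \<open>If l divided the coefficient of y, then independence of B modulo l would
          make it divide all the others, against primitivity.\<close>
        have "\<not> int l dvd m None"
        proof
          assume d: "int l dvd m None"
          have "int l dvd (\<Sum>b\<in>B. D a b * m (Some b))" if "a \<in> A" for a using Pm[OF that] d by simp
          then have "\<forall>b\<in>B. int l dvd m (Some b)"
            using ind[unfolded indep_mod_def, rule_format, of "\<lambda>b. m (Some b)"] by blast
          with d m(2) show False by auto
        qed
        then have "coprime (m None) (int l)" using l by (simp add: prime_imp_coprime coprime_commute)
        then obtain w where "[m None * w = 1] (mod int l)" using cong_solve_coprime_int by blast
        then obtain u where u: "m None * w + int l * u = 1"
          by (metis cong_iff_lin cong_sym mult.commute)
        \<comment> \<open>Bezout: y = u * (l * y) + w * (m None * y). Here l * y is the image of x,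
          and the primitive relation writes m None * y as minus the combination of the columns in
          B.\<close>
        define z where "z c = u * x c - (if c \<in> B then w * m (Some c) else 0)" for c
        have "y a = (\<Sum>c\<in>C. D a c * z c)" if a: "a \<in> A" for a
        proof -
          have "(\<Sum>c\<in>C. D a c * (if c \<in> B then w * m (Some c) else 0)) = (\<Sum>c\<in>B. D a c * (w * m (Some c)))"
            using B C by (intro sum.mono_neutral_cong_right) auto
          also have "\<dots> = w * - (y a * m None)"
            unfolding Pm[OF a, symmetric] by (simp add: sum_distrib_left mult.left_commute)
          finally have "(\<Sum>c\<in>C. D a c * z c) = u * (\<Sum>c\<in>C. D a c * x c) + w * (y a * m None)"
            by (simp add: z_def right_diff_distrib sum_subtractf sum_distrib_left mult.left_commute)
          also have "\<dots> = y a * (m None * w + int l * u)"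
            using ly[OF a] by (simp add: algebra_simps)
          finally show ?thesis by (simp add: u)
        qed
        with no show False by blast
      qed
    qed simp
    then show ?thesis using finB by (simp add: card_image card_insert_if image_iff)
  qed
qed

section \<open>The Koszul matrices over the integers, and torsion from their cokernels\<close>

definition kbasis :: "nat \<Rightarrow> nat set set \<Rightarrow> nat \<Rightarrow> int \<Rightarrow> (nat \<times> nat multiset) set" where
  "kbasis n \<Delta> i d = (SIGMA b:{..<card (subsets_of_card n i)}. {m. int (size m) = d - int i \<and> set_mset m \<in> \<Delta>})"

text \<open>The Koszul differential on the monomial basis, with entries 0, 1 and -1 taken as
  integers, so that a single matrix serves all fields.\<close>

definition kmat :: "nat \<Rightarrow> nat \<Rightarrow> nat \<times> nat multiset \<Rightarrow> nat \<times> nat multiset \<Rightarrow> int" where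
  "kmat n i x y = (let s = kenum n i (fst x); t = kenum n (Suc i) (fst y); z = the_elem (t - s) in
     if snd y \<subseteq># snd x \<and> s \<subseteq> t \<and> snd x - snd y = {#z#} then (- 1) ^ kpos z s else 0)"

context sr_over
begin

lemma cindex_koszul: "cindex koszul i d = kbasis n \<Delta> i d"
  by (simp add: cindex_def basis_index_def kbasis_def)

text \<open>\<open>\<iota>\<close> stands for the map from the integers to K, namely
  \<open>of_int\<close> or reduction modulo l. On entries 0, 1 and -1 the three assumed values
  determine it.\<close>

lemma cmatrix_koszul:
  assumes "\<iota> 0 = \<zero>" "\<iota> 1 = \<one>" "\<iota> (-1) = \<ominus> \<one>"
  shows "cmatrix koszul i x y = \<iota> (kmat n i x y)"
  using assms by (simp add: cmatrix_def kdiff_def kmat_def Let_def S_zero mterm_def sg_def minus_one_power_iff)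

lemma betti_koszul:
  assumes "\<iota> 0 = \<zero>" "\<iota> 1 = \<one>" "\<iota> (-1) = \<ominus> \<one>"
  shows "betti K n \<Delta> (Suc h) d + mat_rank (kbasis n \<Delta> (Suc h) d) (kbasis n \<Delta> (Suc (Suc h)) d) (\<lambda>x y. \<iota> (kmat n (Suc h) x y)) +
     mat_rank (kbasis n \<Delta> h d) (kbasis n \<Delta> (Suc h) d) (\<lambda>x y. \<iota> (kmat n h x y)) = card (kbasis n \<Delta> (Suc h) d)"
proof -
  have "cmatrix koszul i = (\<lambda>x y. \<iota> (kmat n i x y))" for i
    by (intro ext cmatrix_koszul assms)
  then show ?thesis using betti_resolution[OF koszul_gres, of h d] by (simp only: cindex_koszul)
qed

lemma finite_kbasis: "finite (kbasis n \<Delta> i d)"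
  using finite_basis_index[of "card (subsets_of_card n i)" "\<lambda>b. int i" d] by (simp add: basis_index_def kbasis_def)

end

text \<open>Over both fields the Betti number is the same number of basis elements minus two ranks.
  Neither rank modulo l exceeds the rational one, and the class y of order l makes one of them
  strictly smaller.\<close>

lemma has_torsionI:
  fixes l :: nat
  assumes l: "Factorial_Ring.prime l"
    and \<Delta>: "\<And>w. w \<in> \<Delta> \<Longrightarrow> w \<subseteq> {1..n}" "\<And>w w'. w \<in> \<Delta> \<Longrightarrow> w' \<subseteq> w \<Longrightarrow> w' \<in> \<Delta>"
    and ly: "\<And>a. a \<in> kbasis n \<Delta> (Suc h) d \<Longrightarrow> int l * y a = (\<Sum>c\<in>kbasis n \<Delta> (Suc (Suc h)) d. kmat n (Suc h) a c * x c)"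
    and no: "\<not> (\<exists>z. \<forall>a\<in>kbasis n \<Delta> (Suc h) d. y a = (\<Sum>c\<in>kbasis n \<Delta> (Suc (Suc h)) d. kmat n (Suc h) a c * z c))"
  shows "has_torsion l n \<Delta>"
proof -
  have F: "field (residue_ring (int l))" and F0: "\<zero>\<^bsub>residue_ring (int l)\<^esub> = 0"
    and F1: "\<one>\<^bsub>residue_ring (int l)\<^esub> = 1" and Fneg: "\<ominus>\<^bsub>residue_ring (int l)\<^esub> 1 = (- 1) mod int l"
  proof -
    define R where "R = residue_ring (int l)"
    interpret residues_prime l R by unfold_locales (use l R_def in auto)
    show "field (residue_ring (int l))" using is_field by (simp only: R_def)
    show "\<zero>\<^bsub>residue_ring (int l)\<^esub> = 0" using res_zero_eq by (simp only: R_def)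
    show "\<one>\<^bsub>residue_ring (int l)\<^esub> = 1" using res_one_eq by (simp only: R_def)
    show "\<ominus>\<^bsub>residue_ring (int l)\<^esub> 1 = (- 1) mod int l" using res_neg_eq[of 1] by (simp only: R_def)
  qed
  have ax: "sr_over_axioms n \<Delta>"
    unfolding sr_over_axioms_def using \<Delta> by blast
  have Fp: "sr_over (residue_ring (int l)) n \<Delta>"
    by (rule sr_over.intro[OF poly_over.intro[OF F] ax])
  have Q: "sr_over rat_ring n \<Delta>"
    by (rule sr_over.intro[OF poly_over.intro[OF rat_field] ax])
  let ?A = "\<lambda>i. kbasis n \<Delta> i d"
  have l1: "int l > 1" using l prime_gt_1_nat by fastforce
  note fin = sr_over.finite_kbasis[OF Q]
  have bF: "betti (residue_ring (int l)) n \<Delta> (Suc h) d +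
      field.mat_rank (residue_ring (int l)) (?A (Suc h)) (?A (Suc (Suc h))) (\<lambda>x y. kmat n (Suc h) x y mod int l) +
      field.mat_rank (residue_ring (int l)) (?A h) (?A (Suc h)) (\<lambda>x y. kmat n h x y mod int l) = card (?A (Suc h))"
    using l1 by (intro sr_over.betti_koszul[OF Fp, of "\<lambda>k. k mod int l"]) (simp_all add: F0 F1 Fneg)
  have bQ: "betti rat_ring n \<Delta> (Suc h) d +
      field.mat_rank rat_ring (?A (Suc h)) (?A (Suc (Suc h))) (\<lambda>x y. of_int (kmat n (Suc h) x y)) +
      field.mat_rank rat_ring (?A h) (?A (Suc h)) (\<lambda>x y. of_int (kmat n h x y)) = card (?A (Suc h))"
    by (intro sr_over.betti_koszul[OF Q, of of_int]) (auto simp: uminus_rat_ring)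
  obtain B where B: "B \<subseteq> ?A (Suc (Suc h))" "indep_mod (int l) (?A (Suc h)) (kmat n (Suc h)) B"
    "field.mat_rank (residue_ring (int l)) (?A (Suc h)) (?A (Suc (Suc h))) (\<lambda>x y. kmat n (Suc h) x y mod int l) \<le> card B"
    using mat_rank_residue_le[OF l fin fin] by blast
  obtain B' where B': "B' \<subseteq> ?A (Suc h)" "indep_mod (int l) (?A h) (kmat n h) B'"
    "field.mat_rank (residue_ring (int l)) (?A h) (?A (Suc h)) (\<lambda>x y. kmat n h x y mod int l) \<le> card B'"
    using mat_rank_residue_le[OF l fin fin] by blast
  have "card B < field.mat_rank rat_ring (?A (Suc h)) (?A (Suc (Suc h))) (\<lambda>x y. of_int (kmat n (Suc h) x y))"
    by (rule mat_rank_rat_ge(2)[OF l fin fin B(1,2) ly no])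
  moreover have "card B' \<le> field.mat_rank rat_ring (?A h) (?A (Suc h)) (\<lambda>x y. of_int (kmat n h x y))"
    by (rule mat_rank_rat_ge(1)[OF l fin fin B'(1,2)])
  ultimately have "betti rat_ring n \<Delta> (Suc h) d < betti (residue_ring (int l)) n \<Delta> (Suc h) d"
    using bF bQ B(3) B'(3) by linarith
  then show ?thesis unfolding has_torsion_def by blast
qed

section \<open>Torsion from cocycles on a vertex set\<close>

text \<open>The integer analogue of \<open>koszul_map\<close>: one row of the matrix applied to a
  vector.\<close>

lemma sum_kmat:
  assumes s: "s \<in> subsets_of_card n i" and a: "(kidx n i s, m) \<in> kbasis n \<Delta> i d"
    and \<Delta>: "\<And>w. w \<in> \<Delta> \<Longrightarrow> w \<subseteq> {1..n}" "\<And>w w'. w \<in> \<Delta> \<Longrightarrow> w' \<subseteq> w \<Longrightarrow> w' \<in> \<Delta>"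
  shows "(\<Sum>c\<in>kbasis n \<Delta> (Suc i) d. kmat n i (kidx n i s, m) c * f c) =
    (\<Sum>y\<in>set_mset m - s. (- 1) ^ kpos y s * f (kidx n (Suc i) (insert y s), m - {#y#}))"
proof -
  let ?C = "kbasis n \<Delta> (Suc i) d" and ?h = "\<lambda>y. (kidx n (Suc i) (insert y s), m - {#y#})"
  have m: "int (size m) = d - int i" "set_mset m \<in> \<Delta>" using a by (auto simp: kbasis_def)
  note es = kenum_kidx[OF s]
  have ins: "insert y s \<in> subsets_of_card n (Suc i)" if "y \<in> set_mset m - s" for y
    using that \<Delta>(1)[OF m(2)] by (intro insert_subsets_of_card[OF s]) auto
  have hC: "?h y \<in> ?C" if y: "y \<in> set_mset m - s" for y
  proof -
    have "set_mset (m - {#y#}) \<in> \<Delta>" by (rule \<Delta>(2)[OF m(2)]) (auto dest: in_diffD)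
    moreover have "int (size (m - {#y#})) = d - int (Suc i)"
      using y m(1) by (simp add: size_Diff_singleton) (metis Suc_pred gr0I int_ops(4) of_nat_Suc add_diff_cancel_left' diff_diff_eq size_eq_0_iff_empty empty_iff set_mset_empty of_nat_diff One_nat_def Suc_leI)
    ultimately show ?thesis using kidx_less[OF ins[OF y]] by (simp add: kbasis_def)
  qed
  have finC: "finite ?C"
  proof -
    have "?C \<subseteq> (SIGMA b:{..<card (subsets_of_card n (Suc i))}. multisets_of_size {1..n} (nat (d - int (Suc i))))"
      using \<Delta>(1) by (auto simp: kbasis_def multisets_of_size_def)
    then show ?thesis by (rule finite_subset) auto
  qed
  have inj: "inj_on ?h (set_mset m - s)"
  proof (rule inj_onI)
    fix y z assume y: "y \<in> set_mset m - s" and z: "z \<in> set_mset m - s" and eq: "?h y = ?h z"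
    have "insert y s = kenum n (Suc i) (kidx n (Suc i) (insert y s))" by (rule kenum_kidx[OF ins[OF y], symmetric])
    also have "\<dots> = kenum n (Suc i) (kidx n (Suc i) (insert z s))" using eq by (simp only: prod.inject)
    also have "\<dots> = insert z s" by (rule kenum_kidx[OF ins[OF z]])
    finally have "y \<in> insert z s" by (metis insertI1)
    with y show "y = z" by simp
  qed
  have val: "kmat n i (kidx n i s, m) (?h y) = (- 1) ^ kpos y s" if y: "y \<in> set_mset m - s" for y
  proof -
    have "insert y s - s = {y}" using y by blast
    moreover have "m - (m - {#y#}) = {#y#}" using y by (intro diff_diff_submultiset) simp
    ultimately show ?thesis by (simp add: kmat_def Let_def es kenum_kidx[OF ins[OF y]] subset_insertI)
  qed
  have van: "kmat n i (kidx n i s, m) c = 0" if c: "c \<in> ?C" "c \<notin> ?h ` (set_mset m - s)" for c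
  proof (rule ccontr)
    assume nz: "kmat n i (kidx n i s, m) c \<noteq> 0"
    obtain b m' where bm: "c = (b, m')" by fastforce
    let ?t = "kenum n (Suc i) b"
    have b: "b < card (subsets_of_card n (Suc i))" using c bm by (auto simp: kbasis_def)
    have nz': "m' \<subseteq># m" "s \<subseteq> ?t" "m - m' = {#the_elem (?t - s)#}"
      using nz by (auto simp: kmat_def Let_def bm es split: if_splits)
    obtain y where y: "y \<in> {1..n}" "y \<notin> s" "?t = insert y s"
      using subset_subsets_of_card[OF s kenum_mem[OF b] nz'(2)] by blast
    have "?t - s = {y}" using y by blast
    then have my: "m - m' = {#y#}" using nz'(3) by simp
    have "m = m' + {#y#}" using nz'(1) my by (metis subset_mset.add_diff_inverse)
    then have "y \<in># m" "m' = m - {#y#}" by simp_all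
    moreover have "b = kidx n (Suc i) (insert y s)" using kidx_kenum[OF b] y by simp
    ultimately have "c = ?h y" "y \<in> set_mset m - s" using bm y by auto
    then show False using c(2) by blast
  qed
  have "(\<Sum>c\<in>?C. kmat n i (kidx n i s, m) c * f c) = (\<Sum>c\<in>?h ` (set_mset m - s). kmat n i (kidx n i s, m) c * f c)"
    using van hC by (intro sum.mono_neutral_right finC) auto
  also have "\<dots> = (\<Sum>y\<in>set_mset m - s. kmat n i (kidx n i s, m) (?h y) * f (?h y))"
    by (rule sum.reindex[OF inj, unfolded o_def])
  also have "\<dots> = (\<Sum>y\<in>set_mset m - s. (- 1) ^ kpos y s * f (?h y))"
    by (rule sum.cong[OF refl]) (simp only: val)
  finally show ?thesis .
qed

text \<open>The basis element \<open>e\<^sub>t \<otimes> m\<close> of multidegree \<open>W\<close> has \<open>m\<close> supported on the face \<open>W - t\<close>. These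
  signs turn the Koszul differential into the simplicial coboundary.\<close>

definition ksign :: "nat set \<Rightarrow> nat set \<Rightarrow> int" where
  "ksign W t = (\<Prod>u\<in>t. (- 1) ^ kpos u W)"

lemma ksign_square: "ksign W t * ksign W t = 1"
proof -
  have "ksign W t * ksign W t = (\<Prod>u\<in>t. (- 1) ^ kpos u W * (- 1) ^ kpos u W)"
    unfolding ksign_def by (rule prod.distrib [symmetric])
  also have "\<dots> = 1" by (intro prod.neutral) (auto simp flip: power_add)
  finally show ?thesis .
qed

text \<open>With T the triangle, the position of y in W is its position in W - T plus its position
  in T. Dropping y from T changes \<open>ksign\<close> by the sign of the former position; combined
  with the Koszul sign of y in W - T this leaves the sign of y in T, which is the alternating sign
  of the coboundary.\<close>

lemma ksign_coboundary:
  assumes W: "finite W" "{p, q, r} \<subseteq> W" and ord: "p < q" "q < r"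
  shows "(\<Sum>y\<in>{p, q, r}. (- 1) ^ kpos y (W - {p, q, r}) * (ksign W ({p, q, r} - {y}) * g ({p, q, r} - {y}))) =
    ksign W {p, q, r} * (g {q, r} - g {p, r} + (g {p, q} :: int))"
proof -
  let ?T = "{p, q, r}"
  have kp: "kpos y W = kpos y (W - ?T) + kpos y ?T" for y
  proof -
    have "{t \<in> W. t < y} = {t \<in> W - ?T. t < y} \<union> {t \<in> ?T. t < y}" using W by auto
    moreover have "card ({t \<in> W - ?T. t < y} \<union> {t \<in> ?T. t < y}) = card {t \<in> W - ?T. t < y} + card {t \<in> ?T. t < y}"
      using W by (intro card_Un_disjoint) auto
    ultimately show ?thesis by (simp add: kpos_def)
  qed
  have T: "{t \<in> ?T. t < p} = {}" "{t \<in> ?T. t < q} = {p}" "{t \<in> ?T. t < r} = {p, q}" using ord by auto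
  have kT: "kpos p ?T = 0" "kpos q ?T = 1" "kpos r ?T = 2" unfolding kpos_def T using ord by simp_all
  define P where "P = ((- 1) ^ kpos p (W - ?T) :: int)"
  define Q where "Q = ((- 1) ^ kpos q (W - ?T) :: int)"
  define R where "R = ((- 1) ^ kpos r (W - ?T) :: int)"
  have sq: "P * P = 1" "Q * Q = 1" "R * R = 1" by (simp_all add: P_def Q_def R_def flip: power_add)
  have w: "(- 1 :: int) ^ kpos p W = P" "(- 1 :: int) ^ kpos q W = - Q" "(- 1 :: int) ^ kpos r W = R"
    unfolding kp kT by (simp_all add: P_def Q_def R_def power_add)
  have D: "?T - {p} = {q, r}" "?T - {q} = {p, r}" "?T - {r} = {p, q}" using ord by auto
  have k: "ksign W {q, r} = - Q * R" "ksign W {p, r} = P * R" "ksign W {p, q} = - P * Q" "ksign W ?T = - P * Q * R"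
    unfolding ksign_def using ord w by simp_all
  have "(\<Sum>y\<in>?T. (- 1) ^ kpos y (W - ?T) * (ksign W (?T - {y}) * g (?T - {y}))) =
      P * (ksign W {q, r} * g {q, r}) + Q * (ksign W {p, r} * g {p, r}) + R * (ksign W {p, q} * g {p, q})"
    using ord by (simp add: D P_def Q_def R_def)
  also have "\<dots> = ksign W ?T * (g {q, r} - g {p, r} + g {p, q})"
    unfolding k by (simp add: algebra_simps)
  finally show ?thesis .
qed

lemma card3_ordered:
  assumes "card (T :: nat set) = 3"
  obtains p q r where "T = {p, q, r}" "p < q" "q < r"
proof -
  obtain a b c where T: "T = {a, b, c}" and d: "a \<noteq> b" "b \<noteq> c" "a \<noteq> c" using assms by (auto simp: card_3_iff)
  consider "a < b" "b < c" | "a < c" "c < b" | "b < a" "a < c" | "b < c" "c < a" | "c < a" "a < b" | "c < b" "b < a"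
    using d by (metis linorder_neqE_nat)
  then show ?thesis
    by cases (use that T in \<open>blast, (metis insert_commute)+\<close>)
qed

text \<open>x is a 1-cochain on W whose coboundary is divisible by l on every triangle, so the
  quotient is a 2-cochain y with l * y a coboundary; the last assumption says that y is not one. In
  multidegree W a face t gives e_(W - t) times the monomial of t, in homological degree card W -
  card t. Hence triangles sit in degree h + 1, edges in degree h + 2, and the internal degree is
  card W = h + 4. Antisymmetry allows triangles to be written in any order.\<close>

lemma has_torsion_of_cocycle:
  fixes l :: nat and x :: "nat \<Rightarrow> nat \<Rightarrow> int"
  assumes l: "Factorial_Ring.prime l"
    and \<Delta>: "\<And>w. w \<in> \<Delta> \<Longrightarrow> w \<subseteq> {1..n}" "\<And>w w'. w \<in> \<Delta> \<Longrightarrow> w' \<subseteq> w \<Longrightarrow> w' \<in> \<Delta>"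
    and W: "W \<subseteq> {1..n}" "card W = h + 4"
    and anti: "\<And>u w. x u w = - x w u"
    and cyc: "\<And>p q r. {p, q, r} \<subseteq> W \<Longrightarrow> {p, q, r} \<in> \<Delta> \<Longrightarrow> p \<noteq> q \<Longrightarrow> q \<noteq> r \<Longrightarrow> p \<noteq> r \<Longrightarrow>
        int l dvd x p q + x q r + x r p"
    and no: "\<And>z. (\<And>u w. z u w = - z w u) \<Longrightarrow>
        (\<And>p q r. {p, q, r} \<subseteq> W \<Longrightarrow> {p, q, r} \<in> \<Delta> \<Longrightarrow> p \<noteq> q \<Longrightarrow> q \<noteq> r \<Longrightarrow> p \<noteq> r \<Longrightarrow>
           x p q + x q r + x r p = int l * (z p q + z q r + z r p)) \<Longrightarrow> False"
  shows "has_torsion l n \<Delta>"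
proof -
  let ?d = "int (h + 4)"
  let ?A = "kbasis n \<Delta> (Suc h) ?d" and ?C = "kbasis n \<Delta> (Suc (Suc h)) ?d"
  have finW: "finite W" using W(1) finite_subset by blast
  have l0: "int l \<noteq> 0" using prime_gt_0_nat[OF l] by simp
  define g where "g t = x (Min t) (Max t)" for t
  have g2: "g {u, w} = x u w" if "u < w" for u w using that by (simp add: g_def)
  \<comment> \<open>x transported to the multidegree W, with signs, and extended by zero to all
    other multidegrees.\<close>
  define f where "f c = (let s = kenum n (Suc (Suc h)) (fst c) in
     if s \<subseteq> W \<and> snd c = mset_set (W - s) then ksign W (W - s) * g (W - s) else 0)" for c
  have fin3: "finite t" if "t \<subseteq> W" for t using that finW finite_subset by blast
  have sub: "W - t \<in> subsets_of_card n k" if "t \<subseteq> W" "card t + k = h + 4" for t k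
    using that W card_Diff_subset[OF fin3[OF that(1)] that(1)] by (auto simp: subsets_of_card_def)
  have eval: "(\<Sum>c\<in>?C. kmat n (Suc h) (kidx n (Suc h) (W - {p, q, r}), mset_set {p, q, r}) c * f' c) =
      ksign W {p, q, r} * (g' {q, r} - g' {p, r} + g' {p, q})"
    if T: "{p, q, r} \<subseteq> W" "{p, q, r} \<in> \<Delta>" "p < q" "q < r"
      and f': "\<And>t. t \<subseteq> {p, q, r} \<Longrightarrow> card t = 2 \<Longrightarrow> f' (kidx n (Suc (Suc h)) (W - t), mset_set t) = ksign W t * g' t"
    for p q r f' g'
  proof -
    let ?T = "{p, q, r}"
    have c3: "card ?T = 3" using T by simp
    have s: "W - ?T \<in> subsets_of_card n (Suc h)" using T c3 by (intro sub) auto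
    have a: "(kidx n (Suc h) (W - ?T), mset_set ?T) \<in> ?A"
    proof -
      have "size (mset_set ?T) = 3" using c3 by (simp only: size_mset_set)
      then show ?thesis using kidx_less[OF s] T(2) by (simp add: kbasis_def)
    qed
    have set: "set_mset (mset_set ?T) - (W - ?T) = ?T" using T by auto
    have "(\<Sum>c\<in>?C. kmat n (Suc h) (kidx n (Suc h) (W - ?T), mset_set ?T) c * f' c) =
       (\<Sum>y\<in>set_mset (mset_set ?T) - (W - ?T).
          (- 1) ^ kpos y (W - ?T) * f' (kidx n (Suc (Suc h)) (insert y (W - ?T)), mset_set ?T - {#y#}))"
      by (rule sum_kmat[OF s a \<Delta>])
    also have "\<dots> = (\<Sum>y\<in>?T. (- 1) ^ kpos y (W - ?T) * f' (kidx n (Suc (Suc h)) (insert y (W - ?T)), mset_set ?T - {#y#}))"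
      by (simp only: set)
    also have "\<dots> = (\<Sum>y\<in>?T. (- 1) ^ kpos y (W - ?T) * (ksign W (?T - {y}) * g' (?T - {y})))"
    proof (rule sum.cong[OF refl])
      fix y assume y: "y \<in> ?T"
      have 1: "insert y (W - ?T) = W - (?T - {y})" using y T by blast
      have 2: "mset_set ?T - {#y#} = mset_set (?T - {y})"
        using y mset_set.remove[of ?T y] by simp
      have "card (?T - {y}) = 2" using y c3 by (simp add: card_Diff_singleton)
      then show "(- 1) ^ kpos y (W - ?T) * f' (kidx n (Suc (Suc h)) (insert y (W - ?T)), mset_set ?T - {#y#}) =
         (- 1) ^ kpos y (W - ?T) * (ksign W (?T - {y}) * g' (?T - {y}))"
        unfolding 1 2 by (subst f') auto
    qed
    also have "\<dots> = ksign W ?T * (g' {q, r} - g' {p, r} + g' {p, q})"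
      by (rule ksign_coboundary[OF finW T(1,3,4)])
    finally show ?thesis .
  qed
  have fval: "f (kidx n (Suc (Suc h)) (W - t), mset_set t) = ksign W t * g t"
    if "t \<subseteq> W" "card t = 2" for t
  proof -
    have "W - t \<in> subsets_of_card n (Suc (Suc h))" using that by (intro sub) auto
    moreover have "W - (W - t) = t" using that by blast
    ultimately show ?thesis by (simp add: f_def kenum_kidx)
  qed
  have evalf: "(\<Sum>c\<in>?C. kmat n (Suc h) (kidx n (Suc h) (W - {p, q, r}), mset_set {p, q, r}) c * f c) =
      ksign W {p, q, r} * (x p q + x q r + x r p)"
    if T: "{p, q, r} \<subseteq> W" "{p, q, r} \<in> \<Delta>" "p < q" "q < r" for p q r
  proof -
    have "(\<Sum>c\<in>?C. kmat n (Suc h) (kidx n (Suc h) (W - {p, q, r}), mset_set {p, q, r}) c * f c) =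
      ksign W {p, q, r} * (g {q, r} - g {p, r} + g {p, q})"
      by (rule eval[OF T]) (use T fval in blast)
    then show ?thesis using T anti[of r p] by (simp add: g2)
  qed
  have dvd: "int l dvd (\<Sum>c\<in>?C. kmat n (Suc h) a c * f c)" if a: "a \<in> ?A" for a
  proof -
    obtain b m where bm: "a = (b, m)" "b < card (subsets_of_card n (Suc h))" "size m = 3" "set_mset m \<in> \<Delta>"
      using a by (auto simp: kbasis_def)
    let ?s = "kenum n (Suc h) b"
    note s = kenum_mem[OF bm(2)]
    have b: "b = kidx n (Suc h) ?s" using kidx_kenum[OF bm(2)] by simp
    have a': "(kidx n (Suc h) ?s, m) \<in> ?A" using a bm(1) b by simp
    show ?thesis
    proof (cases "?s \<subseteq> W \<and> m = mset_set (W - ?s)")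
      case True
      let ?T = "W - ?s"
      have "card ?T = 3" using True bm(3) by (simp add: size_mset_set)
      then obtain p q r where T: "?T = {p, q, r}" "p < q" "q < r" by (rule card3_ordered)
      have s': "?s = W - {p, q, r}" using True T(1) by blast
      have "{p, q, r} \<in> \<Delta>" using bm(4) True T(1) finW by simp
      moreover have "{p, q, r} \<subseteq> W" using T(1) by blast
      ultimately have "(\<Sum>c\<in>?C. kmat n (Suc h) a c * f c) = ksign W {p, q, r} * (x p q + x q r + x r p)"
        using evalf[of p q r] T True b s' unfolding bm(1) by metis
      then show ?thesis using cyc[of p q r] \<open>{p, q, r} \<in> \<Delta>\<close> \<open>{p, q, r} \<subseteq> W\<close> T by simp
    next
      case False
      \<comment> \<open>A row outside the multidegree W: the differential preserves multidegrees, so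
        no column in the support of f meets this row.\<close>
      have "f (kidx n (Suc (Suc h)) (insert y ?s), m - {#y#}) = 0" if y: "y \<in> set_mset m - ?s" for y
      proof (rule ccontr)
        assume nz: "f (kidx n (Suc (Suc h)) (insert y ?s), m - {#y#}) \<noteq> 0"
        have "y \<in> {1..n}" using y \<Delta>(1)[OF bm(4)] by auto
        then have "insert y ?s \<in> subsets_of_card n (Suc (Suc h))" using y by (intro insert_subsets_of_card[OF s]) auto
        then have e: "kenum n (Suc (Suc h)) (kidx n (Suc (Suc h)) (insert y ?s)) = insert y ?s" by (rule kenum_kidx)
        have *: "insert y ?s \<subseteq> W" "m - {#y#} = mset_set (W - insert y ?s)"
          using nz by (auto simp: f_def e Let_def split: if_splits)
        have "m = add_mset y (mset_set (W - insert y ?s))" using *(2) y by (metis DiffD1 insert_DiffM)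
        also have "\<dots> = mset_set (insert y (W - insert y ?s))" using finW by simp
        also have "insert y (W - insert y ?s) = W - ?s" using * y by blast
        finally show False using False * by blast
      qed
      then have "(\<Sum>y\<in>set_mset m - ?s. (- 1) ^ kpos y ?s * f (kidx n (Suc (Suc h)) (insert y ?s), m - {#y#})) = 0"
        by (intro sum.neutral) simp
      moreover have "(\<Sum>c\<in>?C. kmat n (Suc h) (kidx n (Suc h) ?s, m) c * f c) =
          (\<Sum>y\<in>set_mset m - ?s. (- 1) ^ kpos y ?s * f (kidx n (Suc (Suc h)) (insert y ?s), m - {#y#}))"
        by (rule sum_kmat[OF s a' \<Delta>])
      ultimately have "(\<Sum>c\<in>?C. kmat n (Suc h) a c * f c) = 0" using b by (simp only: bm(1))
      then show ?thesis by simp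
    qed
  qed
  define y where "y a = (\<Sum>c\<in>?C. kmat n (Suc h) a c * f c) div int l" for a
  have ly: "int l * y a = (\<Sum>c\<in>?C. kmat n (Suc h) a c * f c)" if "a \<in> ?A" for a
    using dvd[OF that] by (simp add: y_def)
  show ?thesis
  proof (rule has_torsionI[OF l \<Delta> ly])
    show "\<not> (\<exists>z. \<forall>a\<in>?A. y a = (\<Sum>c\<in>?C. kmat n (Suc h) a c * z c))"
    proof
      assume "\<exists>z. \<forall>a\<in>?A. y a = (\<Sum>c\<in>?C. kmat n (Suc h) a c * z c)"
      then obtain z' where z': "\<And>a. a \<in> ?A \<Longrightarrow> y a = (\<Sum>c\<in>?C. kmat n (Suc h) a c * z' c)" by blast
      \<comment> \<open>Only the part of a primitive in multidegree W matters. Its signs are undone,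
        and it becomes an antisymmetric cochain z.\<close>
      define g' where "g' t = ksign W t * z' (kidx n (Suc (Suc h)) (W - t), mset_set t)" for t
      define z where "z u w = (if u < w then g' {u, w} else if w < u then - g' {u, w} else 0)" for u w
      have zanti: "z u w = - z w u" for u w by (auto simp: z_def insert_commute)
      have ordered: "x p q + x q r + x r p = int l * (z p q + z q r + z r p)"
        if T: "{p, q, r} \<subseteq> W" "{p, q, r} \<in> \<Delta>" "p < q" "q < r" for p q r
      proof -
        let ?a = "(kidx n (Suc h) (W - {p, q, r}), mset_set {p, q, r})"
        have c3: "card {p, q, r} = 3" using T by simp
        have "W - {p, q, r} \<in> subsets_of_card n (Suc h)" using T c3 by (intro sub) auto
        moreover have "size (mset_set {p, q, r}) = 3" using c3 by (simp only: size_mset_set)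
        ultimately have a: "?a \<in> ?A" using kidx_less T(2) by (simp add: kbasis_def)
        have "(\<Sum>c\<in>?C. kmat n (Suc h) ?a c * z' c) = ksign W {p, q, r} * (g' {q, r} - g' {p, r} + g' {p, q})"
          by (rule eval[OF T]) (simp add: g'_def ksign_square flip: mult.assoc)
        moreover have "ksign W {p, q, r} * (x p q + x q r + x r p) = int l * (\<Sum>c\<in>?C. kmat n (Suc h) ?a c * z' c)"
          using ly[OF a] z'[OF a] evalf[OF T] by simp
        ultimately have "ksign W {p, q, r} * (x p q + x q r + x r p) =
            ksign W {p, q, r} * (int l * (g' {q, r} - g' {p, r} + g' {p, q}))"
          by (simp add: mult.left_commute)
        moreover have "ksign W {p, q, r} \<noteq> 0" using ksign_square[of W "{p, q, r}"] by auto
        ultimately have "x p q + x q r + x r p = int l * (g' {q, r} - g' {p, r} + g' {p, q})" by simp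
        then show ?thesis using T by (simp add: z_def insert_commute)
      qed
      show False
      proof (rule no[OF zanti])
        fix p q r assume T: "{p, q, r} \<subseteq> W" "{p, q, r} \<in> \<Delta>" and d: "p \<noteq> q" "q \<noteq> r" "p \<noteq> r"
        have ins: "{p, r, q} = {p, q, r}" "{q, p, r} = {p, q, r}" "{q, r, p} = {p, q, r}" "{r, p, q} = {p, q, r}" "{r, q, p} = {p, q, r}"
          by auto
        note an = anti[of p q] anti[of q r] anti[of r p] zanti[of p q] zanti[of q r] zanti[of r p]
        consider "p < q" "q < r" | "p < r" "r < q" | "q < p" "p < r" | "q < r" "r < p" | "r < p" "p < q" | "r < q" "q < p"
          using d by (metis linorder_neqE_nat)
        then show "x p q + x q r + x r p = int l * (z p q + z q r + z r p)"
        proof cases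
          case 1 then show ?thesis using ordered[of p q r] T by simp
        next
          case 2 then show ?thesis using ordered[of p r q] T an unfolding ins by (simp add: algebra_simps)
        next
          case 3 then show ?thesis using ordered[of q p r] T an unfolding ins by (simp add: algebra_simps)
        next
          case 4 then show ?thesis using ordered[of q r p] T an unfolding ins by (simp add: algebra_simps)
        next
          case 5 then show ?thesis using ordered[of r p q] T an unfolding ins by (simp add: algebra_simps)
        next
          case 6 then show ?thesis using ordered[of r q p] T an unfolding ins by (simp add: algebra_simps)
        qed
      qed
    qed
  qed
qed

section \<open>A flag complex with torsion in its cohomology\<close>

text \<open>A flag Moore space: the apex is the cone point over a ring of length \<open>4 * l\<close>, which an annulus of
  triangles wraps \<open>l\<close> times around a circle of length 4. So the second cohomology is cyclic of
  order \<open>l\<close>. The numbering puts the ring last, so that a vertex has at most two earlier neighbours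
  on the circle and two on the ring, besides the apex.\<close>

datatype moore_vertex = Apex | Circ nat | Ring nat

fun moore_adj :: "nat \<Rightarrow> moore_vertex \<Rightarrow> moore_vertex \<Rightarrow> bool" where
  "moore_adj l Apex Apex = False"
| "moore_adj l Apex (Circ j) = False"
| "moore_adj l (Circ j) Apex = False"
| "moore_adj l Apex (Ring i) = True"
| "moore_adj l (Ring i) Apex = True"
| "moore_adj l (Circ j) (Circ k) = (k = (j + 1) mod 4 \<or> j = (k + 1) mod 4)"
| "moore_adj l (Ring i) (Circ j) = (j = i mod 4 \<or> j = (i + 1) mod 4)"
| "moore_adj l (Circ j) (Ring i) = (j = i mod 4 \<or> j = (i + 1) mod 4)"
| "moore_adj l (Ring i) (Ring k) = (k = (i + 1) mod (4 * l) \<or> i = (k + 1) mod (4 * l))"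

fun moore_vertex_of :: "nat \<Rightarrow> moore_vertex" where
  "moore_vertex_of k = (if k = 0 then Apex else if k < 5 then Circ (k - 1) else Ring (k - 5))"

definition moore_graph :: "nat \<Rightarrow> nat \<Rightarrow> nat \<Rightarrow> bool" where
  "moore_graph l k k' = moore_adj l (moore_vertex_of k) (moore_vertex_of k')"

fun moore_index :: "moore_vertex \<Rightarrow> nat" where
  "moore_index Apex = 0" | "moore_index (Circ j) = j + 1" | "moore_index (Ring i) = i + 5"

fun moore_valid :: "nat \<Rightarrow> moore_vertex \<Rightarrow> bool" where
  "moore_valid l Apex = True" | "moore_valid l (Circ j) = (j < 4)" | "moore_valid l (Ring i) = (i < 4 * l)"

lemma moore_vertex_of_index: "moore_valid l v \<Longrightarrow> moore_vertex_of (moore_index v) = v"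
  by (cases v) auto

lemma moore_index_less: "moore_valid l v \<Longrightarrow> moore_index v < 4 * l + 5"
  by (cases v) auto

lemma moore_index_vertex_of: "moore_index (moore_vertex_of k) = k"
  by auto

lemma moore_valid_vertex_of: "k < 4 * l + 5 \<Longrightarrow> moore_valid l (moore_vertex_of k)"
  by auto

lemma moore_adj_sym: "moore_adj l v w = moore_adj l w v"
  by (cases "(l, v, w)" rule: moore_adj.cases) auto

lemma moore_graph_back_degree: "card {k'. k' < k \<and> moore_graph l k' k} \<le> 5"
proof (cases "k < 5")
  case True
  have "{k'. k' < k \<and> moore_graph l k' k} \<subseteq> {..<k}" by auto
  then have "card {k'. k' < k \<and> moore_graph l k' k} \<le> card {..<k}" by (rule card_mono[rotated]) simp
  then show ?thesis using True by simp
next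
  case False
  let ?i = "k - 5"
  \<comment> \<open>The apex, the two circle neighbours, the predecessor on the ring, and the
    successor, which comes earlier only where the ring closes up.\<close>
  let ?xs = "[0, ?i mod 4 + 1, (?i + 1) mod 4 + 1, k - 1, (?i + 1) mod (4 * l) + 5]"
  have "k' \<in> set ?xs" if k': "k' < k" "moore_graph l k' k" for k'
  proof -
    have vk: "moore_vertex_of k = Ring ?i" using False by simp
    consider "k' = 0" | "k' \<noteq> 0" "k' < 5" | "k' \<ge> 5" by linarith
    then show ?thesis
    proof cases
      case 2
      then have "moore_adj l (Circ (k' - 1)) (Ring ?i)" using k'(2) unfolding moore_graph_def vk by simp
      then have "k' - 1 = ?i mod 4 \<or> k' - 1 = (?i + 1) mod 4" by simp
      then have "k' = ?i mod 4 + 1 \<or> k' = (?i + 1) mod 4 + 1" using 2 by linarith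
      then show ?thesis by auto
    next
      case 3
      then have "moore_adj l (Ring (k' - 5)) (Ring ?i)" using k'(2) unfolding moore_graph_def vk by simp
      then have "?i = (k' - 5 + 1) mod (4 * l) \<or> k' - 5 = (?i + 1) mod (4 * l)" by simp
      then have "k' = k - 1 \<or> k' - 5 = (?i + 1) mod (4 * l)"
      proof
        assume "?i = (k' - 5 + 1) mod (4 * l)"
        then have "?i \<le> k' - 5 + 1" by (metis mod_less_eq_dividend)
        then show ?thesis using 3 k'(1) by linarith
      qed simp
      then show ?thesis using 3 by auto
    qed simp
  qed
  then have "{k'. k' < k \<and> moore_graph l k' k} \<subseteq> set ?xs" by blast
  then have "card {k'. k' < k \<and> moore_graph l k' k} \<le> card (set ?xs)" by (rule card_mono[rotated]) simp
  also have "\<dots> \<le> length ?xs" by (rule card_length)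
  finally show ?thesis by simp
qed

text \<open>A 1-cochain whose coboundary is, up to orientation, l on the one triangle where the ring
  closes up, and 0 on all others. An edge between ring and circle counts the turns completed around
  the circle, and passing from \<open>Circ 3\<close> to \<open>Circ 0\<close> completes a turn.
  Around the 4-cycle it sums to 1.\<close>

fun moore_cochain :: "moore_vertex \<Rightarrow> moore_vertex \<Rightarrow> int" where
  "moore_cochain (Ring i) (Circ j) = (if j = i mod 4 then int (i div 4) else int ((i + 1) div 4))"
| "moore_cochain (Circ j) (Ring i) = - (if j = i mod 4 then int (i div 4) else int ((i + 1) div 4))"
| "moore_cochain (Circ j) (Circ k) = (if j = 3 \<and> k = 0 then 1 else if j = 0 \<and> k = 3 then - 1 else 0)"
| "moore_cochain _ _ = 0"

lemma moore_cochain_anti: "moore_cochain v w = - moore_cochain w v"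
  by (cases "(v, w)" rule: moore_cochain.cases) auto

lemma Suc_mod_4:
  fixes i :: nat
  shows "(i + 1) mod 4 = (if i mod 4 = 3 then 0 else i mod 4 + 1)"
  by presburger

lemma Suc_mod_cases:
  fixes i N :: nat
  assumes "i < N"
  shows "(i + 1) mod N = (if i + 1 = N then 0 else i + 1)"
  using assms by auto

text \<open>Cycles of length at least 4 stay unfilled in a clique complex. It applies to the circle,
  of length 4, and to the ring, of length 4 * l.\<close>

lemma ring_no_triangle:
  fixes N :: nat
  assumes N: "N \<ge> 4" and "i < N" "j < N" "k < N" and 1: "j = (i + 1) mod N \<or> i = (j + 1) mod N"
    and 2: "k = (j + 1) mod N \<or> j = (k + 1) mod N" and 3: "k = (i + 1) mod N \<or> i = (k + 1) mod N"
  shows False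
  using 1 2 3 N unfolding Suc_mod_cases[OF assms(2)] Suc_mod_cases[OF assms(3)] Suc_mod_cases[OF assms(4)]
  by (auto split: if_splits)

text \<open>The turn counts at the two circle neighbours of a ring vertex differ only across the
  edge from \<open>Circ 3\<close> to \<open>Circ 0\<close>, whose value makes up for it.\<close>

lemma ring_circ_circ:
  assumes "j < (4::nat)" "k < 4" "j = i mod 4 \<or> j = (i + 1) mod 4" "k = i mod 4 \<or> k = (i + 1) mod 4" "j \<noteq> k"
  shows "moore_cochain (Ring i) (Circ j) + moore_cochain (Circ j) (Circ k) + moore_cochain (Circ k) (Ring i) = 0"
proof -
  have d: "Suc i div 4 = (if i mod 4 = 3 then Suc (i div 4) else i div 4)" by presburger
  have "i mod 4 < 4" by simp
  then show ?thesis using assms unfolding Suc_mod_4 by (auto simp: d split: if_splits)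
qed

text \<open>Consecutive ring vertices share only the circle vertex (i + 1) mod 4. Their turn counts
  there agree, except where the ring closes up: there they are l and 0.\<close>

lemma ring_ring_circ:
  assumes l: "l > 0" and "i < 4 * l" "k < 4 * l" and j: "j = i mod 4 \<or> j = (i + 1) mod 4" "j = k mod 4 \<or> j = (k + 1) mod 4"
    and k: "k = (i + 1) mod (4 * l)"
  shows "int l dvd moore_cochain (Ring i) (Circ j) + moore_cochain (Circ j) (Ring k)"
proof -
  have km: "k mod 4 = (i + 1) mod 4" unfolding k by (simp add: mod_mod_cancel)
  have j': "j = (i + 1) mod 4" using j km by presburger
  have ne: "(i + 1) mod 4 \<noteq> i mod 4" by presburger
  have e: "moore_cochain (Ring i) (Circ j) = int ((i + 1) div 4)" using ne by (simp add: j')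
  have f: "moore_cochain (Circ j) (Ring k) = - int (k div 4)" by (simp add: j' km)
  show ?thesis
  proof (cases "i + 1 = 4 * l")
    case True
    then have "k = 0" using k by simp
    moreover have "(i + 1) div 4 = l" using True by simp
    ultimately show ?thesis unfolding e f by simp
  next
    case False
    then have "k = i + 1" using k assms(2) by simp
    then show ?thesis unfolding e f by simp
  qed
qed

text \<open>A triangle either contains the apex and two ring vertices, where the cochain is zero, or
  belongs to the annulus and has one or two ring vertices. The cases run through the positions of
  the vertices.\<close>

lemma moore_cochain_cocycle:
  assumes l: "l > 0" and val: "moore_valid l u" "moore_valid l v" "moore_valid l w"
    and adj: "moore_adj l u v" "moore_adj l v w" "moore_adj l w u" and d: "u \<noteq> v" "v \<noteq> w" "w \<noteq> u"
  shows "int l dvd moore_cochain u v + moore_cochain v w + moore_cochain w u"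
proof -
  have N: "4 * l \<ge> 4" using l by simp
  have rrc: "int l dvd moore_cochain (Ring i) (Circ j) + moore_cochain (Circ j) (Ring k)"
    if "i < 4 * l" "k < 4 * l" "moore_adj l (Ring i) (Circ j)" "moore_adj l (Ring k) (Circ j)" "moore_adj l (Ring i) (Ring k)" for i j k
  proof -
    have "k = (i + 1) mod (4 * l) \<or> i = (k + 1) mod (4 * l)" using that(5) by simp
    then show ?thesis
    proof
      assume "k = (i + 1) mod (4 * l)"
      then show ?thesis using ring_ring_circ[OF l that(1,2), of j] that by simp
    next
      assume "i = (k + 1) mod (4 * l)"
      then have "int l dvd moore_cochain (Ring k) (Circ j) + moore_cochain (Circ j) (Ring i)"
        using ring_ring_circ[OF l that(2,1), of j] that by simp
      moreover have "moore_cochain (Ring i) (Circ j) + moore_cochain (Circ j) (Ring k) =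
         - (moore_cochain (Ring k) (Circ j) + moore_cochain (Circ j) (Ring i))"
        using moore_cochain_anti[of "Ring i" "Circ j"] moore_cochain_anti[of "Ring k" "Circ j"] by simp
      ultimately show ?thesis by (metis dvd_minus_iff)
    qed
  qed
  have rcc: "moore_cochain (Ring i) (Circ j) + moore_cochain (Circ j) (Circ k) + moore_cochain (Circ k) (Ring i) = 0"
    if "j < 4" "k < 4" "moore_adj l (Ring i) (Circ j)" "moore_adj l (Ring i) (Circ k)" "Circ j \<noteq> Circ k" for i j k
    using ring_circ_circ[of j k i] that by simp
  consider i j k where "u = Ring i" "v = Ring j" "w = Ring k" | i j k where "u = Circ i" "v = Circ j" "w = Circ k"
    | i j k where "u = Ring i" "v = Circ j" "w = Circ k" | i j k where "u = Circ k" "v = Ring i" "w = Circ j"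
    | i j k where "u = Circ j" "v = Circ k" "w = Ring i"
    | i j k where "u = Ring i" "v = Circ j" "w = Ring k" | i j k where "u = Ring k" "v = Ring i" "w = Circ j"
    | i j k where "u = Circ j" "v = Ring k" "w = Ring i"
    | "u = Apex" | "v = Apex" | "w = Apex"
    by (metis moore_vertex.exhaust)
  then show ?thesis
  proof cases
    case 1
    then have False using ring_no_triangle[OF N, of i j k] val adj by auto
    then show ?thesis ..
  next
    case 2
    then have False using ring_no_triangle[of 4 i j k] val adj by auto
    then show ?thesis ..
  next
    case 3
    then show ?thesis using rcc[of j k i] val adj d by simp
  next
    case 4
    then show ?thesis using rcc[of j k i] val adj d by (simp add: add_ac del: moore_cochain.simps)
  next
    case 5
    then show ?thesis using rcc[of j k i] val adj d by (simp add: add_ac del: moore_cochain.simps)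
  next
    case 6
    then show ?thesis using rrc[of i k j] val adj moore_adj_sym by (simp add: moore_adj_sym[of l "Ring k"])
  next
    case 7
    then show ?thesis using rrc[of i k j] val adj moore_adj_sym[of l "Ring k" "Ring i"] by (simp add: add_ac)
  next
    case 8
    then show ?thesis using rrc[of i k j] val adj moore_adj_sym[of l "Ring k" "Ring i"] by (simp add: add_ac)
  next
    case 9
    then show ?thesis using adj by (cases v; cases w) auto
  next
    case 10
    then show ?thesis using adj by (cases u; cases w) auto
  next
    case 11
    then show ?thesis using adj by (cases u; cases v) auto
  qed
qed

lemma sum_cyclic_shift:
  fixes f :: "nat \<Rightarrow> int"
  assumes "N > 0"
  shows "(\<Sum>i<N. f ((i + 1) mod N)) = (\<Sum>i<N. f i)"
proof -
  obtain M where N: "N = Suc M" using assms by (cases N) auto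
  have "(\<Sum>i<Suc M. f ((i + 1) mod Suc M)) = (\<Sum>i<M. f (Suc i)) + f 0"
    by simp
  also have "\<dots> = (\<Sum>i<Suc M. f i)" unfolding sum.lessThan_Suc_shift by (rule add.commute)
  finally show ?thesis by (simp add: N)
qed

lemma sum_mod_4: "(\<Sum>i<4 * l. f (i mod 4)) = int l * (f 0 + f 1 + f 2 + f (3::nat))"
proof (induction l)
  case (Suc l)
  have m: "(4 * l) mod 4 = 0" "(4 * l + 1) mod 4 = 1" "(4 * l + 2) mod 4 = 2" "(4 * l + 3) mod 4 = 3" by presburger+
  have "{..<4 * Suc l} = insert (4 * l + 3) (insert (4 * l + 2) (insert (4 * l + 1) (insert (4 * l) {..<4 * l})))" by auto
  then have "(\<Sum>i<4 * Suc l. f (i mod 4)) = f 3 + (f 2 + (f 1 + (f 0 + (\<Sum>i<4 * l. f (i mod 4)))))"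
    using m by simp
  then show ?case using Suc by (simp add: algebra_simps)
qed simp

text \<open>Every integral cocycle vanishes on the 4-cycle, since \<open>l\<close> times that cycle bounds.\<close>

lemma moore_cocycle_vanishes:
  fixes z :: "moore_vertex \<Rightarrow> moore_vertex \<Rightarrow> int"
  assumes l: "l > 0" and anti: "\<And>u v. z u v = - z v u"
    and cyc: "\<And>u v w. moore_valid l u \<Longrightarrow> moore_valid l v \<Longrightarrow> moore_valid l w \<Longrightarrow> moore_adj l u v \<Longrightarrow>
      moore_adj l v w \<Longrightarrow> moore_adj l w u \<Longrightarrow> u \<noteq> v \<Longrightarrow> v \<noteq> w \<Longrightarrow> w \<noteq> u \<Longrightarrow> z u v + z v w + z w u = 0"
  shows "z (Circ 0) (Circ 1) + z (Circ 1) (Circ 2) + z (Circ 2) (Circ 3) + z (Circ 3) (Circ 0) = 0"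
proof -
  let ?N = "4 * l"
  have N: "?N > 0" using l by simp
  let ?s = "\<lambda>i. (i + 1) mod ?N"
  have s: "?s i < ?N" for i using N by simp
  have ne: "?s i \<noteq> i" if i: "i < ?N" for i
  proof -
    have "i + 1 = ?N \<Longrightarrow> i \<noteq> 0" using l by arith
    then show ?thesis unfolding Suc_mod_cases[OF i] by auto
  qed
  have sm: "?s i mod 4 = (i + 1) mod 4" for i by (simp add: mod_mod_cancel)
  have ne4: "(i + 1) mod 4 \<noteq> i mod 4" for i :: nat by presburger
  \<comment> \<open>Cone triangles: along the ring z is the difference of a potential, so it sums to
    zero around the ring.\<close>
  have 1: "z (Ring i) (Ring (?s i)) = z Apex (Ring (?s i)) - z Apex (Ring i)" if i: "i < ?N" for i
  proof -
    have "z Apex (Ring i) + z (Ring i) (Ring (?s i)) + z (Ring (?s i)) Apex = 0"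
      using i s[of i] ne[OF i] by (intro cyc) auto
    then show ?thesis using anti[of "Ring (?s i)" Apex] by simp
  qed
  \<comment> \<open>Annulus triangles with a ring edge: the sum along the ring is expressed by edges
    between ring and circle.\<close>
  have 2: "z (Ring i) (Ring (?s i)) = z (Ring i) (Circ ((i + 1) mod 4)) - z (Ring (?s i)) (Circ (?s i mod 4))" if i: "i < ?N" for i
  proof -
    have "z (Ring i) (Ring (?s i)) + z (Ring (?s i)) (Circ (?s i mod 4)) + z (Circ (?s i mod 4)) (Ring i) = 0"
      using i s[of i] ne[OF i] sm[of i] by (intro cyc) auto
    then show ?thesis using anti[of "Circ (?s i mod 4)" "Ring i"] sm[of i] by simp
  qed
  \<comment> \<open>Annulus triangles with a circle edge: the same edges express the sum along the
    circle, each edge of which is met l times.\<close>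
  have 3: "z (Circ (i mod 4)) (Circ ((i + 1) mod 4)) = z (Ring i) (Circ ((i + 1) mod 4)) - z (Ring i) (Circ (i mod 4))" if i: "i < ?N" for i
  proof -
    have "z (Ring i) (Circ (i mod 4)) + z (Circ (i mod 4)) (Circ ((i + 1) mod 4)) + z (Circ ((i + 1) mod 4)) (Ring i) = 0"
      using i ne4[of i] by (intro cyc) (auto simp: mod_Suc_eq)
    then show ?thesis using anti[of "Circ ((i + 1) mod 4)" "Ring i"] by simp
  qed
  have "(\<Sum>i<?N. z (Ring i) (Ring (?s i))) = (\<Sum>i<?N. z Apex (Ring (?s i))) - (\<Sum>i<?N. z Apex (Ring i))"
    unfolding sum_subtractf [symmetric] by (rule sum.cong) (use 1 in auto)
  then have r0: "(\<Sum>i<?N. z (Ring i) (Ring (?s i))) = 0"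
    using sum_cyclic_shift[OF N, of "\<lambda>i. z Apex (Ring i)"] by simp
  have "(\<Sum>i<?N. z (Ring i) (Ring (?s i))) = (\<Sum>i<?N. z (Ring i) (Circ ((i + 1) mod 4))) - (\<Sum>i<?N. z (Ring (?s i)) (Circ (?s i mod 4)))"
    unfolding sum_subtractf [symmetric] by (rule sum.cong) (use 2 in auto)
  then have "(\<Sum>i<?N. z (Ring i) (Circ ((i + 1) mod 4))) = (\<Sum>i<?N. z (Ring i) (Circ (i mod 4)))"
    using r0 sum_cyclic_shift[OF N, of "\<lambda>i. z (Ring i) (Circ (i mod 4))"] by simp
  moreover have "(\<Sum>i<?N. z (Circ (i mod 4)) (Circ ((i + 1) mod 4))) =
     (\<Sum>i<?N. z (Ring i) (Circ ((i + 1) mod 4))) - (\<Sum>i<?N. z (Ring i) (Circ (i mod 4)))"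
    unfolding sum_subtractf [symmetric] by (rule sum.cong) (use 3 in auto)
  moreover have "(\<Sum>i<?N. z (Circ (i mod 4)) (Circ ((i + 1) mod 4))) =
     (\<Sum>i<?N. (\<lambda>j. z (Circ j) (Circ ((j + 1) mod 4))) (i mod 4))"
    by (intro sum.cong refl) (simp add: mod_Suc_eq)
  ultimately have "(\<Sum>i<?N. (\<lambda>j. z (Circ j) (Circ ((j + 1) mod 4))) (i mod 4)) = 0" by simp
  moreover have e: "(0 + 1) mod 4 = (1 :: nat)" "(1 + 1) mod 4 = (2 :: nat)" "(2 + 1) mod 4 = (3 :: nat)" "(3 + 1) mod 4 = (0 :: nat)"
    by simp_all
  ultimately have "int l * (z (Circ 0) (Circ 1) + z (Circ 1) (Circ 2) + z (Circ 2) (Circ 3) + z (Circ 3) (Circ 0)) = 0"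
    using sum_mod_4[of "\<lambda>j. z (Circ j) (Circ ((j + 1) mod 4))" l] by (simp only: e)
  then show ?thesis using l by simp
qed

section \<open>Torsion from an induced copy of the Moore graph\<close>

lemma clique_complex_vertices: "w \<in> clique_complex n E \<Longrightarrow> w \<subseteq> {1..n}"
  by (simp add: clique_complex_def)

lemma clique_complex_down: "w \<in> clique_complex n E \<Longrightarrow> w' \<subseteq> w \<Longrightarrow> w' \<in> clique_complex n E"
  unfolding clique_complex_def by blast

text \<open>As the copy is induced, the clique complex restricted to the image of \<psi> is exactly
  the flag Moore space, and the cochain on it is pulled back along the inverse of \<psi>.\<close>

lemma has_torsion_of_copy:
  assumes l: "Factorial_Ring.prime l" and inj: "inj_on \<psi> {..<4 * l + 5}" and im: "\<psi> ` {..<4 * l + 5} \<subseteq> {1..n}"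
    and copy: "\<And>k k'. k < k' \<Longrightarrow> k' < 4 * l + 5 \<Longrightarrow> {\<psi> k, \<psi> k'} \<in> E \<longleftrightarrow> moore_graph l k k'"
  shows "has_torsion l n (clique_complex n E)"
proof -
  have l0: "l > 0" and l2: "l \<ge> 2" using prime_gt_0_nat[OF l] prime_ge_2_nat[OF l] by auto
  let ?V = "{..<4 * l + 5}"
  define W where "W = \<psi> ` ?V"
  define dec where "dec p = moore_vertex_of (the_inv_into ?V \<psi> p)" for p
  define enc where "enc v = \<psi> (moore_index v)" for v
  have dec_enc: "dec (enc v) = v" if "moore_valid l v" for v
    unfolding dec_def enc_def using moore_index_less[OF that] moore_vertex_of_index[OF that]
    by (simp add: the_inv_into_f_f[OF inj] del: moore_vertex_of.simps)
  have decW: "moore_valid l (dec p)" "enc (dec p) = p" if pW: "p \<in> W" for p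
  proof -
    obtain k where k: "k < 4 * l + 5" "p = \<psi> k" using pW by (auto simp: W_def)
    then have "the_inv_into ?V \<psi> p = k" by (simp add: the_inv_into_f_f[OF inj])
    then show "moore_valid l (dec p)" "enc (dec p) = p"
      using k moore_valid_vertex_of[OF k(1)] moore_index_vertex_of[of k]
      by (simp_all add: dec_def enc_def del: moore_vertex_of.simps)
  qed
  have encW: "enc v \<in> W" if "moore_valid l v" for v
    using moore_index_less[OF that] by (simp add: enc_def W_def)
  have edge: "{p, q} \<in> E \<longleftrightarrow> moore_adj l (dec p) (dec q)" if pq: "p \<in> W" "q \<in> W" "p \<noteq> q" for p q
  proof -
    obtain k where k: "k < 4 * l + 5" "p = \<psi> k" using pq by (auto simp: W_def)
    obtain k' where k': "k' < 4 * l + 5" "q = \<psi> k'" using pq by (auto simp: W_def)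
    have d: "dec p = moore_vertex_of k" "dec q = moore_vertex_of k'"
      using k k' by (simp_all add: dec_def the_inv_into_f_f[OF inj] del: moore_vertex_of.simps)
    have "k \<noteq> k'" using pq(3) k(2) k'(2) by blast
    then have "k < k' \<or> k' < k" by arith
    then have "{\<psi> k, \<psi> k'} \<in> E \<longleftrightarrow> moore_adj l (moore_vertex_of k) (moore_vertex_of k')"
    proof
      assume "k < k'"
      from copy[OF this k'(1)] show ?thesis unfolding moore_graph_def .
    next
      assume "k' < k"
      from copy[OF this k(1)] show ?thesis
        unfolding moore_graph_def insert_commute[of "\<psi> k'"] moore_adj_sym[of l "moore_vertex_of k'"] .
    qed
    then show ?thesis unfolding d unfolding k(2) k'(2) .
  qed
  have triangle: "moore_adj l (dec p) (dec q)" if "{p, q, r} \<subseteq> W" "{p, q, r} \<in> clique_complex n E" "p \<noteq> q" for p q r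
    using that edge[of p q] by (auto simp: clique_complex_def)
  have decne: "dec p \<noteq> dec q" if "p \<in> W" "q \<in> W" "p \<noteq> q" for p q using that decW(2) by metis
  have Wn: "W \<subseteq> {1..n}" using im by (simp add: W_def)
  show ?thesis
  proof (rule has_torsion_of_cocycle[where W = W and h = "4 * l + 1" and x = "\<lambda>p q. moore_cochain (dec p) (dec q)", OF l])
    show "w \<subseteq> {1..n}" if "w \<in> clique_complex n E" for w using that by (rule clique_complex_vertices)
    show "w' \<in> clique_complex n E" if "w \<in> clique_complex n E" "w' \<subseteq> w" for w w' using that by (rule clique_complex_down)
    show "W \<subseteq> {1..n}" by (rule Wn)
    show "card W = 4 * l + 1 + 4" unfolding W_def using card_image[OF inj] by simp
    show "moore_cochain (dec u) (dec w) = - moore_cochain (dec w) (dec u)" for u w by (rule moore_cochain_anti)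
    fix p q r assume T: "{p, q, r} \<subseteq> W" "{p, q, r} \<in> clique_complex n E" and d: "p \<noteq> q" "q \<noteq> r" "p \<noteq> r"
    have T': "{q, r, p} \<subseteq> W" "{q, r, p} \<in> clique_complex n E" "{r, p, q} \<subseteq> W" "{r, p, q} \<in> clique_complex n E"
      using T by (simp_all add: insert_commute)
    show "int l dvd moore_cochain (dec p) (dec q) + moore_cochain (dec q) (dec r) + moore_cochain (dec r) (dec p)"
      using T d decW(1) decne triangle[OF T d(1)] triangle[OF T'(1,2) d(2)] triangle[OF T'(3,4) d(3)[symmetric]]
      by (intro moore_cochain_cocycle[OF l0]) auto
  next
    fix z :: "nat \<Rightarrow> nat \<Rightarrow> int"
    assume zanti: "\<And>u w. z u w = - z w u"
      and z: "\<And>p q r. {p, q, r} \<subseteq> W \<Longrightarrow> {p, q, r} \<in> clique_complex n E \<Longrightarrow> p \<noteq> q \<Longrightarrow> q \<noteq> r \<Longrightarrow> p \<noteq> r \<Longrightarrow>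
        moore_cochain (dec p) (dec q) + moore_cochain (dec q) (dec r) + moore_cochain (dec r) (dec p) =
        int l * (z p q + z q r + z r p)"
    \<comment> \<open>A primitive z makes y an integral cocycle, so y sums to 0 around the 4-cycle.
      The Moore cochain sums to 1 there, hence l divides 1.\<close>
    define y where "y u v = moore_cochain u v - int l * z (enc u) (enc v)" for u v
    have "y (Circ 0) (Circ 1) + y (Circ 1) (Circ 2) + y (Circ 2) (Circ 3) + y (Circ 3) (Circ 0) = 0"
    proof (rule moore_cocycle_vanishes[OF l0])
      show "y u v = - y v u" for u v
        using moore_cochain_anti[of u v] zanti[of "enc u" "enc v"] by (simp add: y_def)
      fix u v w
      assume val: "moore_valid l u" "moore_valid l v" "moore_valid l w"
        and adj: "moore_adj l u v" "moore_adj l v w" "moore_adj l w u" and d: "u \<noteq> v" "v \<noteq> w" "w \<noteq> u"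
      have ne: "enc u \<noteq> enc v" "enc v \<noteq> enc w" "enc u \<noteq> enc w" using val d dec_enc by metis+
      have sub: "{enc u, enc v, enc w} \<subseteq> W" using val encW by auto
      have "{enc u, enc v} \<in> E" "{enc v, enc w} \<in> E" "{enc w, enc u} \<in> E"
        using edge[OF encW[OF val(1)] encW[OF val(2)] ne(1)] edge[OF encW[OF val(2)] encW[OF val(3)] ne(2)]
          edge[OF encW[OF val(3)] encW[OF val(1)] ne(3)[symmetric]] adj val by (simp_all add: dec_enc)
      then have "{enc u, enc v, enc w} \<in> clique_complex n E"
        using sub Wn by (auto simp: clique_complex_def insert_commute)
      from z[OF sub this ne] show "y u v + y v w + y w u = 0"
        by (simp add: y_def dec_enc val algebra_simps)
    qed
    then have "1 = int l * (z (enc (Circ 0)) (enc (Circ 1)) + z (enc (Circ 1)) (enc (Circ 2)) +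
        z (enc (Circ 2)) (enc (Circ 3)) + z (enc (Circ 3)) (enc (Circ 0)))"
      by (simp add: y_def algebra_simps)
    then have "int l dvd 1" by (metis dvd_triv_left)
    then show False using l2 by simp
  qed
qed

section \<open>Induced subgraphs of the random graph\<close>

lemma pair_pmf_prob_le:
  assumes c: "0 \<le> c" and R: "\<And>f. measure_pmf.prob N {g. R f g} \<le> c"
  shows "measure_pmf.prob (pair_pmf M N) {(f, g). R f g} \<le> c"
proof -
  have R': "emeasure N {g. R f g} \<le> ennreal c" for f
    using R[of f] c by (simp add: measure_pmf.emeasure_eq_measure)
  have "pair_pmf M N = bind_pmf M (\<lambda>f. map_pmf (Pair f) N)"
    by (simp add: pair_pmf_def map_pmf_def)
  then have "emeasure (pair_pmf M N) {(f, g). R f g} = (\<integral>\<^sup>+f. emeasure N {g. R f g} \<partial>M)"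
    by (simp add: vimage_def)
  also have "\<dots> \<le> (\<integral>\<^sup>+f. ennreal c \<partial>M)" by (intro nn_integral_mono R')
  also have "\<dots> = ennreal c" by simp
  finally show ?thesis using c by (simp add: measure_pmf.emeasure_eq_measure)
qed

lemma pair_pmf_prob_times:
  "measure_pmf.prob (pair_pmf M N) {(f, g). P f \<and> Q g} =
     measure_pmf.prob M {f. P f} * measure_pmf.prob N {g. Q g}"
proof -
  have "measure_pmf.prob (pair_pmf M N) {(f, g). P f \<and> Q g} =
      pmf (map_pmf (\<lambda>(f, g). (P f, Q g)) (pair_pmf M N)) (True, True)"
    unfolding pmf_map by (rule arg_cong[where f = "measure_pmf.prob _"]) auto
  also have "\<dots> = pmf (map_pmf P M) True * pmf (map_pmf Q N) True"
    unfolding map_pair by (rule pmf_pair)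
  finally show ?thesis by (simp add: pmf_map vimage_def)
qed

text \<open>The product distribution is split into the coordinates in A, which decide P, and the
  remaining ones, which decide Q.\<close>

lemma Pi_pmf_prob_conj:
  assumes fin: "finite B" and A: "A \<subseteq> B"
    and P: "\<And>g g'. (\<And>x. x \<in> A \<Longrightarrow> g x = g' x) \<Longrightarrow> P g = P g'"
    and Q: "\<And>g g'. (\<And>x. x \<in> B - A \<Longrightarrow> g x = g' x) \<Longrightarrow> Q g = Q g'"
  shows "measure_pmf.prob (Pi_pmf B dflt p) {g. P g \<and> Q g} =
    measure_pmf.prob (Pi_pmf B dflt p) {g. P g} * measure_pmf.prob (Pi_pmf B dflt p) {g. Q g}"
proof -
  let ?M = "Pi_pmf A dflt p" and ?N = "Pi_pmf (B - A) dflt p"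
  have split: "Pi_pmf B dflt p = map_pmf (\<lambda>(f, g) x. if x \<in> A then f x else g x) (pair_pmf ?M ?N)"
    using Pi_pmf_union[of A "B - A" dflt p] fin A finite_subset[OF A fin] by (simp add: Un_absorb1)
  have P': "P (\<lambda>x. if x \<in> A then f x else g x) = P f" for f g by (rule P) simp
  have Q': "Q (\<lambda>x. if x \<in> A then f x else g x) = Q g" for f g by (rule Q) simp
  have "measure_pmf.prob (Pi_pmf B dflt p) {g. P g \<and> Q g} = measure_pmf.prob (pair_pmf ?M ?N) {(f, g). P f \<and> Q g}"
    unfolding split measure_map_pmf by (rule arg_cong[where f = "measure_pmf.prob _"]) (auto simp: P' Q')
  moreover have "measure_pmf.prob (Pi_pmf B dflt p) {g. P g} = measure_pmf.prob (pair_pmf ?M ?N) {(f, g). P f \<and> True}"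
    unfolding split measure_map_pmf by (rule arg_cong[where f = "measure_pmf.prob _"]) (auto simp: P')
  moreover have "measure_pmf.prob (Pi_pmf B dflt p) {g. Q g} = measure_pmf.prob (pair_pmf ?M ?N) {(f, g). True \<and> Q g}"
    unfolding split measure_map_pmf by (rule arg_cong[where f = "measure_pmf.prob _"]) (auto simp: Q')
  ultimately show ?thesis unfolding pair_pmf_prob_times by simp
qed

lemma Pi_pmf_prob_Ball:
  assumes fin: "finite B" and "finite M" and S: "\<And>x. x \<in> M \<Longrightarrow> S x \<subseteq> B"
    and disj: "\<And>x y. x \<in> M \<Longrightarrow> y \<in> M \<Longrightarrow> x \<noteq> y \<Longrightarrow> S x \<inter> S y = {}"
    and P: "\<And>x g g'. x \<in> M \<Longrightarrow> (\<And>e. e \<in> S x \<Longrightarrow> g e = g' e) \<Longrightarrow> P x g = P x g'"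
  shows "measure_pmf.prob (Pi_pmf B dflt p) {g. \<forall>x\<in>M. P x g} =
    (\<Prod>x\<in>M. measure_pmf.prob (Pi_pmf B dflt p) {g. P x g})"
  using \<open>finite M\<close> S disj P
proof (induction M)
  case empty
  then show ?case by simp
next
  case (insert x M)
  have "measure_pmf.prob (Pi_pmf B dflt p) {g. \<forall>y\<in>insert x M. P y g} =
      measure_pmf.prob (Pi_pmf B dflt p) {g. P x g \<and> (\<forall>y\<in>M. P y g)}" by simp
  also have "\<dots> = measure_pmf.prob (Pi_pmf B dflt p) {g. P x g} *
      measure_pmf.prob (Pi_pmf B dflt p) {g. \<forall>y\<in>M. P y g}"
  proof (rule Pi_pmf_prob_conj[OF fin, where A = "S x"])
    show "S x \<subseteq> B" using insert.prems(1) by simp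
    show "P x g = P x g'" if "\<And>e. e \<in> S x \<Longrightarrow> g e = g' e" for g g' using insert.prems(3)[of x g g'] that by simp
    show "(\<forall>y\<in>M. P y g) = (\<forall>y\<in>M. P y g')" if gg: "\<And>e. e \<in> B - S x \<Longrightarrow> g e = g' e" for g g'
    proof (rule ball_cong)
      fix y assume y: "y \<in> M"
      then have "S y \<subseteq> B - S x" using insert.prems(1)[of y] insert.prems(2)[of x y] insert.hyps(2) by blast
      then show "P y g = P y g'" using insert.prems(3)[of y g g'] y gg by blast
    qed simp
  qed
  also have "measure_pmf.prob (Pi_pmf B dflt p) {g. \<forall>y\<in>M. P y g} =
      (\<Prod>x\<in>M. measure_pmf.prob (Pi_pmf B dflt p) {g. P x g})"
  proof (rule insert.IH)
    show "S y \<subseteq> B" if "y \<in> M" for y using insert.prems(1)[of y] that by simp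
    show "S y \<inter> S z = {}" if "y \<in> M" "z \<in> M" "y \<noteq> z" for y z using insert.prems(2)[of y z] that by simp
    show "P y g = P y g'" if "y \<in> M" "\<And>e. e \<in> S y \<Longrightarrow> g e = g' e" for y g g'
      using insert.prems(3)[of y g g'] that by simp
  qed
  finally show ?case using insert.hyps by simp
qed

lemma Pi_pmf_bernoulli_component:
  assumes "finite B" "e \<in> B" "0 \<le> p" "p \<le> 1"
  shows "measure_pmf.prob (Pi_pmf B False (\<lambda>_. bernoulli_pmf p)) {g. g e = b} = (if b then p else 1 - p)"
proof -
  have "measure_pmf.prob (Pi_pmf B False (\<lambda>_. bernoulli_pmf p)) {g. g e = b} =
      pmf (map_pmf (\<lambda>g. g e) (Pi_pmf B False (\<lambda>_. bernoulli_pmf p))) b"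
    by (simp add: pmf_map vimage_def)
  also have "\<dots> = pmf (bernoulli_pmf p) b" using assms by (simp add: Pi_pmf_component)
  finally show ?thesis using assms by simp
qed

text \<open>The candidates \<open>w \<in> C\<close> for the next vertex are tested independently, because the edges
  from different \<open>w\<close> to the embedded vertices \<open>\<psi> i\<close> are different.\<close>

lemma no_extension_prob:
  fixes G :: "nat \<Rightarrow> bool"
  assumes B: "finite B" and C: "finite C" and p: "0 \<le> p" "p \<le> 1"
    and inj: "inj_on \<psi> {..<k}" and sep: "\<And>i. i < k \<Longrightarrow> \<psi> i \<notin> C"
    and edges: "\<And>i w. i < k \<Longrightarrow> w \<in> C \<Longrightarrow> {\<psi> i, w} \<in> B"
  shows "measure_pmf.prob (Pi_pmf B False (\<lambda>_. bernoulli_pmf p)) {g. \<forall>w\<in>C. \<not> (\<forall>i<k. g {\<psi> i, w} = G i)} =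
    (1 - (\<Prod>i<k. if G i then p else 1 - p)) ^ card C"
proof -
  let ?M = "Pi_pmf B False (\<lambda>_. bernoulli_pmf p)"
  have one: "measure_pmf.prob ?M {g. \<forall>i\<in>{..<k}. g {\<psi> i, w} = G i} = (\<Prod>i<k. if G i then p else 1 - p)"
    if w: "w \<in> C" for w
  proof -
    have "measure_pmf.prob ?M {g. \<forall>i\<in>{..<k}. g {\<psi> i, w} = G i} =
        (\<Prod>i\<in>{..<k}. measure_pmf.prob ?M {g. g {\<psi> i, w} = G i})"
      using edges[OF _ w] inj w sep
      by (intro Pi_pmf_prob_Ball[OF B, where S = "\<lambda>i. {{\<psi> i, w}}"]) (auto simp: doubleton_eq_iff inj_on_def)
    then show ?thesis using edges[OF _ w] B p by (simp add: Pi_pmf_bernoulli_component)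
  qed
  have "measure_pmf.prob ?M {g. \<forall>w\<in>C. \<not> (\<forall>i<k. g {\<psi> i, w} = G i)} =
      (\<Prod>w\<in>C. measure_pmf.prob ?M {g. \<not> (\<forall>i<k. g {\<psi> i, w} = G i)})"
  proof (rule Pi_pmf_prob_Ball[OF B C, where S = "\<lambda>w. (\<lambda>i. {\<psi> i, w}) ` {..<k}"])
    show "(\<lambda>i. {\<psi> i, w}) ` {..<k} \<subseteq> B" if "w \<in> C" for w using edges that by auto
    show "(\<lambda>i. {\<psi> i, w}) ` {..<k} \<inter> (\<lambda>i. {\<psi> i, w'}) ` {..<k} = {}" if "w \<in> C" "w' \<in> C" "w \<noteq> w'" for w w'
      using that sep by (auto simp: doubleton_eq_iff)
    show "(\<not> (\<forall>i<k. g {\<psi> i, w} = G i)) = (\<not> (\<forall>i<k. g' {\<psi> i, w} = G i))"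
      if "\<And>e. e \<in> (\<lambda>i. {\<psi> i, w}) ` {..<k} \<Longrightarrow> g e = g' e" for w g g'
      using that by auto
  qed
  also have "\<dots> = (\<Prod>w\<in>C. 1 - (\<Prod>i<k. if G i then p else 1 - p))"
  proof (rule prod.cong[OF refl])
    fix w assume w: "w \<in> C"
    have "measure_pmf.prob ?M {g. \<not> (\<forall>i<k. g {\<psi> i, w} = G i)} = 1 - measure_pmf.prob ?M {g. \<forall>i<k. g {\<psi> i, w} = G i}"
      using measure_pmf.prob_compl[of "{g. \<forall>i<k. g {\<psi> i, w} = G i}" ?M] by (simp add: Compl_eq_Diff_UNIV[symmetric] Collect_neg_eq[symmetric])
    then show "measure_pmf.prob ?M {g. \<not> (\<forall>i<k. g {\<psi> i, w} = G i)} = 1 - (\<Prod>i<k. if G i then p else 1 - p)"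
      using one[OF w] by (simp add: Ball_def)
  qed
  finally show ?thesis by simp
qed

text \<open>The edges contribute at most d factors p, and each of the at most v non-edges a factor 1
  - p \<ge> \<epsilon>. Both p and \<epsilon> are at most 1, so raising the exponents only lowers
  the product.\<close>

lemma prod_edge_prob_ge:
  fixes p \<epsilon> :: real
  assumes p: "0 \<le> p" "p \<le> 1 - \<epsilon>" and \<epsilon>: "0 < \<epsilon>" and d: "card {i. i < k \<and> G i} \<le> d" and kv: "k \<le> v"
  shows "p ^ d * \<epsilon> ^ v \<le> (\<Prod>i<k. if G i then p else 1 - p)"
proof -
  have S: "{..<k} \<inter> {i. G i} = {i. i < k \<and> G i}" by auto
  have "(\<Prod>i<k. if G i then p else 1 - p) = (\<Prod>i\<in>{..<k} \<inter> {i. G i}. p) * (\<Prod>i\<in>{..<k} \<inter> - {i. G i}. 1 - p)"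
    by (rule prod.If_cases) simp
  also have "\<dots> = p ^ card {i. i < k \<and> G i} * (1 - p) ^ card ({..<k} \<inter> - {i. G i})" by (simp add: S)
  also have "\<dots> \<ge> p ^ d * \<epsilon> ^ v"
  proof (rule mult_mono)
    show "p ^ d \<le> p ^ card {i. i < k \<and> G i}" using p \<epsilon> d by (intro power_decreasing) auto
    have "card ({..<k} \<inter> - {i. G i}) \<le> card {..<k}" by (rule card_mono) auto
    then have "card ({..<k} \<inter> - {i. G i}) \<le> v" using kv by simp
    then have "\<epsilon> ^ v \<le> \<epsilon> ^ card ({..<k} \<inter> - {i. G i})" using p \<epsilon> by (intro power_decreasing) auto
    also have "\<dots> \<le> (1 - p) ^ card ({..<k} \<inter> - {i. G i})" using p \<epsilon> by (intro power_mono) auto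
    finally show "\<epsilon> ^ v \<le> (1 - p) ^ card ({..<k} \<inter> - {i. G i})" .
  qed (use p \<epsilon> in auto)
  finally show ?thesis .
qed

text \<open>The equality with G governs edges and non-edges alike, so the copy is induced. The
  blocks are disjoint and increasing, which makes \<psi> strictly increasing and hence
  injective.\<close>

definition block_embedding :: "nat \<Rightarrow> (nat \<Rightarrow> nat \<Rightarrow> bool) \<Rightarrow> nat \<Rightarrow> (nat set \<Rightarrow> bool) \<Rightarrow> (nat \<Rightarrow> nat) \<Rightarrow> bool" where
  "block_embedding N G k h \<psi> \<longleftrightarrow> (\<forall>i<k. \<psi> i \<in> {i * N + 1..i * N + N}) \<and>
     (\<forall>j<k. \<forall>i<j. h {\<psi> i, \<psi> j} = G i j)"

lemma block_less:
  fixes i j N :: nat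
  assumes "i < j" "x \<in> {i * N + 1..i * N + N}" "y \<in> {j * N + 1..j * N + N}"
  shows "x < y"
proof -
  have "Suc i * N \<le> j * N" using assms(1) by (intro mult_le_mono1) simp
  then show ?thesis using assms(2,3) by simp
qed

lemma block_upper:
  fixes i k N :: nat
  assumes "i < k" "x \<in> {i * N + 1..i * N + N}"
  shows "x \<in> {1..k * N}"
proof -
  have "Suc i * N \<le> k * N" using assms(1) by (intro mult_le_mono1) simp
  then show ?thesis using assms(2) by simp
qed

lemma block_embedding_less: "block_embedding N G k h \<psi> \<Longrightarrow> i < j \<Longrightarrow> j < k \<Longrightarrow> \<psi> i < \<psi> j"
  using block_less[of i j "\<psi> i" N "\<psi> j"] by (simp add: block_embedding_def)

lemma block_embedding_inj:
  assumes "block_embedding N G k h \<psi>"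
  shows "inj_on \<psi> {..<k}"
proof (rule inj_onI)
  fix i j assume "i \<in> {..<k}" "j \<in> {..<k}" "\<psi> i = \<psi> j"
  then show "i = j" using block_embedding_less[OF assms, of i j] block_embedding_less[OF assms, of j i]
    by (cases i j rule: linorder_cases) auto
qed

text \<open>Embedding into the first k blocks reveals only edges inside them; the edges to the next
  block remain fresh.\<close>

lemma block_embedding_cong:
  assumes "\<And>e. e \<in> potential_edges (k * N) \<Longrightarrow> h e = h' e"
  shows "block_embedding N G k h \<psi> = block_embedding N G k h' \<psi>"
  unfolding block_embedding_def
proof (intro conj_cong refl all_cong imp_cong)
  fix i j assume b: "\<forall>i<k. \<psi> i \<in> {i * N + 1..i * N + N}" and ij: "j < k" "i < j"
  have "\<psi> i < \<psi> j" using b ij by (intro block_less[OF ij(2)]) auto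
  moreover have "\<psi> i \<in> {1..k * N}" "\<psi> j \<in> {1..k * N}" using b ij by (meson block_upper less_trans)+
  ultimately have "{\<psi> i, \<psi> j} \<in> potential_edges (k * N)" by (simp add: potential_edges_def)
  then show "(h {\<psi> i, \<psi> j} = G i j) = (h' {\<psi> i, \<psi> j} = G i j)" using assms by simp
qed

lemma finite_potential_edges: "finite (potential_edges n)"
  by (rule finite_subset[of _ "Pow {1..n}"]) (auto simp: potential_edges_def)

text \<open>Induction on k. The edges inside the first k blocks (f) are independent of all others
  (g). If f admits an embedding of the first k vertices, then for fixed f each of the N vertices of
  the next block extends it with at least the stated probability, independently of one another. Each
  step thus adds one failure probability to the union bound.\<close>

lemma block_embedding_prob:
  fixes p \<epsilon> :: real
  assumes p: "0 \<le> p" "p \<le> 1 - \<epsilon>" and \<epsilon>: "0 < \<epsilon>" and d: "\<And>k. card {i. i < k \<and> G i k} \<le> d"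
    and n: "v * N \<le> n" and kv: "k \<le> v"
  shows "measure_pmf.prob (Pi_pmf (potential_edges n) False (\<lambda>_. bernoulli_pmf p))
     {h. \<not> (\<exists>\<psi>. block_embedding N G k h \<psi>)} \<le> real k * (1 - p ^ d * \<epsilon> ^ v) ^ N"
  using kv
proof (induction k)
  case 0
  have "block_embedding N G 0 h \<psi>" for h \<psi> by (simp add: block_embedding_def)
  then show ?case by simp
next
  case (Suc k)
  let ?\<pi> = "p ^ d * \<epsilon> ^ v"
  let ?U = "potential_edges n" and ?A = "potential_edges (k * N)" and ?C = "{k * N + 1..k * N + N}"
  let ?M = "\<lambda>B. Pi_pmf B False (\<lambda>_. bernoulli_pmf p)"
  \<comment> \<open>The partial embedding has to be a function of f alone. Conditioned on f it is
    then fixed, and \<open>R f g\<close> is an event about g only.\<close>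
  define \<Psi> where "\<Psi> f = (SOME \<psi>. block_embedding N G k f \<psi>)" for f
  define R where "R f g \<longleftrightarrow> (\<exists>\<psi>. block_embedding N G k f \<psi>) \<and> (\<forall>w\<in>?C. \<not> (\<forall>i<k. g {\<Psi> f i, w} = G i k))" for f g
  have p1: "p \<le> 1" using p \<epsilon> by simp
  have "?\<pi> \<le> (\<Prod>i<k. if G i k then p else 1 - p)"
    using Suc.prems by (intro prod_edge_prob_ge[OF p \<epsilon> d]) simp
  moreover have "(\<Prod>i<k. if G i k then p else 1 - p) \<le> 1"
    by (rule prod_le_1) (use p(1) p1 in auto)
  ultimately have \<pi>: "?\<pi> \<le> (\<Prod>i<k. if G i k then p else 1 - p)" "(\<Prod>i<k. if G i k then p else 1 - p) \<le> 1" by auto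
  have Nn: "Suc k * N \<le> n" using mult_le_mono1[OF Suc.prems, of N] n by simp
  then have AU: "?A \<subseteq> ?U" by (auto simp: potential_edges_def)
  have split: "?M ?U = map_pmf (\<lambda>(f, g) x. if x \<in> ?A then f x else g x) (pair_pmf (?M ?A) (?M (?U - ?A)))"
    using Pi_pmf_union[of ?A "?U - ?A" False "\<lambda>_. bernoulli_pmf p"] AU finite_potential_edges
    by (simp add: Un_absorb1)
  have Rle: "measure_pmf.prob (?M (?U - ?A)) {g. R f g} \<le> (1 - ?\<pi>) ^ N" for f
  proof (cases "\<exists>\<psi>. block_embedding N G k f \<psi>")
    case False
    then show ?thesis using \<pi> by (simp add: R_def)
  next
    case True
    then have emb: "block_embedding N G k f (\<Psi> f)" unfolding \<Psi>_def by (rule someI_ex)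
    have up: "\<Psi> f i \<in> {1..k * N}" if "i < k" for i
      using emb that by (intro block_upper[OF that]) (simp add: block_embedding_def)
    have "measure_pmf.prob (?M (?U - ?A)) {g. R f g} =
        measure_pmf.prob (?M (?U - ?A)) {g. \<forall>w\<in>?C. \<not> (\<forall>i<k. g {\<Psi> f i, w} = G i k)}"
      using True by (simp add: R_def)
    also have "\<dots> = (1 - (\<Prod>i<k. if G i k then p else 1 - p)) ^ card ?C"
    proof (rule no_extension_prob[OF _ _ p(1) p1 block_embedding_inj[OF emb]])
      show "\<Psi> f i \<notin> ?C" if "i < k" for i using up[OF that] by auto
      show "{\<Psi> f i, w} \<in> ?U - ?A" if "i < k" "w \<in> ?C" for i w
        using up[OF that(1)] that(2) Nn by (auto simp: potential_edges_def)
    qed (simp_all add: finite_potential_edges)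
    also have "\<dots> \<le> (1 - ?\<pi>) ^ N" using \<pi> by (simp add: power_mono)
    finally show ?thesis .
  qed
  \<comment> \<open>If no embedding of k + 1 vertices exists, either the first k cannot be embedded,
    or the particular embedding chosen from f does not extend.\<close>
  have ext: "R f g \<or> \<not> (\<exists>\<psi>. block_embedding N G k h \<psi>)"
    if no: "\<not> (\<exists>\<psi>. block_embedding N G (Suc k) h \<psi>)" and h: "h = (\<lambda>x. if x \<in> ?A then f x else g x)" for f g h
  proof (rule disjCI)
    assume "\<not> \<not> (\<exists>\<psi>. block_embedding N G k h \<psi>)"
    moreover have hf: "block_embedding N G k h \<psi> = block_embedding N G k f \<psi>" for \<psi>
      by (rule block_embedding_cong) (simp add: h)
    ultimately have ex: "\<exists>\<psi>. block_embedding N G k f \<psi>" by simp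
    then have emb: "block_embedding N G k h (\<Psi> f)" unfolding \<Psi>_def hf by (rule someI_ex)
    have up: "\<Psi> f i \<in> {1..k * N}" if "i < k" for i
      using emb that by (intro block_upper[OF that]) (simp add: block_embedding_def)
    have "\<not> (\<forall>i<k. g {\<Psi> f i, w} = G i k)" if w: "w \<in> ?C" for w
    proof
      assume new: "\<forall>i<k. g {\<Psi> f i, w} = G i k"
      have "h {\<Psi> f i, w} = G i k" if "i < k" for i
        using new that up[OF that] w by (auto simp: h potential_edges_def)
      then have "block_embedding N G (Suc k) h ((\<Psi> f)(k := w))"
        using emb w unfolding block_embedding_def by (auto simp: less_Suc_eq)
      then show False using no by blast
    qed
    then show "R f g" using ex by (simp add: R_def)
  qed
  have "measure_pmf.prob (?M ?U) {h. \<not> (\<exists>\<psi>. block_embedding N G (Suc k) h \<psi>)} =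
      measure_pmf.prob (pair_pmf (?M ?A) (?M (?U - ?A)))
        {(f, g). \<not> (\<exists>\<psi>. block_embedding N G (Suc k) (\<lambda>x. if x \<in> ?A then f x else g x) \<psi>)}"
    unfolding split measure_map_pmf by (rule arg_cong[where f = "measure_pmf.prob _"]) auto
  also have "\<dots> \<le> measure_pmf.prob (pair_pmf (?M ?A) (?M (?U - ?A)))
      ({(f, g). R f g} \<union> {(f, g). \<not> (\<exists>\<psi>. block_embedding N G k (\<lambda>x. if x \<in> ?A then f x else g x) \<psi>)})"
    by (rule measure_pmf.finite_measure_mono) (use ext in blast, simp)
  also have "\<dots> \<le> measure_pmf.prob (pair_pmf (?M ?A) (?M (?U - ?A))) {(f, g). R f g} +
      measure_pmf.prob (pair_pmf (?M ?A) (?M (?U - ?A)))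
        {(f, g). \<not> (\<exists>\<psi>. block_embedding N G k (\<lambda>x. if x \<in> ?A then f x else g x) \<psi>)}"
    by (rule measure_Un_le) simp_all
  also have "measure_pmf.prob (pair_pmf (?M ?A) (?M (?U - ?A)))
        {(f, g). \<not> (\<exists>\<psi>. block_embedding N G k (\<lambda>x. if x \<in> ?A then f x else g x) \<psi>)} =
      measure_pmf.prob (?M ?U) {h. \<not> (\<exists>\<psi>. block_embedding N G k h \<psi>)}"
    unfolding split measure_map_pmf by (rule arg_cong[where f = "measure_pmf.prob _"]) auto
  also have "\<dots> \<le> real k * (1 - ?\<pi>) ^ N" using Suc by simp
  also have "measure_pmf.prob (pair_pmf (?M ?A) (?M (?U - ?A))) {(f, g). R f g} \<le> (1 - ?\<pi>) ^ N"
    by (rule pair_pmf_prob_le[OF _ Rle]) (use \<pi> in simp)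
  finally show ?case by (simp add: algebra_simps)
qed

text \<open>By 1 - t \<le> exp (- t) it suffices that p ^ 5 * (n div v) tends to infinity. The sixth
  power of the growth hypothesis makes n * p ^ 6 tend to infinity, and p ^ 6 \<le> p ^ 5 passes from
  one exponent to the other.\<close>

lemma exp_bound_tendsto_0:
  fixes p :: "nat \<Rightarrow> real" and \<epsilon> :: real
  assumes \<epsilon>: "\<epsilon> > 0" and p: "\<And>n. 0 \<le> p n \<and> p n \<le> 1 - \<epsilon>"
    and o: "(\<lambda>n. real n powr (- 1 / 6)) \<in> o(p)" and v: "v > 0"
  shows "(\<lambda>n. real v * (1 - p n ^ 5 * \<epsilon> ^ v) ^ (n div v)) \<longlonglongrightarrow> 0"
proof -
  have p1: "p n \<le> 1" for n using p[of n] \<epsilon> by linarith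
  have np: "filterlim (\<lambda>n. real n * p n ^ 6) at_top sequentially"
    unfolding filterlim_at_top_gt[where c = 0]
  proof (intro allI impI)
    fix Z :: real assume Z: "Z > 0"
    \<comment> \<open>With this c the sixth power of \<open>n powr (- 1 / 6) \<le> c * p n\<close>
      reads 1 / n \<le> p ^ 6 / Z.\<close>
    define c where "c = Z powr (- 1 / 6)"
    have c: "c > 0" using Z by (simp add: c_def)
    have "\<forall>\<^sub>F n in sequentially. norm (real n powr (- 1 / 6)) \<le> c * norm (p n)"
      using landau_o.smallD[OF o c] .
    then show "\<forall>\<^sub>F n in sequentially. Z \<le> real n * p n ^ 6"
      using eventually_gt_at_top[of 0]
    proof eventually_elim
      case (elim n)
      have six: "(x powr (- 1 / 6)) ^ 6 = 1 / x" if "x > 0" for x :: real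
      proof -
        have "(x powr (- 1 / 6)) ^ 6 = (x powr (- 1 / 6)) powr (real 6)" using that by (subst powr_realpow) auto
        also have "\<dots> = x powr - 1" unfolding powr_powr by simp
        also have "\<dots> = 1 / x" using that by (simp add: powr_minus_divide)
        finally show ?thesis .
      qed
      have "(real n powr (- 1 / 6)) ^ 6 \<le> (c * p n) ^ 6" using elim p[of n] by (intro power_mono) auto
      then have "1 / real n \<le> (1 / Z) * p n ^ 6"
        using six[of "real n"] six[of Z] elim Z by (simp add: power_mult_distrib c_def)
      then show ?case using elim Z by (simp add: field_simps)
    qed
  qed
  have "filterlim (\<lambda>n. \<epsilon> ^ v / real v * (real n * p n ^ 6)) at_top sequentially"
    by (rule filterlim_tendsto_pos_mult_at_top[OF tendsto_const _ np]) (use v \<epsilon> in simp)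
  from filterlim_tendsto_add_at_top[OF tendsto_const[of "- (\<epsilon> ^ v)"] this]
  have lim: "filterlim (\<lambda>n. \<epsilon> ^ v * ((1 / real v) * (real n * p n ^ 6) - 1)) at_top sequentially"
    by (simp add: algebra_simps)
  have "(\<lambda>n. real v * exp (- (\<epsilon> ^ v * ((1 / real v) * (real n * p n ^ 6) - 1)))) \<longlonglongrightarrow> real v * 0"
    by (intro tendsto_mult tendsto_const filterlim_compose[OF exp_at_bot] filterlim_compose[OF filterlim_uminus_at_bot_at_top lim])
  then have top: "(\<lambda>n. real v * exp (- (\<epsilon> ^ v * ((1 / real v) * (real n * p n ^ 6) - 1)))) \<longlonglongrightarrow> 0" by simp
  have \<epsilon>1: "\<epsilon> \<le> 1" using p[of 0] by linarith
  have \<pi>: "0 \<le> p n ^ 5 * \<epsilon> ^ v" "p n ^ 5 * \<epsilon> ^ v \<le> 1" for n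
    using p[of n] p1[of n] \<epsilon> \<epsilon>1 by (auto intro!: mult_le_one power_le_one)
  show ?thesis
  proof (rule tendsto_sandwich[OF _ _ tendsto_const top])
    show "\<forall>\<^sub>F n in sequentially. 0 \<le> real v * (1 - p n ^ 5 * \<epsilon> ^ v) ^ (n div v)"
      using \<pi> by (intro always_eventually allI) simp
    show "\<forall>\<^sub>F n in sequentially. real v * (1 - p n ^ 5 * \<epsilon> ^ v) ^ (n div v) \<le>
        real v * exp (- (\<epsilon> ^ v * ((1 / real v) * (real n * p n ^ 6) - 1)))"
    proof (intro always_eventually allI mult_left_mono)
      fix n
      \<comment> \<open>Rounding in n div v loses at most 1. After multiplication by p ^ 5 \<le> 1
        the loss is still at most 1, which is the subtracted 1 in the exponent.\<close>
      have "real n / real v - 1 \<le> real (n div v)"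
        using floor_divide_of_nat_eq[of n v, where ?'a = real] by linarith
      then have "p n ^ 5 * (real n / real v - 1) \<le> p n ^ 5 * real (n div v)" using p[of n] by (intro mult_left_mono) auto
      moreover have "p n ^ 6 \<le> p n ^ 5" using p[of n] p1[of n] by (intro power_decreasing) auto
      then have "real n / real v * p n ^ 6 \<le> real n / real v * p n ^ 5" by (intro mult_left_mono) auto
      moreover have "p n ^ 5 \<le> 1" using p[of n] p1[of n] by (intro power_le_one) auto
      ultimately have "(1 / real v) * (real n * p n ^ 6) - 1 \<le> p n ^ 5 * real (n div v)"
        by (simp add: algebra_simps)
      then have "\<epsilon> ^ v * ((1 / real v) * (real n * p n ^ 6) - 1) \<le> \<epsilon> ^ v * (p n ^ 5 * real (n div v))"
        using \<epsilon> by (intro mult_left_mono) auto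
      then have e: "exp (- (p n ^ 5 * \<epsilon> ^ v * real (n div v))) \<le> exp (- (\<epsilon> ^ v * ((1 / real v) * (real n * p n ^ 6) - 1)))"
        by (simp add: algebra_simps)
      have "(1 - p n ^ 5 * \<epsilon> ^ v) ^ (n div v) \<le> exp (- (p n ^ 5 * \<epsilon> ^ v)) ^ (n div v)"
        using \<pi>[of n] exp_ge_add_one_self[of "- (p n ^ 5 * \<epsilon> ^ v)"] by (intro power_mono) auto
      also have "\<dots> = exp (- (p n ^ 5 * \<epsilon> ^ v * real (n div v)))"
        by (simp add: exp_of_nat_mult[symmetric] algebra_simps)
      finally show "(1 - p n ^ 5 * \<epsilon> ^ v) ^ (n div v) \<le> exp (- (\<epsilon> ^ v * ((1 / real v) * (real n * p n ^ 6) - 1)))"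
        using e by linarith
    qed simp
  qed
qed

section \<open>Torsion with high probability\<close>

lemma embedding_extends_has_torsion:
  assumes l: "Factorial_Ring.prime l" and n: "(4 * l + 5) * N \<le> n"
    and emb: "block_embedding N (moore_graph l) (4 * l + 5) h \<psi>"
  shows "has_torsion l n (clique_complex n {e \<in> potential_edges n. h e})"
proof (rule has_torsion_of_copy[OF l block_embedding_inj[OF emb]])
  have up: "\<psi> i \<in> {1..n}" if "i < 4 * l + 5" for i
    using emb n block_upper[OF that, of "\<psi> i" N] that by (auto simp: block_embedding_def)
  then show "\<psi> ` {..<4 * l + 5} \<subseteq> {1..n}" by auto
  fix k k' assume k: "k < k'" "k' < 4 * l + 5"
  have "\<psi> k < \<psi> k'" by (rule block_embedding_less[OF emb k])
  then have "{\<psi> k, \<psi> k'} \<in> potential_edges n"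
    using up[OF k(2)] up[OF less_trans[OF k]] by (simp add: potential_edges_def)
  then show "({\<psi> k, \<psi> k'} \<in> {e \<in> potential_edges n. h e}) = moore_graph l k k'"
    using emb k by (simp add: block_embedding_def)
qed

lemma no_torsion_prob_tendsto_0:
  fixes \<epsilon> :: real and p :: "nat \<Rightarrow> real"
  assumes \<epsilon>: "\<epsilon> > 0" and p: "\<And>n. 0 \<le> p n \<and> p n \<le> 1 - \<epsilon>"
    and o: "(\<lambda>n. real n powr (- 1 / 6)) \<in> o(p)" and l: "Factorial_Ring.prime l"
  shows "(\<lambda>n. measure_pmf.prob (random_flag_complex n (p n)) {\<Delta>. \<not> has_torsion l n \<Delta>}) \<longlonglongrightarrow> 0"
proof (rule tendsto_sandwich[OF _ _ tendsto_const exp_bound_tendsto_0[OF \<epsilon> p o]])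
  let ?v = "4 * l + 5"
  show "?v > 0" by simp
  show "\<forall>\<^sub>F n in sequentially. measure_pmf.prob (random_flag_complex n (p n)) {\<Delta>. \<not> has_torsion l n \<Delta>} \<le>
      real ?v * (1 - p n ^ 5 * \<epsilon> ^ ?v) ^ (n div ?v)"
  proof (intro always_eventually allI)
    fix n
    let ?M = "Pi_pmf (potential_edges n) False (\<lambda>_. bernoulli_pmf (p n))"
    have N: "?v * (n div ?v) \<le> n" by (rule times_div_less_eq_dividend)
    have "measure_pmf.prob (random_flag_complex n (p n)) {\<Delta>. \<not> has_torsion l n \<Delta>} =
        measure_pmf.prob ?M {h. \<not> has_torsion l n (clique_complex n {e \<in> potential_edges n. h e})}"
      by (simp add: random_flag_complex_def random_graph_def vimage_def)
    also have "\<dots> \<le> measure_pmf.prob ?M {h. \<not> (\<exists>\<psi>. block_embedding (n div ?v) (moore_graph l) ?v h \<psi>)}"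
      by (rule measure_pmf.finite_measure_mono) (use embedding_extends_has_torsion[OF l N] in blast, simp)
    also have "\<dots> \<le> real ?v * (1 - p n ^ 5 * \<epsilon> ^ ?v) ^ (n div ?v)"
      by (rule block_embedding_prob) (use p \<epsilon> N moore_graph_back_degree in auto)
    finally show "measure_pmf.prob (random_flag_complex n (p n)) {\<Delta>. \<not> has_torsion l n \<Delta>} \<le>
      real ?v * (1 - p n ^ 5 * \<epsilon> ^ ?v) ^ (n div ?v)" .
  qed
qed simp

lemma all_torsion_prob_tendsto_1:
  fixes \<epsilon> :: real and p :: "nat \<Rightarrow> real"
  assumes \<epsilon>: "\<epsilon> > 0" and p: "\<And>n. 0 \<le> p n \<and> p n \<le> 1 - \<epsilon>"
    and o: "(\<lambda>n. real n powr (- 1 / 6)) \<in> o(p)"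
    and L: "finite L" "\<And>l. l \<in> L \<Longrightarrow> Factorial_Ring.prime l"
  shows "(\<lambda>n. measure_pmf.prob (random_flag_complex n (p n)) {\<Delta>. \<forall>l\<in>L. has_torsion l n \<Delta>}) \<longlonglongrightarrow> 1"
proof (rule tendsto_sandwich[where h = "\<lambda>_. 1"])
  let ?P = "\<lambda>n. measure_pmf.prob (random_flag_complex n (p n))"
  have "(\<lambda>n. 1 - (\<Sum>l\<in>L. ?P n {\<Delta>. \<not> has_torsion l n \<Delta>})) \<longlonglongrightarrow> 1 - (\<Sum>l\<in>L. 0)"
    using no_torsion_prob_tendsto_0[OF \<epsilon> p o L(2)] by (intro tendsto_intros)
  then show "(\<lambda>n. 1 - (\<Sum>l\<in>L. ?P n {\<Delta>. \<not> has_torsion l n \<Delta>})) \<longlonglongrightarrow> 1" by simp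
  show "\<forall>\<^sub>F n in sequentially. 1 - (\<Sum>l\<in>L. ?P n {\<Delta>. \<not> has_torsion l n \<Delta>}) \<le> ?P n {\<Delta>. \<forall>l\<in>L. has_torsion l n \<Delta>}"
  proof (intro always_eventually allI)
    fix n
    have "1 - ?P n {\<Delta>. \<forall>l\<in>L. has_torsion l n \<Delta>} = ?P n (- {\<Delta>. \<forall>l\<in>L. has_torsion l n \<Delta>})"
      using measure_pmf.prob_compl[of "{\<Delta>. \<forall>l\<in>L. has_torsion l n \<Delta>}" "random_flag_complex n (p n)"]
      by (simp add: Compl_eq_Diff_UNIV)
    also have "- {\<Delta>. \<forall>l\<in>L. has_torsion l n \<Delta>} = (\<Union>l\<in>L. {\<Delta>. \<not> has_torsion l n \<Delta>})" by auto
    also have "?P n \<dots> \<le> (\<Sum>l\<in>L. ?P n {\<Delta>. \<not> has_torsion l n \<Delta>})"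
      by (rule measure_pmf.finite_measure_subadditive_finite) (simp_all add: L)
    finally show "1 - (\<Sum>l\<in>L. ?P n {\<Delta>. \<not> has_torsion l n \<Delta>}) \<le> ?P n {\<Delta>. \<forall>l\<in>L. has_torsion l n \<Delta>}" by simp
  qed
qed simp_all

theorem theorem1p3:
  fixes \<epsilon> :: real and p :: "nat \<Rightarrow> real"
  assumes "\<epsilon> > 0"
    and "\<And>n. 0 \<le> p n \<and> p n \<le> 1 - \<epsilon>"
    and "(\<lambda>n. real n powr (- 1 / 6)) \<in> o(p)"
  shows "((\<lambda>n. measure_pmf.prob (random_flag_complex n (p n))
              {\<Delta>. depends_on_characteristic n \<Delta>}) \<longlonglongrightarrow> 1) \<and>
    (\<forall>m::nat. m \<ge> 2 \<longrightarrow>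
       (\<lambda>n. measure_pmf.prob (random_flag_complex n (p n))
              {\<Delta>. \<forall>l. Factorial_Ring.prime l \<and> l dvd m \<longrightarrow> has_torsion l n \<Delta>}) \<longlonglongrightarrow> 1)"
proof (intro conjI allI impI)
  \<comment> \<open>Torsion for a single prime suffices in the first claim; 2 is taken.\<close>
  have "(\<lambda>n. measure_pmf.prob (random_flag_complex n (p n)) {\<Delta>. \<forall>l\<in>{2}. has_torsion l n \<Delta>}) \<longlonglongrightarrow> 1"
    by (rule all_torsion_prob_tendsto_1[OF assms]) auto
  then show "(\<lambda>n. measure_pmf.prob (random_flag_complex n (p n)) {\<Delta>. depends_on_characteristic n \<Delta>}) \<longlonglongrightarrow> 1"
  proof (rule tendsto_sandwich[where h = "\<lambda>_. 1", rotated 2])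
    show "\<forall>\<^sub>F n in sequentially. measure_pmf.prob (random_flag_complex n (p n)) {\<Delta>. \<forall>l\<in>{2}. has_torsion l n \<Delta>} \<le>
        measure_pmf.prob (random_flag_complex n (p n)) {\<Delta>. depends_on_characteristic n \<Delta>}"
      by (intro always_eventually allI measure_pmf.finite_measure_mono)
        (auto simp: depends_on_characteristic_def intro: two_is_prime_nat)
  qed simp_all
next
  fix m :: nat
  assume m: "m \<ge> 2"
  \<comment> \<open>A union bound over the primes dividing m is possible because m is nonzero and so
    has finitely many divisors.\<close>
  have "finite {l. Factorial_Ring.prime l \<and> l dvd m}"
    by (rule finite_subset[of _ "{..m}"]) (use m in \<open>auto dest: dvd_imp_le\<close>)
  from all_torsion_prob_tendsto_1[OF assms this]
  show "(\<lambda>n. measure_pmf.prob (random_flag_complex n (p n))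
      {\<Delta>. \<forall>l. Factorial_Ring.prime l \<and> l dvd m \<longrightarrow> has_torsion l n \<Delta>}) \<longlonglongrightarrow> 1"
    by simp
qed

end
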